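(* Let $m,n\ge 1$, let $\Phi:\mathbb R^n\to[0,\infty)$ and let $A_1(t),\dots,A_m(t)$ be real $n\times n$ matrices that are invertible for almost every $t$ in the support of $\Phi$. Let $\gamma_1,\dots,\gamma_m\in\mathbb R$, $\gamma=\gamma_1+\cdots+\gamma_m$, $\omega_i(x)=|x|^{\gamma_i}$, $\omega(x)=|x|^{\gamma}$. Let $q_1(\cdot),\dots,q_m(\cdot),q(\cdot)\in\mathcal P_b(\mathbb R^n)$ with $\frac1{q_1(\cdot)}+\cdots+\frac1{q_m(\cdot)}=\frac1{q(\cdot)}$, and $\zeta>0$. Let $\alpha_1,\dots,\alpha_m\in L^\infty(\mathbb R^n)\cap\mathbf C_0^{\log}(\mathbb R^n)\cap\mathbf C_\infty^{\log}(\mathbb R^n)$, $\alpha(\cdot)=\alpha_1(\cdot)+\cdots+\alpha_m(\cdot)$, with $\alpha_i(0)=\alpha_{i\infty}$ for all $i=1,\dots,m$. Let $1\le p,p_1,\dots,p_m<\infty$ with $\frac1{p_1}+\cdots+\frac1{p_m}=\frac1p$. Suppose that for almost every $t\in\operatorname{supp}(\Phi)$ and all $i$, $$q_i(A_i^{-1}(t)\cdot)\le \zeta\, q_i(\cdot)\quad\text{and}\quad \|1\|_{L^{r_i(t,\cdot)}}<\infty,\qquad \text{where } \frac1{r_i(t,\cdot)}=\frac1{q_i(A_i^{-1}(t)\cdot)}-\frac1{\zeta q_i(\cdot)},$$ and that $$\mathcal C_4=\int_{\mathbb R^n}(2-\Theta_n^* )^{m-\frac1p}\frac{\Phi(t)}{|t|^n}\prod_{i=1}^m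 c_{A_i,q_i,\gamma_i}(t)\|1\|_{L^{r_i(t,\cdot)}}\|A_i(t)\|^{-\alpha_i(0)}\Big(\sum_{r=\Theta_n^*-1}^0 2^{-r\alpha_i(0)}\Big)dt<\infty,$$ where $$c_{A_i,q_i,\gamma_i}(t)=\max\{\|A_i(t)\|^{-\gamma_i},\|A_i^{-1}(t)\|^{\gamma_i}\}\,\max\{|\det A_i^{-1}(t)|^{1/q_{i+}},|\det A_i^{-1}(t)|^{1/q_{i-}}\}$$ and $\Theta_n^*=\Theta_n^*(t)$ is the greatest integer satisfying $\max_{i=1,\dots,m}\{\|A_i(t)\|\,\|A_i^{-1}(t)\|\}<2^{-\Theta_n^*}$ for a.e. $t\in\mathbb R^n$. Then $H_{\Phi,\vec A}$ is a bounded operator from $\dot K^{\alpha_1(\cdot),p_1}_{\zeta q_1(\cdot),\omega_1}\times\cdots\times\dot K^{\alpha_m(\cdot),p_m}_{\zeta q_m(\cdot),\omega_m}$ to $\dot K^{\alpha(\cdot),p}_{q(\cdot),\omega}$.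
   Context: All functions and matrix-valued functions are Lebesgue measurable. The multilinear Hausdorff operator is $H_{\Phi,\vec A}(\vec f)(x)=\int_{\mathbb R^n}\frac{\Phi(t)}{|t|^n}\prod_{i=1}^m f_i(A_i(t)x)\,dt$, $x\in\mathbb R^n$, for $\vec f=(f_1,\dots,f_m)$ measurable functions $\mathbb R^n\to\mathbb C$, $\vec A=(A_1,\dots,A_m)$. Bounded means $\|H_{\Phi,\vec A}(\vec f)\|\le C\prod_i\|f_i\|$ with $C$ independent of $\vec f$. For a matrix $A=(a_{ij})$, $\|A\|=(\sum_{i,j}|a_{ij}|^2)^{1/2}$. $\mathcal P(\mathbb R^n)$ is the set of measurable $p(\cdot):\mathbb R^n\to[1,\infty]$. For $p(\cdot)\in\mathcal P(\mathbb R^n)$ let $\Omega_\infty=\{x:p(x)=\infty\}$ and $F_p(g)=\int_{\mathbb R^n\setminus\Omega_\infty}|g(x)|^{p(x)}dx+\|g\|_{L^\infty(\Omega_\infty)}$; $L^{p(\cdot)}=L^{p(\cdot)}(\mathbb R^n)$ is the set of complex-valued measurable $f$ with $F_p(f/\eta)<\infty$ for some $\eta>0$, with norm $\|f\|_{L^{p(\cdot)}}=\inf\{\eta>0:F_p(f/\eta)\le1\}$. For a weight $\omega\ge 0$, $\|f\|_{L^{p(\cdot)}_\omega}=\|f\omega\|_{L^{p(\cdot)}}$. $q_-=\operatorname{ess\,inf}q$, $q_+=\operatorname{ess\,sup}q$ ($q_{i\pm}$ for $q_i$); $\mathcal P_b(\mathbb R^n)$ is the class of $q(\cdot)\in\mathcal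 P(\mathbb R^n)$ with $1<q_-\le q(x)\le q_+<\infty$ for all $x$. In $1/r$, $1/\infty=0$. $\mathbf C_0^{\log}(\mathbb R^n)$: functions $\alpha(\cdot):\mathbb R^n\to\mathbb R$ with $|\alpha(x)-\alpha(0)|\le \frac{C_0^\alpha}{\log(e+1/|x|)}$ for all $x$ and some constant $C_0^\alpha$. $\mathbf C_\infty^{\log}(\mathbb R^n)$: functions with $|\alpha(x)-\alpha_\infty|\le\frac{C_\infty^\alpha}{\log(e+|x|)}$ for all $x$ and some constants $\alpha_\infty$, $C_\infty^\alpha$ (so $\alpha_\infty$ is the limit at infinity; $\alpha_{i\infty}$ denotes it for $\alpha_i$). Let $B_k=\{x:|x|\le2^k\}$, $C_k=B_k\setminus B_{k-1}$, $\chi_k=\chi_{C_k}$, $k\in\mathbb Z$. For $0<p<\infty$, $q(\cdot)\in\mathcal P_b(\mathbb R^n)$, $\alpha(\cdot)\in L^\infty(\mathbb R^n)$, the weighted variable exponent Herz space $\dot K^{\alpha(\cdot),p}_{q(\cdot),\omega}$ is the set of $f\in L^{q(\cdot)}_{\rm loc}(\mathbb R^n\setminus\{0\})$ with $$\|f\|_{\dot K^{\alpha(\cdot),p}_{q(\cdot),\omega}}=\Big(\sum_{k=-\infty}^{\infty}\|2^{k\alpha(\cdot)}f\chi_k\|^p_{L^{q(\cdot)}_\omega}\Big)^{1/p}<\infty.$$ *)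

theory Defs
  imports "HOL-Analysis.Analysis" "HOL-Probability.Essential_Supremum"
begin

section \<open>Variable exponent Lebesgue spaces\<close>

text \<open>
  Exponents take values in \<^typ>\<open>ennreal\<close>, where \<open>inverse \<infinity> = 0\<close>, so that \<open>1 / p(x)\<close> is
  \<open>inverse (p x)\<close>. Measurability is always with respect to \<^const>\<open>lebesgue\<close>.
\<close>

definition variable_exponents :: "(real^'n \<Rightarrow> ennreal) set" where
  "variable_exponents = {p \<in> borel_measurable lebesgue. \<forall>x. 1 \<le> p x}"

definition essinf :: "'a measure \<Rightarrow> ('a \<Rightarrow> ennreal) \<Rightarrow> ennreal" where
  "essinf M f = Liminf (ae_filter M) f"

definition bounded_variable_exponents :: "(real^'n \<Rightarrow> ennreal) set" where
  "bounded_variable_exponents =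
     {q \<in> variable_exponents. 1 < essinf lebesgue q \<and> esssup lebesgue q < \<infinity> \<and>
        (\<forall>x. essinf lebesgue q \<le> q x \<and> q x \<le> esssup lebesgue q)}"

definition Lp_modular :: "(real^'n \<Rightarrow> ennreal) \<Rightarrow> (real^'n \<Rightarrow> complex) \<Rightarrow> ennreal" where
  "Lp_modular p g =
     (\<integral>\<^sup>+x\<in>- {x. p x = \<infinity>}. ennreal (norm (g x) powr enn2real (p x)) \<partial>lebesgue) +
     esssup (restrict_space lebesgue {x. p x = \<infinity>}) (\<lambda>x. ennreal (norm (g x)))"

definition Lp_var :: "(real^'n \<Rightarrow> ennreal) \<Rightarrow> (real^'n \<Rightarrow> complex) set" where
  "Lp_var p = {f \<in> borel_measurable lebesgue.
     \<exists>\<eta>::real. \<eta> > 0 \<and> Lp_modular p (\<lambda>x. f x / of_real \<eta>) < \<infinity>}"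

text \<open>The norm takes the value \<open>\<infinity>\<close> (the infimum of the empty set) outside the space.\<close>

definition Lp_norm :: "(real^'n \<Rightarrow> ennreal) \<Rightarrow> (real^'n \<Rightarrow> complex) \<Rightarrow> ennreal" where
  "Lp_norm p f = Inf {ennreal \<eta> |\<eta>. \<eta> > 0 \<and> Lp_modular p (\<lambda>x. f x / of_real \<eta>) \<le> 1}"

definition weighted_Lp_norm ::
  "(real^'n \<Rightarrow> ennreal) \<Rightarrow> (real^'n \<Rightarrow> real) \<Rightarrow> (real^'n \<Rightarrow> complex) \<Rightarrow> ennreal" where
  "weighted_Lp_norm p \<omega> f = Lp_norm p (\<lambda>x. f x * of_real (\<omega> x))"

definition Lp_loc_punctured :: "(real^'n \<Rightarrow> ennreal) \<Rightarrow> (real^'n \<Rightarrow> complex) set" where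
  "Lp_loc_punctured p = {f \<in> borel_measurable lebesgue.
     \<forall>K. compact K \<and> K \<subseteq> - {0} \<longrightarrow> (\<lambda>x. f x * indicator K x) \<in> Lp_var p}"


section \<open>Regularity classes for the smoothness index\<close>

definition L_infinity :: "(real^'n \<Rightarrow> real) set" where
  "L_infinity = {\<alpha> \<in> borel_measurable lebesgue. esssup lebesgue (\<lambda>x. ennreal \<bar>\<alpha> x\<bar>) < \<infinity>}"

text \<open>At \<open>x = 0\<close> the quotient \<open>1 / norm x\<close> is \<open>0\<close>, not \<open>\<infinity>\<close>; this is harmless, since the
  left-hand side then vanishes and \<open>C \<ge> 0\<close> follows from the other points.\<close>

definition C_log_0 :: "(real^'n \<Rightarrow> real) set" where
  "C_log_0 = {\<alpha>. \<exists>C. \<forall>x. \<bar>\<alpha> x - \<alpha> 0\<bar> \<le> C / ln (exp 1 + 1 / norm x)}"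

definition C_log_infinity :: "(real^'n \<Rightarrow> real) set" where
  "C_log_infinity = {\<alpha>. \<exists>a C. \<forall>x. \<bar>\<alpha> x - a\<bar> \<le> C / ln (exp 1 + norm x)}"


section \<open>Weighted Herz spaces with variable exponents\<close>

text \<open>Only used for \<open>0 < p\<close>, so \<open>\<infinity>\<close> is sent to \<open>\<infinity>\<close>.\<close>

definition ennreal_powr :: "ennreal \<Rightarrow> real \<Rightarrow> ennreal" where
  "ennreal_powr x p = (if x = \<infinity> then \<infinity> else ennreal (enn2real x powr p))"

definition dyadic_shell :: "int \<Rightarrow> (real^'n) set" where
  "dyadic_shell k = cball 0 (2 powi k) - cball 0 (2 powi (k - 1))"

definition herz_norm ::
  "(real^'n \<Rightarrow> real) \<Rightarrow> real \<Rightarrow> (real^'n \<Rightarrow> ennreal) \<Rightarrow> (real^'n \<Rightarrow> real) \<Rightarrow>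
   (real^'n \<Rightarrow> complex) \<Rightarrow> ennreal" where
  "herz_norm \<alpha> p q \<omega> f =
     ennreal_powr
       (\<Sum>\<^sub>\<infinity>k\<in>(UNIV :: int set).
          ennreal_powr
            (weighted_Lp_norm q \<omega>
               (\<lambda>x. of_real (2 powr (of_int k * \<alpha> x)) * f x * indicator (dyadic_shell k) x)) p)
       (1 / p)"

definition herz_space ::
  "(real^'n \<Rightarrow> real) \<Rightarrow> real \<Rightarrow> (real^'n \<Rightarrow> ennreal) \<Rightarrow> (real^'n \<Rightarrow> real) \<Rightarrow>
   (real^'n \<Rightarrow> complex) set" where
  "herz_space \<alpha> p q \<omega> = {f \<in> Lp_loc_punctured q. herz_norm \<alpha> p q \<omega> f < \<infinity>}"


section \<open>The multilinear Hausdorff operator\<close>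

text \<open>The families \<open>f\<close> and \<open>A\<close> are used at the indices \<open>1, \<dots>, m\<close> only.\<close>

definition hausdorff_integrand ::
  "nat \<Rightarrow> (real^'n \<Rightarrow> real) \<Rightarrow> (nat \<Rightarrow> real^'n \<Rightarrow> real^'n^'n) \<Rightarrow>
   (nat \<Rightarrow> real^'n \<Rightarrow> complex) \<Rightarrow> real^'n \<Rightarrow> real^'n \<Rightarrow> complex" where
  "hausdorff_integrand m \<Phi> A f x t =
     of_real (\<Phi> t / norm t ^ CARD('n)) * (\<Prod>i=1..m. f i (A i t *v x))"

definition hausdorff_op ::
  "nat \<Rightarrow> (real^'n \<Rightarrow> real) \<Rightarrow> (nat \<Rightarrow> real^'n \<Rightarrow> real^'n^'n) \<Rightarrow>
   (nat \<Rightarrow> real^'n \<Rightarrow> complex) \<Rightarrow> real^'n \<Rightarrow> complex" where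
  "hausdorff_op m \<Phi> A f x = (LINT t|lebesgue. hausdorff_integrand m \<Phi> A f x t)"


section \<open>Quantities in the sufficient condition\<close>

text \<open>
  The norm of \<^typ>\<open>real^'n^'n\<close> is the square root of the sum of the squared
  entries, i.e. the matrix norm used here.
\<close>

definition supp :: "(real^'n \<Rightarrow> real) \<Rightarrow> (real^'n) set" where
  "supp \<Phi> = closure {t. \<Phi> t \<noteq> 0}"

definition c_const :: "real^'n^'n \<Rightarrow> (real^'n \<Rightarrow> ennreal) \<Rightarrow> real \<Rightarrow> real" where
  "c_const A q \<gamma> =
     max (norm A powr (- \<gamma>)) (norm (matrix_inv A) powr \<gamma>) *
     max (\<bar>det (matrix_inv A)\<bar> powr (1 / enn2real (esssup lebesgue q)))
         (\<bar>det (matrix_inv A)\<bar> powr (1 / enn2real (essinf lebesgue q)))"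

text \<open>The exponent \<open>r\<close> with \<open>1 / r(x) = 1 / q(A\<^sup>-\<^sup>1 x) - 1 / (\<zeta> q(x))\<close>. The truncated subtraction
  of \<^typ>\<open>ennreal\<close> is the true one where \<open>q(A\<^sup>-\<^sup>1 x) \<le> \<zeta> q(x)\<close>, and \<open>r(x) = \<infinity>\<close> where equality
  holds.\<close>

definition r_exponent ::
  "real^'n^'n \<Rightarrow> (real^'n \<Rightarrow> ennreal) \<Rightarrow> real \<Rightarrow> real^'n \<Rightarrow> ennreal" where
  "r_exponent A q \<zeta> x =
     inverse (inverse (q (matrix_inv A *v x)) - inverse (ennreal \<zeta> * q x))"

definition Theta :: "nat \<Rightarrow> (nat \<Rightarrow> real^'n \<Rightarrow> real^'n^'n) \<Rightarrow> real^'n \<Rightarrow> int" where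
  "Theta m A t =
     (GREATEST k::int. (MAX i\<in>{1..m}. norm (A i t) * norm (matrix_inv (A i t))) < 2 powi (- k))"

definition C4 ::
  "nat \<Rightarrow> (real^'n \<Rightarrow> real) \<Rightarrow> (nat \<Rightarrow> real^'n \<Rightarrow> real^'n^'n) \<Rightarrow> (nat \<Rightarrow> real) \<Rightarrow>
   (nat \<Rightarrow> real^'n \<Rightarrow> ennreal) \<Rightarrow> real \<Rightarrow> (nat \<Rightarrow> real^'n \<Rightarrow> real) \<Rightarrow> real \<Rightarrow> ennreal" where
  "C4 m \<Phi> A \<gamma> q \<zeta> \<alpha> p =
     (\<integral>\<^sup>+t. ennreal ((2 - of_int (Theta m A t)) powr (real m - 1 / p) * (\<Phi> t / norm t ^ CARD('n))) *
        (\<Prod>i=1..m. ennreal (c_const (A i t) (q i) (\<gamma> i)) *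
           Lp_norm (r_exponent (A i t) (q i) \<zeta>) (\<lambda>x. 1) *
           ennreal (norm (A i t) powr (- \<alpha> i 0)) *
           ennreal (\<Sum>r\<in>{Theta m A t - 1..0}. 2 powr (- of_int r * \<alpha> i 0)))
      \<partial>lebesgue)"

end

theory Submission
  imports Defs
begin

text \<open>
  For fixed \<open>t\<close> the integrand of the operator is a product of dilations \<open>f\<^sub>i(A\<^sub>i(t) x)\<close>. The theorem is
  obtained by bounding the Herz norm of this product for each \<open>t\<close> and integrating in \<open>t\<close>. Two
  norms have to be pulled inside the integral: the variable exponent norm over a dyadic shell, and the
  \<open>\<ell>\<^sup>p\<close> norm over the indices of the shells. Both are Luxemburg norms, for which Minkowski's integral
  inequality follows from Jensen's inequality at each point (\<open>lux_le_nn_integral\<close>) and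
  Hoelder's inequality from an elementary pointwise estimate (\<open>lux_le_prod\<close>). They are therefore treated
  together by means of the predicate \<open>lux_le\<close>.

  For one matrix \<open>A\<close> and one function the substitution \<open>y = A x\<close> has the following effects. If \<open>x\<close> is in
  the shell with index \<open>k\<close>, then \<open>y\<close> is in one of the shells with index \<open>k + l + r\<close>, where
  \<open>2\<^sup>l\<close> is the dyadic size of the norm of \<open>A\<close> and \<open>r\<close> runs from \<open>\<Theta> - 1\<close> to \<open>0\<close>
  (\<open>linear_image_dyadic_shell\<close>). The weight and the Jacobian contribute the two factors of
  \<open>c_const\<close> (\<open>norm_powr_le_weight\<close>, \<open>lux_le_linear_substitution\<close>). The exponent becomes \<open>q(A\<^sup>-\<^sup>1 y)\<close>,
  and Hoelder's inequality with the exponent \<open>r(t, \<cdot>)\<close> replaces it by \<open>\<zeta> q(y)\<close> at the cost of the norm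
  of the constant function one (\<open>lux_le_smaller_exponent\<close>).

  The variable smoothness index disappears at the beginning: since \<open>\<alpha>\<close> is log-Hoelder continuous at
  the origin and at infinity with the same limit value, \<open>\<bar>k\<bar> \<bar>\<alpha>(x) - \<alpha>(0)\<bar>\<close> is bounded on the
  shell with index \<open>k\<close>, uniformly in \<open>k\<close> (\<open>log_Hoelder_shell_oscillation\<close>). With the constant index
  \<open>\<alpha>(0)\<close> the sum over \<open>r\<close> is a combination of translates of a sequence in \<open>\<ell>\<^sup>p\<close>, with coefficients
  that add up to the remaining factors of the integrand of \<open>C4\<close> (\<open>lux_le_shifted_shell_sum\<close>). The
  power of \<open>2 - \<Theta>\<close> in that integrand is at least one, because condition numbers are at least one.

  Measurability requires some care. The functions \<open>f\<^sub>i\<close> and \<open>q\<^sub>i\<close> are only Lebesgue measurable, and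
  they are composed with the map \<open>(t, x) \<mapsto> A\<^sub>i(t) x\<close>. They are replaced by Borel
  representatives, which is harmless because invertible matrices preserve null sets
  (\<open>AE_linear_family\<close>). The norm of the constant function one, as a function of \<open>t\<close>, is replaced by a
  measurable function below it that still satisfies the required estimate (\<open>unit_dilation_norm\<close>).
\<close>

section \<open>Real powers of extended nonnegative numbers\<close>

lemma ennreal_powr_ennreal: "0 \<le> x \<Longrightarrow> ennreal_powr (ennreal x) p = ennreal (x powr p)"
  by (simp add: ennreal_powr_def)

lemma ennreal_powr_top [simp]: "ennreal_powr top p = top"
  by (simp add: ennreal_powr_def)

lemma ennreal_powr_0 [simp]: "ennreal_powr 0 p = 0"
  by (simp add: ennreal_powr_def)

lemma ennreal_powr_eq_0_iff [simp]: "ennreal_powr x p = 0 \<longleftrightarrow> x = 0"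
  by (cases x) (auto simp: ennreal_powr_ennreal)

lemma ennreal_inverse_mono:
  fixes x y :: ennreal
  assumes "x \<le> y"
  shows "inverse y \<le> inverse x"
proof (cases "x = 0 \<or> y = top")
  case False
  then obtain a b where "x = ennreal a" "y = ennreal b" "0 < a" "0 < b"
    using assms by (cases x; cases y) (auto simp: less_le top_unique)
  then show ?thesis using assms by (simp add: inverse_ennreal le_imp_inverse_le)
qed (use assms in auto)

lemma measurable_ennreal_powr [measurable (raw)]:
  assumes [measurable]: "f \<in> borel_measurable M" "s \<in> borel_measurable M"
  shows "(\<lambda>x. ennreal_powr (f x) (s x)) \<in> borel_measurable M"
  unfolding ennreal_powr_def by measurable

lemma ennreal_powr_mono: "x \<le> y \<Longrightarrow> 0 \<le> p \<Longrightarrow> ennreal_powr x p \<le> ennreal_powr y p"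
  by (cases x; cases y)
    (auto simp: ennreal_powr_ennreal intro!: ennreal_leI powr_mono2,
     auto simp: ennreal_powr_def top_unique)

lemma ennreal_powr_mult:
  assumes "0 < p"
  shows "ennreal_powr (x * y) p = ennreal_powr x p * ennreal_powr y p"
proof (cases x; cases y)
  fix a b assume "x = ennreal a" "0 \<le> a" "y = ennreal b" "0 \<le> b"
  then show ?thesis
    by (simp add: ennreal_powr_ennreal powr_mult flip: ennreal_mult)
qed (auto simp: ennreal_powr_def ennreal_mult_top ennreal_top_mult ennreal_mult_eq_top_iff)

lemma ennreal_powr_powr:
  assumes "0 < a" "0 < b"
  shows "ennreal_powr (ennreal_powr x a) b = ennreal_powr x (a * b)"
  by (cases x) (auto simp: ennreal_powr_ennreal powr_powr)

lemma ennreal_powr_1 [simp]: "ennreal_powr x 1 = x"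
  by (cases x) (auto simp: ennreal_powr_ennreal)

lemma ennreal_powr_add:
  assumes "0 < a" "0 < b"
  shows "ennreal_powr x (a + b) = ennreal_powr x a * ennreal_powr x b"
  using assms by (cases x) (auto simp: ennreal_powr_ennreal powr_add ennreal_mult)

lemma ennreal_powr_sum:
  assumes "finite I" "I \<noteq> {}" "\<And>i. i \<in> I \<Longrightarrow> 0 < a i"
  shows "ennreal_powr x (\<Sum>i\<in>I. a i) = (\<Prod>i\<in>I. ennreal_powr x (a i))"
  using assms
proof (induction I rule: finite_ne_induct)
  case (insert i F)
  then show ?case by (simp add: ennreal_powr_add sum_pos)
qed simp

section \<open>Luxemburg norms, Minkowski and Hoelder inequalities\<close>

text \<open>
  This is the statement that the Luxemburg norm of \<open>g\<close> with exponent \<open>s\<close> is at most \<open>\<eta>\<close>. A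
  predicate is easier to handle than the norm itself: the degenerate bounds need no separate
  treatment, because in the extended nonnegative numbers \<open>g x / 0\<close> is \<open>\<infinity>\<close> unless
  \<open>g x = 0\<close>, so that the bound \<open>0\<close> says that \<open>g\<close> vanishes almost everywhere, while the bound
  \<open>\<infinity>\<close> always holds. On the counting measure of the integers with a constant exponent the same
  predicate describes the norm of \<open>\<ell>\<^sup>p\<close>.
\<close>

definition lux_le :: "'a measure \<Rightarrow> ('a \<Rightarrow> real) \<Rightarrow> ('a \<Rightarrow> ennreal) \<Rightarrow> ennreal \<Rightarrow> bool" where
  "lux_le M s g \<eta> \<longleftrightarrow> (\<integral>\<^sup>+x. ennreal_powr (g x / \<eta>) (s x) \<partial>M) \<le> 1"

lemma lux_le_top [simp]: "lux_le M s g top"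
  by (simp add: lux_le_def)

lemma lux_le_mono:
  assumes "lux_le M s g \<eta>" "AE x in M. h x \<le> g x" "\<eta> \<le> \<theta>" "AE x in M. 0 \<le> s x"
  shows "lux_le M s h \<theta>"
proof -
  have "(\<integral>\<^sup>+x. ennreal_powr (h x / \<theta>) (s x) \<partial>M) \<le> (\<integral>\<^sup>+x. ennreal_powr (g x / \<eta>) (s x) \<partial>M)"
    using assms(2,4)
  proof (intro nn_integral_mono_AE, eventually_elim)
    case (elim x)
    then show ?case using assms(3)
      by (auto simp: divide_ennreal_def intro!: ennreal_powr_mono mult_mono ennreal_inverse_mono)
  qed
  with assms(1) show ?thesis by (auto simp: lux_le_def)
qed

lemma lux_le_cong_AE:
  assumes "AE x in M. g x = h x" "AE x in M. s x = u x"
  shows "lux_le M s g \<eta> \<longleftrightarrow> lux_le M u h \<eta>"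
proof -
  have "(\<integral>\<^sup>+x. ennreal_powr (g x / \<eta>) (s x) \<partial>M) = (\<integral>\<^sup>+x. ennreal_powr (h x / \<eta>) (u x) \<partial>M)"
    using assms by (intro nn_integral_cong_AE) auto
  then show ?thesis by (simp add: lux_le_def)
qed

lemma lux_le_0_imp_AE_eq_0:
  assumes "lux_le M s g 0"
    and [measurable]: "g \<in> borel_measurable M" "s \<in> borel_measurable M"
  shows "AE x in M. g x = 0"
proof -
  have "(\<integral>\<^sup>+x. ennreal_powr (g x / 0) (s x) \<partial>M) \<noteq> \<infinity>"
    using assms(1) by (auto simp: lux_le_def top_unique)
  then have "AE x in M. ennreal_powr (g x / 0) (s x) \<noteq> \<infinity>"
    by (intro nn_integral_PInf_AE) auto
  then show ?thesis
    by eventually_elim (auto simp: ennreal_powr_def divide_ennreal_def ennreal_mult_top split: if_splits)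
qed

lemma lux_le_0_if_AE_eq_0: "AE x in M. g x = 0 \<Longrightarrow> lux_le M s g \<eta>"
proof -
  assume "AE x in M. g x = 0"
  then have "(\<integral>\<^sup>+x. ennreal_powr (g x / \<eta>) (s x) \<partial>M) = (\<integral>\<^sup>+x. 0 \<partial>M)"
    by (intro nn_integral_cong_AE) (auto elim: eventually_mono)
  then show ?thesis by (simp add: lux_le_def)
qed

lemma lux_le_cmult:
  assumes "lux_le M s g \<eta>" "c < \<infinity>"
  shows "lux_le M s (\<lambda>x. c * g x) (c * \<eta>)"
proof (cases "c = 0")
  case False
  have "(c * g x) / (c * \<eta>) = g x / \<eta>" for x
    using False assms(2) divide_mult_eq[of c "g x" \<eta>] by (simp add: mult.commute)
  then show ?thesis using assms by (simp add: lux_le_def)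
qed (simp add: lux_le_0_if_AE_eq_0)

text \<open>
  The graph of a convex power lies above its tangent at \<open>c\<close>; the terms are arranged so that no
  subtraction is left, and the inequality can be integrated over extended nonnegative functions.
\<close>

lemma powr_tangent_ineq:
  fixes h c p :: real
  assumes "0 \<le> h" "0 < c" "1 \<le> p"
  shows "p * c powr (p - 1) * h \<le> h powr p + (p - 1) * c powr p"
proof (cases "p = 1")
  case False
  with assms have p: "p > 1" by simp
  have "h * c powr (p - 1) \<le> h powr p / p + (c powr (p - 1)) powr (p / (p - 1)) / (p / (p - 1))"
    using p assms by (intro Youngs_inequality) (auto simp: field_simps)
  also have "(c powr (p - 1)) powr (p / (p - 1)) = c powr p"
    using p by (simp add: powr_powr)
  finally show ?thesis using p by (simp add: field_simps)
qed (use assms in simp)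

text \<open>
  Jensen's inequality for a weight of total mass at most one: integrate the tangent inequality at
  the mean \<open>c\<close>. A weight of smaller mass only helps, since the constant term \<open>(p - 1) c\<^sup>p\<close> stands on
  the larger side. If the mean is infinite, then \<open>h \<le> 1 + h\<^sup>p\<close> makes the right-hand side infinite.
\<close>

lemma ennreal_powr_nn_integral_le:
  assumes [measurable]: "h \<in> borel_measurable M" "w \<in> borel_measurable M"
    and w: "(\<integral>\<^sup>+t. w t \<partial>M) \<le> 1" and p: "1 \<le> p"
  shows "ennreal_powr (\<integral>\<^sup>+t. h t * w t \<partial>M) p \<le> (\<integral>\<^sup>+t. ennreal_powr (h t) p * w t \<partial>M)"
proof -
  define I where "I = (\<integral>\<^sup>+t. ennreal_powr (h t) p * w t \<partial>M)"
  define J where "J = (\<integral>\<^sup>+t. h t * w t \<partial>M)"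
  consider "J = \<infinity>" | "J = 0" | c where "J = ennreal c" "0 < c"
    by (cases J) (auto simp: less_le)
  then show ?thesis unfolding J_def[symmetric] I_def[symmetric]
  proof cases
    case 1
    have "h t \<le> 1 + ennreal_powr (h t) p" for t
    proof (cases "h t")
      case (real r)
      have "r \<le> 1 + r powr p"
        using powr_mono[of 1 p r] p real by (cases "r \<le> 1") (auto intro: add_increasing2)
      then show ?thesis using real
        by (simp add: ennreal_powr_ennreal flip: ennreal_plus ennreal_1)
    qed simp
    then have "J \<le> (\<integral>\<^sup>+t. (1 + ennreal_powr (h t) p) * w t \<partial>M)"
      unfolding J_def by (intro nn_integral_mono mult_right_mono) auto
    also have "\<dots> = (\<integral>\<^sup>+t. w t \<partial>M) + I"
      unfolding I_def by (simp add: distrib_right nn_integral_add)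
    finally have "I = \<infinity>" using 1 w by (auto simp: top_unique)
    then show "ennreal_powr J p \<le> I" by simp
  next
    case 3
    have pt: "ennreal (p * c powr (p - 1)) * h t \<le> ennreal_powr (h t) p + ennreal ((p - 1) * c powr p)" for t
    proof (cases "h t")
      case (real r)
      then show ?thesis using powr_tangent_ineq[of r c p] 3 p
        by (simp add: ennreal_powr_ennreal flip: ennreal_plus ennreal_mult)
    qed simp
    have "ennreal (p * c powr p) = ennreal (p * c powr (p - 1)) * J"
      using 3 p by (simp add: powr_diff flip: ennreal_mult)
    also have "\<dots> = (\<integral>\<^sup>+t. ennreal (p * c powr (p - 1)) * h t * w t \<partial>M)"
      unfolding J_def by (simp add: nn_integral_cmult mult.assoc)
    also have "\<dots> \<le> (\<integral>\<^sup>+t. (ennreal_powr (h t) p + ennreal ((p - 1) * c powr p)) * w t \<partial>M)"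
      by (intro nn_integral_mono mult_right_mono pt) auto
    also have "\<dots> = I + ennreal ((p - 1) * c powr p) * (\<integral>\<^sup>+t. w t \<partial>M)"
      unfolding I_def by (simp add: distrib_right nn_integral_add nn_integral_cmult)
    also have "\<dots> \<le> I + ennreal ((p - 1) * c powr p) * 1"
      by (intro add_left_mono mult_left_mono w) auto
    finally have *: "ennreal (p * c powr p) \<le> I + ennreal ((p - 1) * c powr p)" by simp
    show "ennreal_powr J p \<le> I"
    proof (cases I)
      case (real r)
      then have "p * c powr p \<le> r + (p - 1) * c powr p"
        using * p by (simp flip: ennreal_plus)
      then show ?thesis using real 3 by (simp add: ennreal_powr_ennreal algebra_simps)
    qed simp
  qed simp
qed

text \<open>
  Minkowski's integral inequality with constant one. Let \<open>S\<close> be the integral of \<open>Q\<close>. Writing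
  \<open>F / S\<close> as \<open>F / Q\<close> times the probability density \<open>Q / S\<close>, Jensen's inequality at each \<open>x\<close> with
  the exponent \<open>s x\<close>, followed by Tonelli's theorem, bounds the modular of the integral by the
  average of the modulars of \<open>F / Q\<close>, which are at most one. Only the pointwise exponent enters, so
  a variable exponent makes no difference.
\<close>

lemma lux_le_nn_integral:
  assumes "sigma_finite_measure M" "sigma_finite_measure N"
    and F [measurable]: "case_prod F \<in> borel_measurable (M \<Otimes>\<^sub>M N)"
    and s [measurable]: "s \<in> borel_measurable M" and s1: "AE x in M. 1 \<le> s x"
    and Q [measurable]: "Q \<in> borel_measurable N"
    and bound: "AE t in N. lux_le M s (\<lambda>x. F x t) (Q t)"
  shows "lux_le M s (\<lambda>x. \<integral>\<^sup>+t. F x t \<partial>N) (\<integral>\<^sup>+t. Q t \<partial>N)"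
proof -
  interpret M: sigma_finite_measure M by fact
  interpret N: sigma_finite_measure N by fact
  interpret MN: pair_sigma_finite M N ..
  define S where "S = (\<integral>\<^sup>+t. Q t \<partial>N)"
  show ?thesis
  proof (cases "S = \<infinity>")
    case False
    then have "AE t in N. Q t \<noteq> \<infinity>"
      unfolding S_def by (intro nn_integral_PInf_AE) auto
    \<comment> \<open>The only obstruction is \<open>Q t = 0\<close>, where the bound forces \<open>F\<close> to vanish.\<close>
    then have "AE t in N. AE x in M. F x t = F x t / Q t * Q t"
      using bound AE_space[of N]
    proof (eventually_elim)
      case (elim t)
      note \<open>t \<in> space N\<close> [measurable]
      show ?case
      proof (cases "Q t = 0")
        case True
        have "AE x in M. F x t = 0"
          using elim True by (intro lux_le_0_imp_AE_eq_0[of M s]) auto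
        then show ?thesis by eventually_elim simp
      next
        case False
        then show ?thesis using elim
          by (intro always_eventually allI) (simp add: ennreal_divide_times less_top)
      qed
    qed
    then have fac: "AE x in M. AE t in N. F x t = F x t / Q t * Q t"
      by (subst MN.AE_commute) auto
    show ?thesis
    proof (cases "S = 0")
      case True
      then have Q0: "AE t in N. Q t = 0"
        unfolding S_def by (simp add: nn_integral_0_iff_AE)
      have "AE x in M. (\<integral>\<^sup>+t. F x t \<partial>N) = 0"
        using fac
      proof eventually_elim
        case (elim x)
        have "AE t in N. F x t = 0"
          using elim Q0 by eventually_elim (metis mult_zero_right)
        then have "(\<integral>\<^sup>+t. F x t \<partial>N) = (\<integral>\<^sup>+t. 0 \<partial>N)"
          by (rule nn_integral_cong_AE)
        then show ?case by simp
      qed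
      then show ?thesis by (rule lux_le_0_if_AE_eq_0)
    next
      case S0: False
      have Sw: "(\<integral>\<^sup>+t. Q t / S \<partial>N) = 1"
        using S0 \<open>S \<noteq> \<infinity>\<close> by (simp add: nn_integral_divide S_def less_top)
      have "AE x in M. ennreal_powr ((\<integral>\<^sup>+t. F x t \<partial>N) / S) (s x)
        \<le> (\<integral>\<^sup>+t. ennreal_powr (F x t / Q t) (s x) * (Q t / S) \<partial>N)"
        using fac s1 AE_space[of M]
      proof eventually_elim
        case (elim x)
        note \<open>x \<in> space M\<close> [measurable]
        have "(\<integral>\<^sup>+t. F x t \<partial>N) = (\<integral>\<^sup>+t. F x t / Q t * Q t \<partial>N)"
          using elim(1) by (rule nn_integral_cong_AE)
        then have "(\<integral>\<^sup>+t. F x t \<partial>N) / S = (\<integral>\<^sup>+t. F x t / Q t * Q t \<partial>N) / S"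
          by simp
        also have "\<dots> = (\<integral>\<^sup>+t. F x t / Q t * (Q t / S) \<partial>N)"
          by (subst nn_integral_divide[symmetric]) (simp_all add: ennreal_times_divide)
        finally have eq: "(\<integral>\<^sup>+t. F x t \<partial>N) / S = (\<integral>\<^sup>+t. F x t / Q t * (Q t / S) \<partial>N)" .
        show ?case unfolding eq
          by (rule ennreal_powr_nn_integral_le) (use elim(2) Sw in simp_all)
      qed
      then have "(\<integral>\<^sup>+x. ennreal_powr ((\<integral>\<^sup>+t. F x t \<partial>N) / S) (s x) \<partial>M)
        \<le> (\<integral>\<^sup>+x. \<integral>\<^sup>+t. ennreal_powr (F x t / Q t) (s x) * (Q t / S) \<partial>N \<partial>M)"
        by (rule nn_integral_mono_AE)
      also have "\<dots> = (\<integral>\<^sup>+t. \<integral>\<^sup>+x. ennreal_powr (F x t / Q t) (s x) * (Q t / S) \<partial>M \<partial>N)"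
        by (intro MN.Fubini'[symmetric]) measurable
      also have "\<dots> = (\<integral>\<^sup>+t. (\<integral>\<^sup>+x. ennreal_powr (F x t / Q t) (s x) \<partial>M) * (Q t / S) \<partial>N)"
        by (auto intro!: nn_integral_cong nn_integral_multc)
      also have "\<dots> \<le> (\<integral>\<^sup>+t. 1 * (Q t / S) \<partial>N)"
        using bound unfolding lux_le_def
        by (intro nn_integral_mono_AE) (erule eventually_mono, rule mult_right_mono, auto)
      finally show ?thesis using Sw by (simp add: lux_le_def S_def)
    qed
  qed (simp add: S_def)
qed

text \<open>
  The triangle inequality is Minkowski's inequality for a finite counting measure.
\<close>

lemma lux_le_sum:
  assumes "sigma_finite_measure M" "finite I"
    and [measurable]: "\<And>i. i \<in> I \<Longrightarrow> g i \<in> borel_measurable M" "s \<in> borel_measurable M"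
    and s1: "AE x in M. 1 \<le> s x"
    and b: "\<And>i. i \<in> I \<Longrightarrow> lux_le M s (g i) (\<eta> i)"
  shows "lux_le M s (\<lambda>x. \<Sum>i\<in>I. g i x) (\<Sum>i\<in>I. \<eta> i)"
proof -
  have [measurable]: "(\<lambda>(x, i). g i x) \<in> borel_measurable (M \<Otimes>\<^sub>M count_space I)"
    unfolding case_prod_beta using assms(2)
    by (intro measurable_compose_countable'[of I "\<lambda>i p. g i (fst p)" _ _ snd]) (auto intro: countable_finite)
  have "lux_le M s (\<lambda>x. \<integral>\<^sup>+i. g i x \<partial>count_space I) (\<integral>\<^sup>+i. \<eta> i \<partial>count_space I)"
    using assms by (intro lux_le_nn_integral sigma_finite_measure_count_space_finite) (auto simp: AE_count_space)
  then show ?thesis using assms(2) by (simp add: nn_integral_count_space_finite)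
qed

text \<open>
  A bound \<open>K \<ge> 1\<close> on the modular is a bound on the norm, because \<open>(1 / K)\<^sup>s \<le> 1 / K\<close> for
  exponents \<open>s \<ge> 1\<close>.
\<close>

lemma lux_le_of_modular_le:
  assumes "(\<integral>\<^sup>+x. ennreal_powr (g x / \<eta>) (s x) \<partial>M) \<le> ennreal K" "1 \<le> K"
    and s1: "AE x in M. 1 \<le> s x"
    and [measurable]: "g \<in> borel_measurable M" "s \<in> borel_measurable M"
  shows "lux_le M s g (ennreal K * \<eta>)"
proof -
  have "(\<integral>\<^sup>+x. ennreal_powr (g x / (ennreal K * \<eta>)) (s x) \<partial>M)
     \<le> (\<integral>\<^sup>+x. ennreal (1 / K) * ennreal_powr (g x / \<eta>) (s x) \<partial>M)"
    using s1
  proof (intro nn_integral_mono_AE, eventually_elim)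
    case (elim x)
    have "g x / (ennreal K * \<eta>) = ennreal (1 / K) * (g x / \<eta>)"
      using \<open>1 \<le> K\<close>
      by (cases "\<eta> = top")
        (auto simp: divide_ennreal_def ennreal_inverse_mult less_top inverse_ennreal inverse_eq_divide ennreal_mult_top mult_ac)
    then have "ennreal_powr (g x / (ennreal K * \<eta>)) (s x) = ennreal ((1 / K) powr s x) * ennreal_powr (g x / \<eta>) (s x)"
      using elim \<open>1 \<le> K\<close> by (simp add: ennreal_powr_mult ennreal_powr_ennreal)
    moreover have "(1 / K) powr s x \<le> (1 / K) powr 1"
      using elim \<open>1 \<le> K\<close> by (intro powr_mono') auto
    ultimately show ?case
      using \<open>1 \<le> K\<close> by (auto intro!: mult_right_mono ennreal_leI)
  qed
  also have "\<dots> = ennreal (1 / K) * (\<integral>\<^sup>+x. ennreal_powr (g x / \<eta>) (s x) \<partial>M)"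
    by (simp add: nn_integral_cmult)
  also have "\<dots> \<le> ennreal (1 / K) * ennreal K"
    by (intro mult_left_mono assms) auto
  also have "\<dots> = 1" using \<open>1 \<le> K\<close> by (simp flip: ennreal_mult)
  finally show ?thesis by (simp add: lux_le_def)
qed

lemma prod_less_top_ennreal:
  fixes f :: "'a \<Rightarrow> ennreal"
  assumes "\<And>i. i \<in> I \<Longrightarrow> f i < top"
  shows "(\<Prod>i\<in>I. f i) < top"
  using assms by (induction I rule: infinite_finite_induct) (auto simp: ennreal_mult_less_top)

lemma prod_divide_ennreal:
  fixes g \<eta> :: "'a \<Rightarrow> ennreal"
  assumes "finite I" "\<And>i. i \<in> I \<Longrightarrow> 0 < \<eta> i \<and> \<eta> i < top"
  shows "(\<Prod>i\<in>I. g i / \<eta> i) = (\<Prod>i\<in>I. g i) / (\<Prod>i\<in>I. \<eta> i)"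
  using assms
proof (induction I rule: finite_induct)
  case (insert i I)
  then have "(\<Prod>i\<in>I. \<eta> i) < top"
    by (metis ennreal_prod_eq_top insertI2 less_top)
  with insert show ?case
    by (simp add: divide_ennreal_def ennreal_inverse_mult mult_ac)
qed simp

text \<open>
  Hoelder's inequality with the number of factors as constant. With \<open>\<Sigma>\<close> the sum of the
  \<open>b\<^sub>i\<^sup>s\<^sup>i\<close>, where \<open>b\<^sub>i = g\<^sub>i / \<eta>\<^sub>i\<close>, each \<open>b\<^sub>i\<close> is at most \<open>\<Sigma>\<close> to the power \<open>1 / s\<^sub>i\<close>, and
  these exponents add up to \<open>1 / u\<close>; hence the product to the power \<open>u\<close> is at most \<open>\<Sigma>\<close>.
\<close>

lemma lux_le_prod:
  assumes I: "finite I" "I \<noteq> {}"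
    and [measurable]: "\<And>i. i \<in> I \<Longrightarrow> g i \<in> borel_measurable M" "\<And>i. i \<in> I \<Longrightarrow> s i \<in> borel_measurable M"
      "u \<in> borel_measurable M"
    and s: "AE x in M. 1 \<le> u x \<and> (\<forall>i\<in>I. 0 < s i x) \<and> (\<Sum>i\<in>I. 1 / s i x) = 1 / u x"
    and b: "\<And>i. i \<in> I \<Longrightarrow> lux_le M (s i) (g i) (\<eta> i)"
  shows "lux_le M u (\<lambda>x. \<Prod>i\<in>I. g i x) (of_nat (card I) * (\<Prod>i\<in>I. \<eta> i))"
proof (cases "\<exists>i\<in>I. \<eta> i = 0")
  case True
  then obtain i where i: "i \<in> I" "\<eta> i = 0" by blast
  then have "AE x in M. g i x = 0"
    using b[OF i(1)] by (intro lux_le_0_imp_AE_eq_0[of M "s i"]) auto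
  then have "AE x in M. (\<Prod>i\<in>I. g i x) = 0"
    by eventually_elim (use i I in auto)
  then show ?thesis by (rule lux_le_0_if_AE_eq_0)
next
  case nz: False
  show ?thesis
  proof (cases "\<exists>i\<in>I. \<eta> i = \<infinity>")
    case True
    then have "(\<Prod>i\<in>I. \<eta> i) = \<infinity>"
      using nz I by (auto simp: ennreal_prod_eq_top)
    moreover have "of_nat (card I) \<noteq> (0::ennreal)" using I by simp
    ultimately show ?thesis by (simp add: ennreal_mult_eq_top_iff ennreal_mult_top)
  next
    case fin: False
    have "(\<integral>\<^sup>+x. ennreal_powr ((\<Prod>i\<in>I. g i x) / (\<Prod>i\<in>I. \<eta> i)) (u x) \<partial>M)
      \<le> (\<integral>\<^sup>+x. (\<Sum>i\<in>I. ennreal_powr (g i x / \<eta> i) (s i x)) \<partial>M)"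
      using s
    proof (intro nn_integral_mono_AE, eventually_elim)
      case (elim x)
      define \<Sigma> where "\<Sigma> = (\<Sum>i\<in>I. ennreal_powr (g i x / \<eta> i) (s i x))"
      have le: "g i x / \<eta> i \<le> ennreal_powr \<Sigma> (1 / s i x)" if "i \<in> I" for i
      proof -
        have "ennreal_powr (g i x / \<eta> i) (s i x) \<le> \<Sigma>"
          unfolding \<Sigma>_def using I that by (intro member_le_sum) auto
        then have "ennreal_powr (ennreal_powr (g i x / \<eta> i) (s i x)) (1 / s i x) \<le> ennreal_powr \<Sigma> (1 / s i x)"
          using elim that by (intro ennreal_powr_mono) (auto simp: less_imp_le)
        then show ?thesis using elim that by (subst (asm) ennreal_powr_powr) auto
      qed
      have "(\<Prod>i\<in>I. g i x) / (\<Prod>i\<in>I. \<eta> i) = (\<Prod>i\<in>I. g i x / \<eta> i)"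
        using nz fin by (intro prod_divide_ennreal[OF I(1), symmetric]) (auto simp: less_top zero_less_iff_neq_zero)
      also have "\<dots> \<le> (\<Prod>i\<in>I. ennreal_powr \<Sigma> (1 / s i x))"
        by (intro prod_mono_ennreal le)
      also have "\<dots> = ennreal_powr \<Sigma> (1 / u x)"
        using I elim by (subst ennreal_powr_sum[symmetric]) auto
      finally have "ennreal_powr ((\<Prod>i\<in>I. g i x) / (\<Prod>i\<in>I. \<eta> i)) (u x) \<le> ennreal_powr (ennreal_powr \<Sigma> (1 / u x)) (u x)"
        using elim by (intro ennreal_powr_mono) auto
      also have "\<dots> = \<Sigma>" using elim by (subst ennreal_powr_powr) auto
      finally show ?case unfolding \<Sigma>_def .
    qed
    also have "\<dots> = (\<Sum>i\<in>I. \<integral>\<^sup>+x. ennreal_powr (g i x / \<eta> i) (s i x) \<partial>M)"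
      by (intro nn_integral_sum) auto
    also have "\<dots> \<le> (\<Sum>i\<in>I. 1)"
      by (intro sum_mono) (use b in \<open>auto simp: lux_le_def\<close>)
    finally have "(\<integral>\<^sup>+x. ennreal_powr ((\<Prod>i\<in>I. g i x) / (\<Prod>i\<in>I. \<eta> i)) (u x) \<partial>M) \<le> ennreal (real (card I))"
      by (simp add: ennreal_of_nat_eq_real_of_nat)
    then have "lux_le M u (\<lambda>x. \<Prod>i\<in>I. g i x) (ennreal (real (card I)) * (\<Prod>i\<in>I. \<eta> i))"
    proof (rule lux_le_of_modular_le)
      have "0 < card I" using I by (simp add: card_gt_0_iff)
      then show "1 \<le> real (card I)" by linarith
    qed (use s in auto)
    then show ?thesis by (simp add: ennreal_of_nat_eq_real_of_nat)
  qed
qed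

lemma filterlim_powr_at_top:
  fixes s :: real
  assumes "0 < s"
  shows "filterlim (\<lambda>x. x powr s) at_top at_top"
proof -
  have "filterlim (\<lambda>x. exp (s * ln x)) at_top at_top"
    using assms
    by (intro filterlim_compose[OF exp_at_top] filterlim_tendsto_pos_mult_at_top[OF tendsto_const _ ln_at_top])
  moreover have "\<forall>\<^sub>F x in at_top. exp (s * ln x) = x powr s"
    using eventually_gt_at_top[of 0] by eventually_elim (simp add: powr_def)
  ultimately show ?thesis by (rule filterlim_cong[OF refl refl, THEN iffD1, rotated])
qed

text \<open>
  The infimum that defines a Luxemburg norm is attained: let the bounds decrease to \<open>\<eta>\<close> and use
  Fatou's lemma.
\<close>

lemma lux_le_closed:
  assumes lux: "\<And>\<theta>. \<eta> < \<theta> \<Longrightarrow> \<theta> < \<infinity> \<Longrightarrow> lux_le M s g \<theta>"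
    and s: "AE x in M. 0 < s x"
    and [measurable]: "g \<in> borel_measurable M" "s \<in> borel_measurable M"
  shows "lux_le M s g \<eta>"
proof (cases "\<eta> = \<infinity>")
  case False
  then obtain e where e: "\<eta> = ennreal e" "0 \<le> e" by (cases \<eta>) auto
  define \<theta> where "\<theta> n = e + 1 / real (Suc n)" for n
  have \<theta>: "\<theta> n > e" "\<theta> n > 0" for n using e by (auto simp: \<theta>_def add_nonneg_pos)
  have \<theta>lim: "\<theta> \<longlonglongrightarrow> e"
    unfolding \<theta>_def using LIMSEQ_inverse_real_of_nat_add[of e] by (simp add: inverse_eq_divide)
  have "(\<integral>\<^sup>+x. ennreal_powr (g x / \<eta>) (s x) \<partial>M) \<le> (\<integral>\<^sup>+x. liminf (\<lambda>n. ennreal_powr (g x / ennreal (\<theta> n)) (s x)) \<partial>M)"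
    using s
  proof (intro nn_integral_mono_AE, eventually_elim)
    case (elim x)
    have "(\<lambda>n. ennreal_powr (g x / ennreal (\<theta> n)) (s x)) \<longlonglongrightarrow> ennreal_powr (g x / \<eta>) (s x)"
    proof (cases "g x")
      case (real r)
      have eq: "ennreal_powr (g x / ennreal (\<theta> n)) (s x) = ennreal ((r / \<theta> n) powr s x)" for n
        using real \<theta> by (simp add: divide_ennreal ennreal_powr_ennreal less_imp_le)
      consider "r = 0" | "e > 0" | "r > 0" "e = 0" using e real by fastforce
      then show ?thesis
      proof cases
        case 2
        have "(\<lambda>n. (r / \<theta> n) powr s x) \<longlonglongrightarrow> (r / e) powr s x"
          using 2 elim by (intro tendsto_intros \<theta>lim tendsto_powr2) (use real \<theta> in \<open>auto simp: less_imp_le\<close>)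
        then show ?thesis using 2 real e unfolding eq by (simp add: divide_ennreal ennreal_powr_ennreal)
      next
        case 3
        have "filterlim (\<lambda>n. r * real (Suc n)) at_top sequentially"
          by (rule filterlim_tendsto_pos_mult_at_top[OF tendsto_const])
            (use 3 in \<open>auto simp del: of_nat_Suc intro: filterlim_compose[OF filterlim_real_sequentially filterlim_Suc]\<close>)
        then have "filterlim (\<lambda>n. (r * real (Suc n)) powr s x) at_top sequentially"
          by (rule filterlim_compose[OF filterlim_powr_at_top[OF \<open>0 < s x\<close>]])
        moreover have "r / \<theta> n = r * real (Suc n)" for n
          using 3 by (simp add: \<theta>_def)
        ultimately have "filterlim (\<lambda>n. (r / \<theta> n) powr s x) at_top sequentially"
          by simp
        then have "(\<lambda>n. ennreal ((r / \<theta> n) powr s x)) \<longlonglongrightarrow> \<infinity>"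
          unfolding infinity_ennreal_def by (intro ennreal_tendsto_top_eq_at_top[THEN iffD2])
        then show ?thesis using 3 e real unfolding eq by simp
      qed (use real e in simp)
    next
      case top
      then show ?thesis using e \<theta> by (simp add: ennreal_top_divide)
    qed
    from lim_imp_Liminf[OF _ this] show ?case by simp
  qed
  also have "\<dots> \<le> liminf (\<lambda>n. \<integral>\<^sup>+x. ennreal_powr (g x / ennreal (\<theta> n)) (s x) \<partial>M)"
    by (intro nn_integral_liminf) measurable
  also have "\<dots> \<le> 1"
  proof -
    have "(\<integral>\<^sup>+x. ennreal_powr (g x / ennreal (\<theta> n)) (s x) \<partial>M) \<le> 1" for n
      using lux[of "ennreal (\<theta> n)"] \<theta>[of n] e by (simp add: lux_le_def ennreal_less_iff)
    then show ?thesis by (intro Liminf_le) auto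
  qed
  finally show ?thesis by (simp add: lux_le_def)
qed simp

section \<open>Luxemburg bounds and variable exponent Lebesgue norms\<close>

lemma Lp_modular_eq_nn_integral:
  assumes fin: "\<And>x. q x < \<infinity>" and "0 < \<eta>"
  shows "Lp_modular q (\<lambda>x. f x / of_real \<eta>) =
    (\<integral>\<^sup>+x. ennreal_powr (ennreal (norm (f x)) / ennreal \<eta>) (enn2real (q x)) \<partial>lebesgue)"
proof -
  have [simp]: "q x \<noteq> top" for x using fin[of x] by simp
  have "esssup (restrict_space lebesgue {}) (\<lambda>x. ennreal (norm (f x / complex_of_real \<eta>))) = 0"
    by (subst esssup_eq_AE) (auto simp: measurable_def space_restrict_space AE_iff_null Inf_eq_bot_iff bot_ennreal
        intro!: Inf_eqI exI[of _ 0])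
  then show ?thesis
    using assms(2) by (simp add: Lp_modular_def ennreal_powr_ennreal divide_ennreal norm_divide)
qed

text \<open>
  The infimum defining the norm is attained. Positivity of the exponent is the natural assumption,
  because the lemma is applied to \<open>\<zeta> q\<^sub>i\<close>, which drops below one for small \<open>\<zeta>\<close>.
\<close>

lemma lux_le_Lp_norm:
  assumes [measurable]: "f \<in> borel_measurable lebesgue" "q \<in> borel_measurable lebesgue"
    and q: "\<And>x. 0 < q x" "\<And>x. q x < \<infinity>"
  shows "lux_le lebesgue (\<lambda>x. enn2real (q x)) (\<lambda>x. ennreal (norm (f x))) (Lp_norm q f)"
proof (rule lux_le_closed)
  show "AE x in lebesgue. 0 < enn2real (q x)"
    using q by (simp add: enn2real_positive_iff)
  fix \<theta> assume "Lp_norm q f < \<theta>"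
  then obtain \<eta> where \<eta>: "0 < \<eta>" "Lp_modular q (\<lambda>x. f x / of_real \<eta>) \<le> 1" "ennreal \<eta> < \<theta>"
    unfolding Lp_norm_def Inf_less_iff by auto
  then have "lux_le lebesgue (\<lambda>x. enn2real (q x)) (\<lambda>x. ennreal (norm (f x))) (ennreal \<eta>)"
    using q by (simp add: Lp_modular_eq_nn_integral lux_le_def)
  then show "lux_le lebesgue (\<lambda>x. enn2real (q x)) (\<lambda>x. ennreal (norm (f x))) \<theta>"
    by (rule lux_le_mono) (use \<eta> in auto)
qed auto

text \<open>
  The defining infimum of the norm ranges over real \<open>\<eta> > 0\<close> only; enlarging a bound by an arbitrary
  positive number brings the bound \<open>0\<close> into that range.
\<close>

lemma Lp_norm_le_if_lux_le:
  assumes lux: "lux_le lebesgue (\<lambda>x. enn2real (q x)) (\<lambda>x. ennreal (norm (f x))) \<eta>"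
    and q: "\<And>x. q x < \<infinity>"
  shows "Lp_norm q f \<le> \<eta>"
proof (rule ennreal_le_epsilon)
  fix e :: real assume "0 < e" "\<eta> < top"
  then obtain r where r: "\<eta> = ennreal r" "0 \<le> r" by (cases \<eta>) auto
  have "lux_le lebesgue (\<lambda>x. enn2real (q x)) (\<lambda>x. ennreal (norm (f x))) (ennreal (r + e))"
    using lux by (rule lux_le_mono) (use r \<open>0 < e\<close> in \<open>auto intro: ennreal_leI\<close>)
  then have "Lp_modular q (\<lambda>x. f x / of_real (r + e)) \<le> 1"
    using r \<open>0 < e\<close> q by (subst Lp_modular_eq_nn_integral) (auto simp: lux_le_def)
  then show "Lp_norm q f \<le> \<eta> + ennreal e"
    unfolding Lp_norm_def using r \<open>0 < e\<close>
    by (intro Inf_lower) (auto intro!: exI[of _ "r + e"])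
qed

text \<open>
  This equivalence allows all later work in the space variable to be done with the Borel measure,
  where substitution and joint measurability behave well.
\<close>

lemma lux_le_lebesgue_iff: "lux_le lebesgue s g \<eta> \<longleftrightarrow> lux_le lborel s g \<eta>"
  by (simp add: lux_le_def nn_integral_completion)

section \<open>Linear changes of variables\<close>

lemma sigma_finite_lebesgue: "sigma_finite_measure (lebesgue :: 'a::euclidean_space measure)"
proof
  obtain F :: "'a set set" where "countable F" "F \<subseteq> sets lborel" "\<Union> F = space lborel" "\<forall>a\<in>F. emeasure lborel a \<noteq> \<infinity>"
    using lborel.sigma_finite_countable by blast
  then show "\<exists>F::'a set set. countable F \<and> F \<subseteq> sets lebesgue \<and> \<Union> F = space lebesgue \<and> (\<forall>a\<in>F. emeasure lebesgue a \<noteq> \<infinity>)"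
    by (intro exI[of _ F]) auto
qed

lemma matrix_inv_mult:
  fixes A :: "real^'n^'n"
  assumes "invertible A"
  shows "A ** matrix_inv A = mat 1" "matrix_inv A ** A = mat 1"
    "A *v (matrix_inv A *v x) = x" "matrix_inv A *v (A *v x) = x"
proof -
  show 1: "A ** matrix_inv A = mat 1" "matrix_inv A ** A = mat 1"
    using assms unfolding invertible_def matrix_inv_def by (metis (mono_tags, lifting) someI_ex)+
  show "A *v (matrix_inv A *v x) = x" "matrix_inv A *v (A *v x) = x"
    by (simp_all add: matrix_vector_mul_assoc 1)
qed

lemma invertible_matrix_inv:
  fixes A :: "real^'n^'n"
  shows "invertible A \<Longrightarrow> invertible (matrix_inv A)"
  using matrix_inv_mult(1,2)[of A] unfolding invertible_def by blast

text \<open>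
  Every matrix is a product of elementary ones, and both sides are multiplicative. A singular map
  has a null image; a diagonal map scales each axis; a transposition of coordinates and a shear
  preserve the volume of boxes. The determinant of a shear is read off from a row operation on the
  identity matrix, so that the formula holds for every finite index type.
\<close>

lemma measure_linear_image_cart:
  fixes f :: "real^'n \<Rightarrow> real^'n"
  assumes "linear f" "S \<in> lmeasurable"
  shows "f ` S \<in> lmeasurable \<and> measure lebesgue (f ` S) = \<bar>det (matrix f)\<bar> * measure lebesgue S"
proof -
  let ?P = "\<lambda>f::real^'n \<Rightarrow> real^'n. \<forall>S \<in> lmeasurable.
    f ` S \<in> lmeasurable \<and> measure lebesgue (f ` S) = \<bar>det (matrix f)\<bar> * measure lebesgue S"
  have unimodular: "?P h" if h: "linear h" "\<bar>det (matrix h)\<bar> = 1"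
    and box: "\<And>a b. cbox a b \<noteq> {} \<Longrightarrow> measure lebesgue (h ` cbox a b) = measure lebesgue (cbox a b)" for h
  proof
    fix S :: "(real^'n) set" assume S: "S \<in> lmeasurable"
    have "measure lebesgue (h ` cbox a b) = 1 * measure lebesgue (cbox a b)" for a b
      using box[of a b] by (cases "cbox a b = {}") auto
    then show "h ` S \<in> lmeasurable \<and> measure lebesgue (h ` S) = \<bar>det (matrix h)\<bar> * measure lebesgue S"
      using measure_linear_sufficient[OF h(1) S, of 1] h(2) by simp
  qed
  have "?P f"
  proof (rule induct_linear_elementary[OF \<open>linear f\<close>])
    fix f g :: "real^'n \<Rightarrow> real^'n" assume fg: "linear f" "linear g" "?P f" "?P g"
    have "(f \<circ> g) ` S = f ` g ` S" for S by (rule image_comp[symmetric])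
    then show "?P (f \<circ> g)"
      using fg(3,4) matrix_compose[OF fg(2,1)] by (simp only: det_mul abs_mult) simp
  next
    fix f :: "real^'n \<Rightarrow> real^'n" and i assume f: "linear f" "\<And>x. f x $ i = 0"
    have "\<not> surj f"
    proof
      assume "surj f"
      then obtain x where "f x = axis i 1" by (metis surjD)
      then show False using f(2)[of x] by simp
    qed
    then have "\<not> inj f" using linear_injective_imp_surjective[OF f(1)] by blast
    then have "negligible (f ` S)" for S
      using negligible_linear_singular_image f(1) by blast
    moreover have "det (matrix f) = 0"
      using \<open>\<not> inj f\<close> det_nz_iff_inj[OF f(1)] by blast
    ultimately show "?P f"
      by (simp add: negligible_imp_measurable negligible_imp_measure0)
  next
    fix c :: "'n \<Rightarrow> real"
    show "?P (\<lambda>x. \<chi> i. c i * x $ i)"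
      by (simp add: measurable_stretch measure_stretch matrix_def axis_def det_diagonal)
  next
    fix m n :: 'n assume "m \<noteq> n"
    let ?h = "\<lambda>v::real^'n. \<chi> i. v $ Transposition.transpose m n i"
    have h: "linear ?h"
      by (rule linearI) (simp_all add: plus_vec_def scaleR_vec_def)
    have "matrix ?h = transpose (\<chi> i j. mat 1 $ i $ Transposition.transpose m n j)"
      by (auto simp: vec_eq_iff transpose_def axis_def mat_def matrix_def)
    then have "\<bar>det (matrix ?h)\<bar> = 1"
      by (simp add: det_permute_columns permutes_swap_id sign_swap_id abs_mult)
    moreover have "measure lebesgue (?h ` cbox a b) = measure lebesgue (cbox a b)" if "cbox a b \<noteq> {}" for a b
    proof -
      have "?h ` cbox a b = cbox (?h a) (?h b)"
      proof (intro equalityI subsetI)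
        fix x assume "x \<in> cbox (?h a) (?h b)"
        then have "?h x \<in> cbox a b"
          by (simp add: mem_box_cart) (metis transpose_involutory)
        moreover have "x = ?h (?h x)" by (simp add: vec_eq_iff)
        ultimately show "x \<in> ?h ` cbox a b" by blast
      qed (auto simp: mem_box_cart)
      then show ?thesis
        using that prod.permute[OF permutes_swap_id[of m UNIV n], of "\<lambda>i. (b - a) $ i"]
        by (simp add: content_cbox_if_cart interval_eq_empty_cart o_def not_less) (metis image_is_empty not_less interval_eq_empty_cart(1))
    qed
    ultimately show "?P ?h" using h by (intro unimodular)
  next
    fix m n :: 'n assume mn: "m \<noteq> n"
    let ?h = "\<lambda>v::real^'n. \<chi> i. if i = m then v $ m + v $ n else v $ i"
    have h: "linear ?h"
      by (rule linearI) (auto simp: algebra_simps vec_eq_iff)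
    have "matrix ?h = (\<chi> k. if k = m then row m (mat 1) + 1 *s row n (mat 1) else row k (mat 1))"
      by (auto simp: vec_eq_iff matrix_def axis_def mat_def row_def)
    then have "\<bar>det (matrix ?h)\<bar> = 1"
      using det_row_operation[OF mn, of "mat 1 :: real^'n^'n" 1] by simp
    moreover have "measure lebesgue (?h ` cbox a b) = measure lebesgue (cbox a b)" if "cbox a b \<noteq> {}" for a b
    proof -
      \<comment> \<open>After a translation the box starts at \<open>0\<close> in the direction \<open>n\<close>, where the volume of its
        sheared image is known; a linear map turns translations into translations.\<close>
      define v where "v = - axis n (a $ n)"
      have "?h ` (+) v ` cbox a b = (+) (?h v) ` ?h ` cbox a b"
        unfolding image_comp o_def by (intro image_cong refl linear_add[OF h])
      then have "measure lebesgue (?h ` cbox a b) = measure lebesgue (?h ` (+) v ` cbox a b)"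
        by (simp only: measure_translation)
      also have "(+) v ` cbox a b = cbox (v + a) (v + b)"
        by (rule cbox_translation[symmetric])
      also have "measure lebesgue (?h ` \<dots>) = measure lebesgue (cbox (v + a) (v + b))"
        using that mn by (intro measure_shear_interval) (auto simp: v_def axis_def interval_ne_empty_cart)
      also have "\<dots> = measure lebesgue (cbox a b)"
        by (simp only: cbox_translation measure_translation)
      finally show ?thesis .
    qed
    ultimately show "?P ?h" using h by (intro unimodular)
  qed
  then show ?thesis using assms(2) by blast
qed

text \<open>
  Lebesgue measure is determined by its values on open boxes, and the preimage of a box under
  \<open>A\<close> is its image under the inverse of \<open>A\<close>.
\<close>

lemma lborel_eq_density_distr_linear:
  fixes A :: "real^'n^'n"
  assumes A: "invertible A"
  shows "lborel = density (distr lborel borel ((*v) A)) (\<lambda>_. ennreal \<bar>det A\<bar>)"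
proof (rule lborel_eqI)
  have [measurable]: "(*v) A \<in> borel_measurable lborel"
    by (simp add: linear_continuous_on borel_measurable_continuous_onI)
  fix l u :: "real^'n" assume lu: "\<And>b. b \<in> Basis \<Longrightarrow> l \<bullet> b \<le> u \<bullet> b"
  have eq: "(*v) A -` box l u = (*v) (matrix_inv A) ` box l u"
    by (force simp: matrix_inv_mult[OF A] image_iff)
  have det: "det A * det (matrix_inv A) = 1"
    using matrix_inv_mult[OF A] by (metis det_I det_mul)
  have m: "(*v) (matrix_inv A) ` box l u \<in> lmeasurable"
      "measure lebesgue ((*v) (matrix_inv A) ` box l u) = \<bar>det (matrix_inv A)\<bar> * measure lebesgue (box l u)"
    using measure_linear_image_cart[of "(*v) (matrix_inv A)" "box l u"] by simp_all
  have "emeasure lborel ((*v) A -` box l u) = emeasure lebesgue ((*v) A -` box l u)"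
    using measurable_sets[of "(*v) A" lborel borel "box l u"] by simp
  also have "\<dots> = ennreal (\<bar>det (matrix_inv A)\<bar> * measure lebesgue (box l u))"
    unfolding eq using m by (simp add: emeasure_eq_measure2)
  finally have *: "emeasure lborel ((*v) A -` box l u) = ennreal (\<bar>det (matrix_inv A)\<bar> * measure lebesgue (box l u))" .
  have "emeasure (density (distr lborel borel ((*v) A)) (\<lambda>_. ennreal \<bar>det A\<bar>)) (box l u)
    = ennreal \<bar>det A\<bar> * emeasure lborel ((*v) A -` box l u)"
    by (subst emeasure_density) (auto simp: nn_integral_cmult_indicator emeasure_distr)
  also have "\<dots> = ennreal (\<bar>det A * det (matrix_inv A)\<bar> * measure lebesgue (box l u))"
    unfolding * by (simp add: abs_mult mult.assoc flip: ennreal_mult)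
  also have "\<dots> = ennreal (\<Prod>b\<in>Basis. (u - l) \<bullet> b)"
    using lu by (simp add: det measure_lborel_box_eq)
  finally show "emeasure (density (distr lborel borel ((*v) A)) (\<lambda>_. ennreal \<bar>det A\<bar>)) (box l u) = ennreal (\<Prod>b\<in>Basis. (u - l) \<bullet> b)" .
qed simp

lemma measurable_matrix_vector [measurable]: "(*v) (A :: real^'n^'m) \<in> borel_measurable borel"
  by (simp add: linear_continuous_on borel_measurable_continuous_onI)

lemma nn_integral_lborel_linear:
  fixes A :: "real^'n^'n"
  assumes A: "invertible A" and [measurable]: "h \<in> borel_measurable borel"
  shows "(\<integral>\<^sup>+y. h y \<partial>lborel) = ennreal \<bar>det A\<bar> * (\<integral>\<^sup>+x. h (A *v x) \<partial>lborel)"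
proof -
  have "(\<integral>\<^sup>+y. h y \<partial>lborel) = (\<integral>\<^sup>+y. h y \<partial>density (distr lborel borel ((*v) A)) (\<lambda>_. ennreal \<bar>det A\<bar>))"
    using lborel_eq_density_distr_linear[OF A] by simp
  also have "\<dots> = ennreal \<bar>det A\<bar> * (\<integral>\<^sup>+x. h (A *v x) \<partial>lborel)"
    by (simp add: nn_integral_density nn_integral_distr nn_integral_cmult)
  finally show ?thesis .
qed

lemma AE_lborel_linear:
  fixes A :: "real^'n^'n"
  assumes A: "invertible A" and P: "AE y in lborel. P y"
  shows "AE x in lborel. P (A *v x)"
proof -
  obtain N where N: "{y. \<not> P y} \<subseteq> N" "N \<in> sets borel" "emeasure lborel N = 0"
    using P by (auto elim!: AE_E)
  have "det A \<noteq> 0" using A by (simp add: invertible_det_nz)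
  have "ennreal \<bar>det A\<bar> * (\<integral>\<^sup>+x. indicator N (A *v x) \<partial>lborel) = 0"
    using N by (subst nn_integral_lborel_linear[OF A, symmetric]) auto
  then have "(\<integral>\<^sup>+x. indicator N (A *v x) \<partial>lborel) = (0::ennreal)"
    using \<open>det A \<noteq> 0\<close> by simp
  then have "AE x in lborel. indicator N (A *v x) = (0::ennreal)"
    using N(2) by (subst (asm) nn_integral_0_iff_AE) auto
  then show ?thesis
    by eventually_elim (use N in \<open>auto simp: indicator_def split: if_splits\<close>)
qed

section \<open>Composition with one invertible matrix\<close>

text \<open>
  With \<open>E = 1 / \<sigma> - 1 / u\<close> this is the integrand \<open>(1 / \<eta>)\<^sup>r\<close> of the modular of the constant function
  \<open>1 / \<eta>\<close> for the exponent \<open>r = 1 / E\<close>. Where \<open>r = \<infinity>\<close> the modular involves an essential supremum; the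
  values \<open>0\<close> and \<open>\<infinity>\<close> chosen there turn the condition \<open>1 / \<eta> \<le> 1\<close> into a condition on an integral,
  which is convenient for measurability in a parameter.
\<close>

definition gap_integrand :: "real \<Rightarrow> real \<Rightarrow> ennreal" where
  "gap_integrand \<eta> E =
     (if 0 < E then ennreal ((1 / \<eta>) powr (1 / E)) else if 1 \<le> \<eta> then 0 else top)"

text \<open>
  Pointwise form of Hoelder's inequality for \<open>1 / \<sigma> = 1 / r + 1 / u\<close>, applied to the factors
  \<open>1 / \<eta>\<close> and \<open>b\<close> and with the same device as for the product of several functions: both factors
  are bounded by powers of the right-hand side.
\<close>

lemma ennreal_powr_divide_le_gap:
  assumes "0 < \<sigma>" "\<sigma> \<le> u" "0 < \<eta>"
  shows "ennreal_powr (b / ennreal \<eta>) \<sigma> \<le> gap_integrand \<eta> (1 / \<sigma> - 1 / u) + ennreal_powr b u"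
proof (cases "\<sigma> < u")
  case True
  define E where "E = 1 / \<sigma> - 1 / u"
  have "0 < E" using True assms by (simp add: E_def field_simps)
  define \<Sigma> where "\<Sigma> = ennreal ((1 / \<eta>) powr (1 / E)) + ennreal_powr b u"
  have "ennreal (1 / \<eta>) = ennreal_powr (ennreal ((1 / \<eta>) powr (1 / E))) E"
    using \<open>0 < E\<close> assms by (simp add: ennreal_powr_ennreal powr_powr)
  also have "\<dots> \<le> ennreal_powr \<Sigma> E"
    using \<open>0 < E\<close> by (intro ennreal_powr_mono) (auto simp: \<Sigma>_def)
  finally have 1: "ennreal (1 / \<eta>) \<le> ennreal_powr \<Sigma> E" .
  have "b = ennreal_powr (ennreal_powr b u) (1 / u)"
    using assms by (subst ennreal_powr_powr) auto
  also have "\<dots> \<le> ennreal_powr \<Sigma> (1 / u)"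
    using assms by (intro ennreal_powr_mono) (auto simp: \<Sigma>_def)
  finally have 2: "b \<le> ennreal_powr \<Sigma> (1 / u)" .
  have "b / ennreal \<eta> = ennreal (1 / \<eta>) * b"
    using assms by (simp add: divide_ennreal_def inverse_ennreal inverse_eq_divide mult.commute)
  also have "\<dots> \<le> ennreal_powr \<Sigma> E * ennreal_powr \<Sigma> (1 / u)"
    using 1 2 by (intro mult_mono) auto
  also have "\<dots> = ennreal_powr \<Sigma> (1 / \<sigma>)"
    using \<open>0 < E\<close> assms by (subst ennreal_powr_add[symmetric]) (auto simp: E_def)
  finally have "ennreal_powr (b / ennreal \<eta>) \<sigma> \<le> ennreal_powr (ennreal_powr \<Sigma> (1 / \<sigma>)) \<sigma>"
    using assms by (intro ennreal_powr_mono) auto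
  also have "\<dots> = \<Sigma>" using assms by (subst ennreal_powr_powr) auto
  finally show ?thesis using \<open>0 < E\<close> by (simp add: \<Sigma>_def gap_integrand_def E_def)
next
  case False
  then have "\<sigma> = u" using assms by simp
  show ?thesis
  proof (cases "1 \<le> \<eta>")
    case True
    have "b / ennreal \<eta> \<le> b / 1"
      using True unfolding divide_ennreal_def by (intro mult_left_mono ennreal_inverse_mono) auto
    then show ?thesis using \<open>\<sigma> = u\<close> assms True
      by (auto simp: gap_integrand_def divide_ennreal_def intro!: ennreal_powr_mono)
  qed (simp add: gap_integrand_def \<open>\<sigma> = u\<close>)
qed

lemma measurable_gap_integrand [measurable (raw)]:
  assumes [measurable]: "E \<in> borel_measurable M"
  shows "(\<lambda>x. gap_integrand \<eta> (E x)) \<in> borel_measurable M"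
  unfolding gap_integrand_def by measurable

text \<open>
  Passing from the exponent \<open>u\<close> to a smaller exponent \<open>\<sigma>\<close> costs twice the norm of the constant
  function one for the exponent \<open>r\<close> with \<open>1 / r = 1 / \<sigma> - 1 / u\<close>. This is how the exponent
  \<open>q\<^sub>i(A\<^sub>i\<^sup>-\<^sup>1 x)\<close> that a substitution produces is replaced by \<open>\<zeta> q\<^sub>i(x)\<close>.
\<close>

lemma lux_le_smaller_exponent:
  assumes [measurable]: "\<sigma> \<in> borel_measurable M" "u \<in> borel_measurable M" "g \<in> borel_measurable M"
    and exps: "AE x in M. 1 \<le> \<sigma> x \<and> \<sigma> x \<le> u x"
    and \<eta>: "0 < \<eta>" "(\<integral>\<^sup>+x. gap_integrand \<eta> (1 / \<sigma> x - 1 / u x) \<partial>M) \<le> 1"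
    and g: "lux_le M u g N"
  shows "lux_le M \<sigma> g (2 * ennreal \<eta> * N)"
proof (cases "N = top")
  case True
  then show ?thesis using \<eta> by (simp add: ennreal_mult_top)
next
  case False
  have "(\<integral>\<^sup>+x. ennreal_powr (g x / (ennreal \<eta> * N)) (\<sigma> x) \<partial>M)
    \<le> (\<integral>\<^sup>+x. gap_integrand \<eta> (1 / \<sigma> x - 1 / u x) + ennreal_powr (g x / N) (u x) \<partial>M)"
    using exps
  proof (intro nn_integral_mono_AE, eventually_elim)
    case (elim x)
    have "g x / (ennreal \<eta> * N) = g x / N / ennreal \<eta>"
      using False by (simp add: divide_ennreal_def ennreal_inverse_mult less_top mult_ac)
    then show ?case using elim \<eta> ennreal_powr_divide_le_gap[of "\<sigma> x" "u x" \<eta> "g x / N"] by simp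
  qed
  also have "\<dots> = (\<integral>\<^sup>+x. gap_integrand \<eta> (1 / \<sigma> x - 1 / u x) \<partial>M) + (\<integral>\<^sup>+x. ennreal_powr (g x / N) (u x) \<partial>M)"
    by (intro nn_integral_add) measurable
  also have "\<dots> \<le> 1 + 1" using \<eta> g by (intro add_mono) (auto simp: lux_le_def)
  finally have "(\<integral>\<^sup>+x. ennreal_powr (g x / (ennreal \<eta> * N)) (\<sigma> x) \<partial>M) \<le> ennreal 2" by simp
  then have "lux_le M \<sigma> g (ennreal 2 * (ennreal \<eta> * N))"
    by (rule lux_le_of_modular_le) (use exps in auto)
  then show ?thesis by (simp add: mult.assoc)
qed

text \<open>
  For \<open>d \<ge> 1\<close> the power \<open>1 / a\<close> suffices because \<open>s / a \<ge> 1\<close>, for \<open>d < 1\<close> the power \<open>1 / b\<close> because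
  \<open>s / b \<le> 1\<close>.
\<close>

lemma le_max_powr_powr:
  fixes d s a b :: real
  assumes "0 < d" "0 < a" "a \<le> s" "s \<le> b"
  shows "d \<le> max (d powr (1 / b)) (d powr (1 / a)) powr s"
proof (cases "1 \<le> d")
  case True
  have "d powr 1 \<le> d powr (s / a)"
    using True assms by (intro powr_mono) (auto simp: field_simps)
  also have "\<dots> = (d powr (1 / a)) powr s" by (simp add: powr_powr)
  also have "\<dots> \<le> max (d powr (1 / b)) (d powr (1 / a)) powr s"
    using assms by (intro powr_mono2) auto
  finally show ?thesis using True by simp
next
  case False
  have "d powr 1 \<le> d powr (s / b)"
    using False assms by (intro powr_mono') (auto simp: field_simps)
  also have "\<dots> = (d powr (1 / b)) powr s" by (simp add: powr_powr)
  also have "\<dots> \<le> max (d powr (1 / b)) (d powr (1 / a)) powr s"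
    using assms by (intro powr_mono2) auto
  finally show ?thesis using assms by simp
qed

text \<open>
  The Jacobian appears inside the modular, where it has to be absorbed by a factor that is raised to
  the variable exponent \<open>s\<close>. This explains the maximum of two powers of the determinant, taken at
  the extreme values of \<open>s\<close>.
\<close>

lemma lux_le_linear_substitution:
  fixes A :: "real^'n^'n"
  assumes A: "invertible A"
    and [measurable]: "s \<in> borel_measurable borel" "h \<in> borel_measurable borel"
    and s: "0 < a" "AE x in lborel. a \<le> s x \<and> s x \<le> b"
    and h: "lux_le lborel (\<lambda>y. s (matrix_inv A *v y)) h N"
  shows "lux_le lborel s (\<lambda>x. h (A *v x))
    (ennreal (max (\<bar>det (matrix_inv A)\<bar> powr (1 / b)) (\<bar>det (matrix_inv A)\<bar> powr (1 / a))) * N)"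
proof -
  define d where "d = \<bar>det (matrix_inv A)\<bar>"
  define D where "D = max (d powr (1 / b)) (d powr (1 / a))"
  have B: "invertible (matrix_inv A)" by (rule invertible_matrix_inv[OF A])
  then have "0 < d" by (simp add: d_def invertible_det_nz)
  then have "0 < D" by (simp add: D_def less_max_iff_disj)
  show ?thesis unfolding d_def[symmetric] D_def[symmetric]
  proof (cases "N = top")
    case True
    then show "lux_le lborel s (\<lambda>x. h (A *v x)) (ennreal D * N)"
      using \<open>0 < D\<close> by (simp add: ennreal_mult_top)
  next
    case False
    have "(\<integral>\<^sup>+x. ennreal_powr (h (A *v x) / (ennreal D * N)) (s x) \<partial>lborel)
      = ennreal d * (\<integral>\<^sup>+y. ennreal_powr (h y / (ennreal D * N)) (s (matrix_inv A *v y)) \<partial>lborel)"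
      by (subst nn_integral_lborel_linear[OF B]) (simp_all add: matrix_inv_mult[OF A] d_def)
    also have "\<dots> = (\<integral>\<^sup>+y. ennreal d * ennreal_powr (h y / (ennreal D * N)) (s (matrix_inv A *v y)) \<partial>lborel)"
      by (simp add: nn_integral_cmult)
    also have "\<dots> \<le> (\<integral>\<^sup>+y. ennreal_powr (h y / N) (s (matrix_inv A *v y)) \<partial>lborel)"
      using AE_lborel_linear[OF B s(2)]
    proof (intro nn_integral_mono_AE, eventually_elim)
      case (elim y)
      define \<sigma> where "\<sigma> = s (matrix_inv A *v y)"
      have \<sigma>: "a \<le> \<sigma>" "\<sigma> \<le> b" "0 < \<sigma>" using elim s(1) by (auto simp: \<sigma>_def)
      have "h y / (ennreal D * N) = ennreal (1 / D) * (h y / N)"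
        using False \<open>0 < D\<close>
        by (simp add: divide_ennreal_def ennreal_inverse_mult less_top inverse_ennreal inverse_eq_divide mult_ac)
      then have "ennreal d * ennreal_powr (h y / (ennreal D * N)) \<sigma>
          = ennreal (d * (1 / D) powr \<sigma>) * ennreal_powr (h y / N) \<sigma>"
        using \<sigma> \<open>0 < D\<close> \<open>0 < d\<close> by (simp add: ennreal_powr_mult ennreal_powr_ennreal ennreal_mult mult.assoc)
      also have "d * (1 / D) powr \<sigma> \<le> 1"
        using le_max_powr_powr[OF \<open>0 < d\<close> s(1) \<sigma>(1,2)] \<open>0 < D\<close> unfolding D_def[symmetric]
        by (simp add: powr_divide field_simps)
      then have "ennreal (d * (1 / D) powr \<sigma>) * ennreal_powr (h y / N) \<sigma> \<le> 1 * ennreal_powr (h y / N) \<sigma>"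
        by (intro mult_right_mono) (auto simp: ennreal_le_1)
      finally show ?case by (simp add: \<sigma>_def)
    qed
    finally show "lux_le lborel s (\<lambda>x. h (A *v x)) (ennreal D * N)"
      using h by (auto simp: lux_le_def)
  qed
qed

lemma norm_matrix_vector_le:
  fixes A :: "real^'n^'m"
  shows "norm (A *v x) \<le> norm A * norm x"
proof -
  have "norm (A *v x) \<le> L2_set (\<lambda>i. norm (A $ i) * norm x) UNIV"
    unfolding norm_vec_def[of "A *v x"]
    by (intro L2_set_mono) (auto simp: matrix_vector_mul_component Cauchy_Schwarz_ineq2)
  also have "\<dots> = norm A * norm x"
    by (simp add: norm_vec_def[of A] L2_set_left_distrib)
  finally show ?thesis .
qed

lemma norm_invertible_bounds:
  fixes A :: "real^'n^'n"
  assumes A: "invertible A"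
  shows "0 < norm A" "0 < norm (matrix_inv A)" "norm x \<le> norm (matrix_inv A) * norm (A *v x)"
    "1 \<le> norm A * norm (matrix_inv A)"
proof -
  show *: "norm x \<le> norm (matrix_inv A) * norm (A *v x)" for x
    using norm_matrix_vector_le[of "matrix_inv A" "A *v x"] by (simp add: matrix_inv_mult[OF A])
  \<comment> \<open>Any nonzero vector shows that the condition number is at least one.\<close>
  define e :: "real^'n" where "e = vec 1"
  have "norm e > 0" by (simp add: e_def vec_eq_iff)
  have "norm e \<le> norm (matrix_inv A) * norm (A *v e)" by (rule *)
  also have "\<dots> \<le> norm (matrix_inv A) * (norm A * norm e)"
    by (intro mult_left_mono norm_matrix_vector_le) auto
  finally have "norm e * 1 \<le> norm e * (norm A * norm (matrix_inv A))" by (simp add: mult_ac)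
  then show 1: "1 \<le> norm A * norm (matrix_inv A)"
    using \<open>norm e > 0\<close> by simp
  show "0 < norm A" "0 < norm (matrix_inv A)"
    using 1 by (auto simp: less_le)
qed

text \<open>
  For \<open>\<gamma> \<ge> 0\<close> the bound comes from \<open>\<bar>x\<bar> \<le> \<parallel>A\<^sup>-\<^sup>1\<parallel> \<bar>A x\<bar>\<close>, for \<open>\<gamma> < 0\<close> from
  \<open>\<bar>A x\<bar> \<le> \<parallel>A\<parallel> \<bar>x\<bar>\<close>.
\<close>

lemma norm_powr_le_weight:
  fixes A :: "real^'n^'n"
  assumes A: "invertible A" and "x \<noteq> 0"
  shows "norm x powr \<gamma> \<le> max (norm A powr (-\<gamma>)) (norm (matrix_inv A) powr \<gamma>) * norm (A *v x) powr \<gamma>"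
proof (cases "0 \<le> \<gamma>")
  case True
  have "norm x powr \<gamma> \<le> (norm (matrix_inv A) * norm (A *v x)) powr \<gamma>"
    using True norm_invertible_bounds[OF A] by (intro powr_mono2) auto
  also have "\<dots> = norm (matrix_inv A) powr \<gamma> * norm (A *v x) powr \<gamma>"
    by (simp add: powr_mult)
  also have "\<dots> \<le> max (norm A powr (-\<gamma>)) (norm (matrix_inv A) powr \<gamma>) * norm (A *v x) powr \<gamma>"
    by (intro mult_right_mono) auto
  finally show ?thesis .
next
  case False
  have "0 < norm x" using \<open>x \<noteq> 0\<close> by simp
  then have "0 < norm (matrix_inv A) * norm (A *v x)"
    using norm_invertible_bounds(3)[OF A, of x] by linarith
  then have pos: "0 < norm (A *v x)" by (simp add: zero_less_mult_iff)
  have "(norm A * norm x) powr \<gamma> \<le> norm (A *v x) powr \<gamma>"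
    using False pos by (intro powr_mono2' norm_matrix_vector_le) auto
  then have "norm x powr \<gamma> \<le> norm A powr (-\<gamma>) * norm (A *v x) powr \<gamma>"
    using norm_invertible_bounds(1)[OF A] by (simp add: powr_mult powr_minus field_simps)
  also have "\<dots> \<le> max (norm A powr (-\<gamma>)) (norm (matrix_inv A) powr \<gamma>) * norm (A *v x) powr \<gamma>"
    by (intro mult_right_mono) auto
  finally show ?thesis .
qed

section \<open>Dyadic shells\<close>

lemma mem_dyadic_shell: "x \<in> dyadic_shell k \<longleftrightarrow> 2 powi (k - 1) < norm x \<and> norm x \<le> 2 powi k"
  by (auto simp: dyadic_shell_def)

lemma dyadic_shell_borel [measurable]: "dyadic_shell k \<in> sets borel"
  by (simp add: dyadic_shell_def)

lemma two_powi: "2 powi k = 2 powr real_of_int k"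
  by (simp add: powr_real_of_int')

lemma dyadic_bounds_ceiling_log:
  assumes "0 < (y::real)"
  shows "2 powi (\<lceil>log 2 y\<rceil> - 1) < y" "y \<le> 2 powi \<lceil>log 2 y\<rceil>"
proof -
  have "log 2 y \<le> real_of_int \<lceil>log 2 y\<rceil>" "real_of_int (\<lceil>log 2 y\<rceil> - 1) < log 2 y"
    by linarith+
  then show "2 powi (\<lceil>log 2 y\<rceil> - 1) < y" "y \<le> 2 powi \<lceil>log 2 y\<rceil>"
    unfolding two_powi using assms by (simp_all only: log_le_iff less_log_iff one_less_numeral_iff semiring_norm)
qed

lemma dyadic_shell_of_norm:
  assumes "x \<noteq> 0"
  shows "x \<in> dyadic_shell \<lceil>log 2 (norm x)\<rceil>"
  using dyadic_bounds_ceiling_log[of "norm x"] assms by (simp add: mem_dyadic_shell)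

text \<open>
  The image of a shell meets few shells. With \<open>2\<^sup>l\<close> the dyadic size of the norm of \<open>A\<close>, the upper
  bound \<open>\<bar>A x\<bar> \<le> \<parallel>A\<parallel> \<bar>x\<bar>\<close> keeps \<open>A x\<close> inside the ball of radius \<open>2\<^sup>k\<^sup>+\<^sup>l\<close>, and the lower bound
  \<open>\<bar>x\<bar> \<le> \<parallel>A\<^sup>-\<^sup>1\<parallel> \<bar>A x\<bar>\<close> costs at most the condition number, which is smaller than the power of two
  with exponent \<open>- \<Theta>\<close>.
\<close>

lemma linear_image_dyadic_shell:
  fixes A :: "real^'n^'n"
  assumes A: "invertible A" and x: "x \<in> dyadic_shell k"
    and \<Theta>: "norm A * norm (matrix_inv A) < 2 powi (-\<Theta>)"
  shows "\<exists>r\<in>{\<Theta> - 1..0}. A *v x \<in> dyadic_shell (k + \<lceil>log 2 (norm A)\<rceil> + r)"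
proof -
  define l where "l = \<lceil>log 2 (norm A)\<rceil>"
  have l: "2 powi (l - 1) < norm A" "norm A \<le> 2 powi l"
    using dyadic_bounds_ceiling_log[of "norm A"] norm_invertible_bounds(1)[OF A] by (auto simp: l_def)
  have k: "2 powi (k - 1) < norm x" "norm x \<le> 2 powi k" using x by (auto simp: mem_dyadic_shell)
  have "0 < norm x" using k(1) by (rule order_le_less_trans[rotated]) simp
  define j where "j = \<lceil>log 2 (norm (A *v x))\<rceil>"
  have "0 < norm (matrix_inv A) * norm (A *v x)"
    using norm_invertible_bounds(3)[OF A, of x] \<open>0 < norm x\<close> by linarith
  then have "0 < norm (A *v x)" by (simp add: zero_less_mult_iff)
  then have Ax: "A *v x \<noteq> 0" by auto
  have j: "2 powi (j - 1) < norm (A *v x)" "norm (A *v x) \<le> 2 powi j"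
    using dyadic_shell_of_norm[OF Ax] by (auto simp: mem_dyadic_shell j_def)
  have "norm (A *v x) \<le> 2 powi l * 2 powi k"
    using norm_matrix_vector_le[of A x] l(2) k(2) mult_mono[of "norm A" "2 powi l" "norm x" "2 powi k"] by simp
  also have "\<dots> = 2 powi (l + k)" by (simp add: power_int_add)
  finally have "(2::real) powi (j - 1) < 2 powi (l + k)" using j(1) by simp
  then have up: "j \<le> k + l" by (simp add: two_powi)
  have "2 powi (l - 1) * 2 powi (k - 1) < norm A * norm x"
    using l(1) k(1) norm_invertible_bounds(1)[OF A] by (intro mult_strict_mono) auto
  also have "\<dots> \<le> norm A * (norm (matrix_inv A) * norm (A *v x))"
    by (intro mult_left_mono norm_invertible_bounds(3)[OF A]) auto
  also have "\<dots> \<le> 2 powi (-\<Theta>) * 2 powi j"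
    using \<Theta> j(2) mult_mono[of "norm A * norm (matrix_inv A)" "2 powi (-\<Theta>)" "norm (A *v x)" "2 powi j"]
    by (simp add: mult.assoc)
  also have "\<dots> = 2 powi (j - \<Theta>)" by (simp add: power_int_add[symmetric])
  finally have "(2::real) powi (l - 1 + (k - 1)) < 2 powi (j - \<Theta>)"
    unfolding two_powi by (simp flip: powr_add)
  then have "l - 1 + (k - 1) < j - \<Theta>" by (simp add: two_powi)
  then have "j - (k + l) \<in> {\<Theta> - 1..0}" using up by auto
  moreover have "A *v x \<in> dyadic_shell (k + l + (j - (k + l)))"
    using dyadic_shell_of_norm[OF Ax] by (simp add: j_def)
  ultimately show ?thesis unfolding l_def by blast
qed

text \<open>
  The three effects of substituting \<open>y = A x\<close> on a shell are put together: the shells that \<open>A x\<close> can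
  visit, the weight, and the two changes of the norm (Jacobian and exponent).
\<close>

lemma shell_substitution_bound:
  fixes A :: "real^'n^'n" and g :: "real^'n \<Rightarrow> ennreal"
  assumes A: "invertible A" and \<Theta>: "norm A * norm (matrix_inv A) < 2 powi (-\<Theta>)"
    and [measurable]: "s \<in> borel_measurable borel" "g \<in> borel_measurable borel"
    and s: "1 \<le> a" "AE x in lborel. a \<le> s x \<and> s x \<le> b"
    and dil: "AE x in lborel. s (matrix_inv A *v x) \<le> \<zeta> * s x"
    and \<eta>: "0 < \<eta>" "(\<integral>\<^sup>+x. gap_integrand \<eta> (1 / s (matrix_inv A *v x) - 1 / (\<zeta> * s x)) \<partial>lborel) \<le> 1"
    and g: "\<And>j. lux_le lborel (\<lambda>x. \<zeta> * s x)
        (\<lambda>y. g y * ennreal (norm y powr \<gamma>) * indicator (dyadic_shell j) y) (N j)"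
  shows "lux_le lborel s (\<lambda>x. g (A *v x) * ennreal (norm x powr \<gamma>) * indicator (dyadic_shell k) x)
    (ennreal (max (norm A powr (-\<gamma>)) (norm (matrix_inv A) powr \<gamma>) *
        max (\<bar>det (matrix_inv A)\<bar> powr (1 / b)) (\<bar>det (matrix_inv A)\<bar> powr (1 / a))) *
      (2 * ennreal \<eta>) * (\<Sum>r\<in>{\<Theta> - 1..0}. N (k + \<lceil>log 2 (norm A)\<rceil> + r)))"
proof -
  define w where "w = max (norm A powr (-\<gamma>)) (norm (matrix_inv A) powr \<gamma>)"
  define d where "d = max (\<bar>det (matrix_inv A)\<bar> powr (1 / b)) (\<bar>det (matrix_inv A)\<bar> powr (1 / a))"
  define l where "l = \<lceil>log 2 (norm A)\<rceil>"
  define R where "R = {\<Theta> - 1..0}"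
  define G where "G = (\<lambda>j y. g y * ennreal (norm y powr \<gamma>) * indicator (dyadic_shell j) y :: ennreal)"
  have [measurable]: "G j \<in> borel_measurable borel" for j unfolding G_def by measurable
  have w0: "0 \<le> w" "0 \<le> d" by (auto simp: w_def d_def le_max_iff_disj)
  have B: "invertible (matrix_inv A)" by (rule invertible_matrix_inv[OF A])
  have sB: "AE x in lborel. a \<le> s (matrix_inv A *v x) \<and> s (matrix_inv A *v x) \<le> b"
    by (rule AE_lborel_linear[OF B s(2)])
  have exps: "AE x in lborel. 1 \<le> s (matrix_inv A *v x) \<and> s (matrix_inv A *v x) \<le> \<zeta> * s x"
    using sB dil by eventually_elim (use s(1) in auto)
  have sum: "lux_le lborel (\<lambda>x. \<zeta> * s x) (\<lambda>y. \<Sum>r\<in>R. G (k + l + r) y) (\<Sum>r\<in>R. N (k + l + r))"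
  proof (rule lux_le_sum)
    show "AE x in lborel. 1 \<le> \<zeta> * s x" using exps by eventually_elim auto
    show "lux_le lborel (\<lambda>x. \<zeta> * s x) (G (k + l + r)) (N (k + l + r))" for r
      using g unfolding G_def by simp
  qed (auto simp: R_def lborel.sigma_finite_measure_axioms)
  have "lux_le lborel (\<lambda>x. s (matrix_inv A *v x)) (\<lambda>y. \<Sum>r\<in>R. G (k + l + r) y)
      (2 * ennreal \<eta> * (\<Sum>r\<in>R. N (k + l + r)))"
    by (rule lux_le_smaller_exponent[OF _ _ _ exps \<eta> sum]) measurable
  then have "lux_le lborel (\<lambda>x. s (matrix_inv A *v x)) (\<lambda>y. ennreal w * (\<Sum>r\<in>R. G (k + l + r) y))
      (ennreal w * (2 * ennreal \<eta> * (\<Sum>r\<in>R. N (k + l + r))))"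
    by (rule lux_le_cmult) simp
  then have "lux_le lborel s (\<lambda>x. ennreal w * (\<Sum>r\<in>R. G (k + l + r) (A *v x)))
      (ennreal d * (ennreal w * (2 * ennreal \<eta> * (\<Sum>r\<in>R. N (k + l + r)))))"
    unfolding d_def by (rule lux_le_linear_substitution[OF A, rotated 4]) (use s in auto)
  then have "lux_le lborel s (\<lambda>x. g (A *v x) * ennreal (norm x powr \<gamma>) * indicator (dyadic_shell k) x)
      (ennreal d * (ennreal w * (2 * ennreal \<eta> * (\<Sum>r\<in>R. N (k + l + r)))))"
  proof (rule lux_le_mono)
    show "AE x in lborel. g (A *v x) * ennreal (norm x powr \<gamma>) * indicator (dyadic_shell k) x
      \<le> ennreal w * (\<Sum>r\<in>R. G (k + l + r) (A *v x))"
    proof (intro always_eventually allI)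
      fix x
      show "g (A *v x) * ennreal (norm x powr \<gamma>) * indicator (dyadic_shell k) x
        \<le> ennreal w * (\<Sum>r\<in>R. G (k + l + r) (A *v x))"
      proof (cases "x \<in> dyadic_shell k")
        case True
        obtain r where r: "r \<in> R" "A *v x \<in> dyadic_shell (k + l + r)"
          using linear_image_dyadic_shell[OF A True \<Theta>] unfolding R_def l_def by blast
        have "x \<noteq> 0"
        proof
          assume "x = 0"
          then have "(2::real) powi (k - 1) < 0" using True by (simp add: mem_dyadic_shell)
          then show False by (simp add: two_powi)
        qed
        have "g (A *v x) * ennreal (norm x powr \<gamma>) \<le> g (A *v x) * ennreal (w * norm (A *v x) powr \<gamma>)"
          using norm_powr_le_weight[OF A \<open>x \<noteq> 0\<close>, of \<gamma>] unfolding w_def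
          by (intro mult_left_mono ennreal_leI) auto
        also have "\<dots> = ennreal w * G (k + l + r) (A *v x)"
          using r w0 by (simp add: G_def ennreal_mult mult_ac)
        also have "\<dots> \<le> ennreal w * (\<Sum>r\<in>R. G (k + l + r) (A *v x))"
          using r by (intro mult_left_mono member_le_sum) (auto simp: R_def)
        finally show ?thesis using True by simp
      qed simp
    qed
  qed (use s in \<open>auto elim: eventually_mono\<close>)
  moreover have "ennreal d * (ennreal w * (2 * ennreal \<eta> * (\<Sum>r\<in>R. N (k + l + r))))
    = ennreal (w * d) * (2 * ennreal \<eta>) * (\<Sum>r\<in>R. N (k + l + r))"
    using w0 by (simp add: ennreal_mult mult_ac)
  ultimately show ?thesis unfolding w_def d_def R_def l_def by simp
qed

section \<open>The norm of the constant function one\<close>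

text \<open>
  A variant of the norm of the constant function one for the exponent \<open>r\<close> with
  \<open>1 / r(x) = 1 / s(B x) - 1 / (\<zeta> s(x))\<close>. The infimum runs over the rational numbers so that it is
  a measurable function of \<open>B\<close>.
\<close>

definition unit_dilation_norm :: "(real^'n \<Rightarrow> real) \<Rightarrow> real \<Rightarrow> real^'n^'n \<Rightarrow> ennreal" where
  "unit_dilation_norm s \<zeta> B =
     (INF \<eta>\<in>{\<eta>\<in>\<rat>. 0 < \<eta>}.
        if (\<integral>\<^sup>+x. gap_integrand \<eta> (1 / s (B *v x) - 1 / (\<zeta> * s x)) \<partial>lborel) \<le> 1 then ennreal \<eta> else top)"

text \<open>
  The preceding bound holds for every rational \<open>\<eta>\<close> admitted in the infimum, hence for the infimum,
  since Luxemburg bounds are closed.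
\<close>

lemma shell_substitution_bound_norm:
  fixes A :: "real^'n^'n" and g :: "real^'n \<Rightarrow> ennreal"
  assumes A: "invertible A" and \<Theta>: "norm A * norm (matrix_inv A) < 2 powi (-\<Theta>)"
    and [measurable]: "s \<in> borel_measurable borel" "g \<in> borel_measurable borel"
    and s: "1 \<le> a" "AE x in lborel. a \<le> s x \<and> s x \<le> b"
    and dil: "AE x in lborel. s (matrix_inv A *v x) \<le> \<zeta> * s x"
    and fin: "\<And>j. N j < top" and U: "unit_dilation_norm s \<zeta> (matrix_inv A) < top"
    and g: "\<And>j. lux_le lborel (\<lambda>x. \<zeta> * s x)
        (\<lambda>y. g y * ennreal (norm y powr \<gamma>) * indicator (dyadic_shell j) y) (N j)"
  shows "lux_le lborel s (\<lambda>x. g (A *v x) * ennreal (norm x powr \<gamma>) * indicator (dyadic_shell k) x)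
    (ennreal (max (norm A powr (-\<gamma>)) (norm (matrix_inv A) powr \<gamma>) *
        max (\<bar>det (matrix_inv A)\<bar> powr (1 / b)) (\<bar>det (matrix_inv A)\<bar> powr (1 / a))) *
      (2 * unit_dilation_norm s \<zeta> (matrix_inv A)) * (\<Sum>r\<in>{\<Theta> - 1..0}. N (k + \<lceil>log 2 (norm A)\<rceil> + r)))"
    (is "lux_le _ _ ?h (ennreal ?W * (2 * ?U) * ?S)")
proof (rule lux_le_closed)
  fix \<theta> :: ennreal assume \<theta>: "ennreal ?W * (2 * ?U) * ?S < \<theta>"
  \<comment> \<open>The constant is collected so that an admissible \<open>\<eta>\<close> below \<open>\<theta> / C\<close> can be chosen.\<close>
  define C where "C = ennreal ?W * 2 * ?S"
  have "C < top" using fin by (simp add: C_def ennreal_mult_less_top)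
  have "C * ?U < \<theta>" using \<theta> by (simp add: C_def mult_ac)
  let ?P = "\<lambda>\<eta>. (\<integral>\<^sup>+x. gap_integrand \<eta> (1 / s (matrix_inv A *v x) - 1 / (\<zeta> * s x)) \<partial>lborel) \<le> 1"
  have ex: "\<exists>\<eta>>0. ?P \<eta> \<and> ennreal \<eta> < u" if "?U < u" for u
    using that unfolding unit_dilation_norm_def INF_less_iff by (auto split: if_splits)
  have "\<exists>\<eta>>0. ?P \<eta> \<and> C * ennreal \<eta> \<le> \<theta>"
  proof (cases "C = 0")
    case True
    then show ?thesis using ex[OF U] by auto
  next
    case False
    have cancel: "C * (\<theta> / C) = \<theta>"
      using False \<open>C < top\<close> by (simp add: ennreal_times_divide mult.commute[of C] ennreal_mult_divide_eq less_top[symmetric])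
    have "?U < \<theta> / C"
    proof (rule ccontr)
      assume "\<not> ?U < \<theta> / C"
      then have "C * (\<theta> / C) \<le> C * ?U" by (intro mult_left_mono) auto
      then show False using cancel \<open>C * ?U < \<theta>\<close> by simp
    qed
    then obtain \<eta> where "0 < \<eta>" "?P \<eta>" "ennreal \<eta> < \<theta> / C" using ex by blast
    then have "C * ennreal \<eta> \<le> C * (\<theta> / C)" by (intro mult_left_mono) auto
    then show ?thesis using cancel \<open>0 < \<eta>\<close> \<open>?P \<eta>\<close> by auto
  qed
  then obtain \<eta> where \<eta>: "0 < \<eta>" "?P \<eta>" "C * ennreal \<eta> \<le> \<theta>" by blast
  show "lux_le lborel s ?h \<theta>"
  proof (rule lux_le_mono[OF shell_substitution_bound[OF A \<Theta> assms(3,4) s dil \<eta>(1,2) g]])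
    show "ennreal ?W * (2 * ennreal \<eta>) * ?S \<le> \<theta>"
      using \<eta>(3) by (simp add: C_def mult_ac)
  qed (use s in \<open>auto elim: eventually_mono\<close>)
next
  show "?h \<in> borel_measurable lborel" by measurable
qed (use s in \<open>auto elim: eventually_mono\<close>)

lemma measurable_unit_dilation_norm:
  assumes [measurable]: "s \<in> borel_measurable borel" "B \<in> borel_measurable M"
    and "\<And>\<eta>. (\<lambda>(t, x). s (B t *v x)) \<in> borel_measurable (M \<Otimes>\<^sub>M lborel)"
  shows "(\<lambda>t. unit_dilation_norm s \<zeta> (B t)) \<in> borel_measurable M"
proof -
  have [measurable]: "(\<lambda>t. \<integral>\<^sup>+x. gap_integrand \<eta> (1 / s (B t *v x) - 1 / (\<zeta> * s x)) \<partial>lborel) \<in> borel_measurable M" for \<eta>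
    using assms(3) by (intro lborel.borel_measurable_nn_integral) (auto simp: case_prod_beta)
  show ?thesis unfolding unit_dilation_norm_def
    by (intro borel_measurable_INF) (auto intro: countable_subset[OF _ countable_rat])
qed

text \<open>
  One inequality between the two norms is enough: finiteness of the integral with the larger norm
  gives finiteness of the integral with the measurable one. The modular decreases in \<open>\<eta>\<close>, so every
  rational number above an admissible real number is admissible.
\<close>

lemma unit_dilation_norm_le_Lp_norm:
  fixes B :: "real^'n^'n"
  assumes q: "q \<in> bounded_variable_exponents" and B: "invertible B" and \<zeta>: "0 < \<zeta>"
    and [measurable]: "s \<in> borel_measurable borel" and sq: "AE x in lborel. q x = ennreal (s x)"
  shows "unit_dilation_norm s \<zeta> (matrix_inv B) \<le> Lp_norm (r_exponent B q \<zeta>) (\<lambda>x. 1)"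
  unfolding Lp_norm_def
proof (rule Inf_greatest, clarify)
  fix e :: real assume e: "0 < e" and mod: "Lp_modular (r_exponent B q \<zeta>) (\<lambda>x. 1 / of_real e) \<le> 1"
  define C where "C = matrix_inv B"
  have C: "invertible C" unfolding C_def by (rule invertible_matrix_inv[OF B])
  have q1: "1 \<le> q x" for x using q by (simp add: bounded_variable_exponents_def variable_exponents_def)
  define r where "r = r_exponent B q \<zeta>"
  define E where "E x = 1 / s (C *v x) - 1 / (\<zeta> * s x)" for x
  have [measurable]: "E \<in> borel_measurable borel" unfolding E_def by measurable
  have rE: "AE x in lborel. (r x = \<infinity> \<longleftrightarrow> E x \<le> 0) \<and> (0 < E x \<longrightarrow> enn2real (r x) = 1 / E x)"
    using sq AE_lborel_linear[OF C sq]
  proof eventually_elim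
    case (elim x)
    have s1: "1 \<le> s x" "1 \<le> s (C *v x)"
      using q1[of x] q1[of "C *v x"] elim by simp_all
    have "inverse (q (C *v x)) - inverse (ennreal \<zeta> * q x) = ennreal (E x)"
      using s1 elim \<zeta> by (simp add: inverse_ennreal E_def inverse_eq_divide ennreal_minus flip: ennreal_mult)
    then have "r x = inverse (ennreal (E x))" by (simp add: r_def r_exponent_def C_def)
    then show ?case
      by (cases "0 < E x") (auto simp: inverse_ennreal inverse_eq_divide ennreal_neg not_less)
  qed
  have meas: "{x. r x = \<infinity>} \<in> sets lebesgue"
  proof -
    have "Measurable.pred lebesgue (\<lambda>x. r x = \<infinity> \<and> \<not> E x \<le> 0)" "Measurable.pred lebesgue (\<lambda>x. r x \<noteq> \<infinity> \<and> E x \<le> 0)"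
      using rE by (auto intro!: sets_completion_AE elim: eventually_mono)
    moreover have "Measurable.pred lborel (\<lambda>x. E x \<le> 0)" by measurable
    then have "Measurable.pred lebesgue (\<lambda>x. E x \<le> 0)" by (rule measurable_completion)
    ultimately have "{x. r x = \<infinity> \<and> \<not> E x \<le> 0} \<union> ({x. E x \<le> 0} - {x. r x \<noteq> \<infinity> \<and> E x \<le> 0}) \<in> sets lebesgue"
      by (intro sets.Un sets.Diff) (simp_all add: pred_def)
    also have "{x. r x = \<infinity> \<and> \<not> E x \<le> 0} \<union> ({x. E x \<le> 0} - {x. r x \<noteq> \<infinity> \<and> E x \<le> 0}) = {x. r x = \<infinity>}"
      by auto
    finally show ?thesis .
  qed
  have gap: "(\<integral>\<^sup>+x. gap_integrand \<eta> (E x) \<partial>lborel) \<le> 1" if "e \<le> \<eta>" for \<eta>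
  proof -
    have ess: "esssup (restrict_space lebesgue {x. r x = \<infinity>}) (\<lambda>x. ennreal (norm (1 / complex_of_real e))) \<le> 1"
      using mod unfolding Lp_modular_def r_def[symmetric] by (rule order_trans[OF add_increasing[OF _ order_refl], rotated]) simp
    have "AE x in restrict_space lebesgue {x. r x = \<infinity>}. 1 \<le> e"
      using esssup_AE[where M="restrict_space lebesgue {x. r x = \<infinity>}" and f="\<lambda>x. ennreal (norm (1 / complex_of_real e))"]
    proof eventually_elim
      case (elim x)
      then have "ennreal (norm (1 / complex_of_real e)) \<le> 1" using ess by (rule order_trans)
      then show ?case using e by (simp add: norm_divide ennreal_le_1)
    qed
    then have "AE x in lebesgue. x \<in> {x. r x = \<infinity>} \<longrightarrow> 1 \<le> e"
      by (subst (asm) AE_restrict_space_iff) (use meas in auto)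
    then have "AE x in lborel. r x = \<infinity> \<longrightarrow> 1 \<le> e"
      unfolding AE_completion_iff mem_Collect_eq .
    then have "(\<integral>\<^sup>+x. gap_integrand \<eta> (E x) \<partial>lborel) \<le>
       (\<integral>\<^sup>+x\<in>- {x. r x = \<infinity>}. ennreal (norm (1 / complex_of_real e) powr enn2real (r x)) \<partial>lborel)"
      using rE
    proof (intro nn_integral_mono_AE, eventually_elim)
      case (elim x)
      show ?case
      proof (cases "0 < E x")
        case True
        have "(1 / \<eta>) powr (1 / E x) \<le> (1 / e) powr (1 / E x)"
          using True e that by (intro powr_mono2) (auto simp: field_simps)
        then show ?thesis using True elim e by (auto simp: gap_integrand_def norm_divide intro!: ennreal_leI)
      qed (use elim that in \<open>auto simp: gap_integrand_def\<close>)
    qed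
    also have "\<dots> \<le> 1"
      using mod unfolding Lp_modular_def r_def[symmetric] nn_integral_completion
      by (rule order_trans[OF add_increasing2[OF _ order_refl], rotated]) simp
    finally show ?thesis .
  qed
  show "unit_dilation_norm s \<zeta> (matrix_inv B) \<le> ennreal e"
  proof (rule dense_ge)
    fix y assume "ennreal e < y"
    then obtain z where z: "e < z" "ennreal z \<le> y"
      using e by (cases y) (auto simp: ennreal_less_iff intro: that[of "e + 1"])
    obtain \<eta> where "\<eta> \<in> \<rat>" "e < \<eta>" "\<eta> < z" using Rats_dense_in_real[OF z(1)] by blast
    then have \<eta>: "\<eta> \<in> \<rat>" "e < \<eta>" "ennreal \<eta> \<le> y"
      using z(2) by (auto intro: order_trans[OF ennreal_leI z(2)])
    then have "unit_dilation_norm s \<zeta> (matrix_inv B) \<le> ennreal \<eta>"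
      unfolding unit_dilation_norm_def C_def[symmetric] E_def[symmetric] using e gap[of \<eta>]
      by (intro INF_lower2[of \<eta>]) auto
    then show "unit_dilation_norm s \<zeta> (matrix_inv B) \<le> y" using \<eta>(3) by simp
  qed
qed

section \<open>Measurable dependence on the matrix\<close>

lemma borel_measurable_vec:
  fixes f :: "'a \<Rightarrow> 'b::euclidean_space^'n"
  assumes "\<And>i. (\<lambda>x. f x $ i) \<in> borel_measurable M"
  shows "f \<in> borel_measurable M"
proof (subst borel_measurable_euclidean_space, intro ballI)
  fix b :: "'b^'n" assume "b \<in> Basis"
  then obtain i u where "b = axis i u" by (auto simp: Basis_vec_def)
  then show "(\<lambda>x. f x \<bullet> b) \<in> borel_measurable M"
    using assms[of i] by (simp add: inner_axis)
qed

lemma measurable_vec_nth [measurable (raw)]: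
  fixes f :: "'a \<Rightarrow> 'b::euclidean_space^'n"
  assumes "f \<in> borel_measurable M"
  shows "(\<lambda>x. f x $ i) \<in> borel_measurable M"
  by (rule borel_measurable_continuous_on[OF _ assms, of "\<lambda>v. v $ i"]) (intro continuous_intros)

lemma measurable_matrix_vector_mult [measurable (raw)]:
  fixes A :: "'a \<Rightarrow> real^'n^'m"
  assumes [measurable]: "A \<in> borel_measurable M" "f \<in> borel_measurable M"
  shows "(\<lambda>x. A x *v f x) \<in> borel_measurable M"
  by (rule borel_measurable_vec) (simp add: matrix_vector_mult_def)

lemma measurable_det [measurable (raw)]:
  fixes A :: "'a \<Rightarrow> real^'n^'n"
  assumes [measurable]: "A \<in> borel_measurable M"
  shows "(\<lambda>x. det (A x)) \<in> borel_measurable M"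
  unfolding det_def by measurable

text \<open>
  Cramer's rule gives the entries of the inverse on the open set of invertible matrices. On the
  singular matrices the choice in the definition of the inverse is made for an unsatisfiable
  condition, hence always has the same value.
\<close>

lemma measurable_matrix_inv [measurable (raw)]:
  fixes A :: "'a \<Rightarrow> real^'n^'n"
  assumes [measurable]: "A \<in> borel_measurable M"
  shows "(\<lambda>x. matrix_inv (A x)) \<in> borel_measurable M"
proof -
  have inv: "matrix_inv B = (if det B \<noteq> 0
      then (\<chi> k j. det (\<chi> i l. if l = k then axis j 1 $ i else B $ i $ l) / det B)
      else (SOME B'. False))" for B :: "real^'n^'n"
  proof (cases "det B \<noteq> 0")
    case True
    then have B: "invertible B" by (simp add: invertible_det_nz)
    have "matrix_inv B $ k $ j = det (\<chi> i l. if l = k then axis j 1 $ i else B $ i $ l) / det B" for k j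
    proof -
      have "B *v (matrix_inv B *v axis j 1) = axis j 1" using matrix_inv_mult[OF B] by simp
      then have "matrix_inv B *v axis j 1 = (\<chi> k. det (\<chi> i l. if l = k then axis j 1 $ i else B $ i $ l) / det B)"
        using cramer[OF True] by blast
      moreover have "(matrix_inv B *v axis j 1) $ k = matrix_inv B $ k $ j"
        by (simp add: matrix_vector_mult_def axis_def if_distrib cong: if_cong)
      ultimately show ?thesis by simp
    qed
    then show ?thesis using True by (simp add: vec_eq_iff)
  next
    case False
    then have "\<not> invertible B" by (simp add: invertible_det_nz)
    then have "(\<lambda>B'. B ** B' = mat 1 \<and> B' ** B = mat 1) = (\<lambda>_. False)"
      unfolding invertible_def by auto
    then show ?thesis using False unfolding matrix_inv_def by simp
  qed
  have "(\<lambda>x. \<chi> k j. det (\<chi> i l. if l = k then axis j 1 $ i else A x $ i $ l) / det (A x)) \<in> borel_measurable M"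
  proof (intro borel_measurable_vec)
    fix k j :: 'n
    have "(\<lambda>x. (\<chi> i l. if l = k then axis j 1 $ i else A x $ i $ l) :: real^'n^'n) \<in> borel_measurable M"
      by (intro borel_measurable_vec) (simp add: if_distrib[of "\<lambda>f. f _"])
    note this[measurable]
    show "(\<lambda>x. (\<chi> k j. det (\<chi> i l. if l = k then axis j 1 $ i else A x $ i $ l) / det (A x)) $ k $ j) \<in> borel_measurable M"
      by simp
  qed
  note this[measurable]
  show ?thesis unfolding inv by measurable
qed

lemma borel_measurable_hausdorff_weight:
  fixes \<Phi> :: "real^'n \<Rightarrow> real"
  assumes [measurable]: "\<Phi> \<in> borel_measurable lebesgue"
  shows "(\<lambda>t. \<Phi> t / norm t ^ CARD('n)) \<in> borel_measurable lebesgue"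
proof -
  have "(\<lambda>t::real^'n. norm t ^ CARD('n)) \<in> borel_measurable lebesgue"
    by (rule measurable_completion) measurable
  note this[measurable]
  show ?thesis by measurable
qed

section \<open>The condition numbers and the log-Hoelder index\<close>

text \<open>
  Solving \<open>\<kappa> < 2\<^sup>-\<^sup>k\<close> for the integer \<open>k\<close> gives a formula that is visibly measurable in \<open>t\<close>. The
  condition numbers are at least one, which makes \<open>\<Theta>\<close> negative.
\<close>

lemma Theta_eq:
  fixes A :: "nat \<Rightarrow> real^'n \<Rightarrow> real^'n^'n"
  assumes "1 \<le> m" and inv: "\<And>i. i \<in> {1..m} \<Longrightarrow> invertible (A i t)"
  shows "Theta m A t = \<lceil>- log 2 (MAX i\<in>{1..m}. norm (A i t) * norm (matrix_inv (A i t)))\<rceil> - 1"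
    and "i \<in> {1..m} \<Longrightarrow> norm (A i t) * norm (matrix_inv (A i t)) < 2 powi (- Theta m A t)"
    and "Theta m A t \<le> -1"
proof -
  define \<kappa> where "\<kappa> = (MAX i\<in>{1..m}. norm (A i t) * norm (matrix_inv (A i t)))"
  have le: "norm (A i t) * norm (matrix_inv (A i t)) \<le> \<kappa>" if "i \<in> {1..m}" for i
    unfolding \<kappa>_def using that by (intro Max_ge) auto
  have "1 \<le> \<kappa>"
    using le[of 1] norm_invertible_bounds(4)[OF inv[of 1]] \<open>1 \<le> m\<close> by simp
  then have iff: "\<kappa> < 2 powi (- k) \<longleftrightarrow> k \<le> \<lceil>- log 2 \<kappa>\<rceil> - 1" for k
  proof -
    have "\<kappa> < 2 powi (- k) \<longleftrightarrow> log 2 \<kappa> < real_of_int (- k)"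
      unfolding two_powi using \<open>1 \<le> \<kappa>\<close> by (subst log_less_iff) auto
    also have "\<dots> \<longleftrightarrow> k \<le> \<lceil>- log 2 \<kappa>\<rceil> - 1" by linarith
    finally show ?thesis .
  qed
  have "(GREATEST k. \<kappa> < 2 powi (- k)) = \<lceil>- log 2 \<kappa>\<rceil> - 1"
    by (rule Greatest_equality) (simp_all only: iff order_refl)
  then show eq: "Theta m A t = \<lceil>- log 2 (MAX i\<in>{1..m}. norm (A i t) * norm (matrix_inv (A i t)))\<rceil> - 1"
    by (simp add: Theta_def \<kappa>_def)
  show "norm (A i t) * norm (matrix_inv (A i t)) < 2 powi (- Theta m A t)" if "i \<in> {1..m}"
    using le[OF that] iff[of "Theta m A t"] eq by (simp add: \<kappa>_def)
  have "0 \<le> log 2 \<kappa>" using \<open>1 \<le> \<kappa>\<close> by simp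
  then have "\<lceil>- log 2 \<kappa>\<rceil> \<le> 0" by linarith
  then show "Theta m A t \<le> -1" using eq by (simp add: \<kappa>_def)
qed

text \<open>
  On the shell with index \<open>k\<close> both logarithms are of order \<open>\<bar>k\<bar>\<close>: the one of \<open>1 / \<bar>x\<bar>\<close> for
  \<open>k \<le> 0\<close>, the one of \<open>\<bar>x\<bar>\<close> for \<open>k > 0\<close>. Since the value at the origin is also the limit at
  infinity, the distance of \<open>\<alpha> x\<close> from \<open>\<alpha> 0\<close> is \<open>O(1 / \<bar>k\<bar>)\<close> on every shell. Consequently
  \<open>2\<^sup>k\<^sup>\<alpha>\<close> may be replaced by the constant \<open>2\<^sup>k\<^sup>\<alpha>\<^sup>(\<^sup>0\<^sup>)\<close> at the cost of a bounded factor.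
\<close>

lemma log_Hoelder_shell_oscillation:
  fixes \<alpha> :: "real^'n \<Rightarrow> real"
  assumes "\<alpha> \<in> C_log_0 \<inter> C_log_infinity" and Lim: "\<alpha> 0 = Lim at_infinity \<alpha>"
  obtains K where "\<And>k x. x \<in> dyadic_shell k \<Longrightarrow> \<bar>real_of_int k * \<alpha> x - real_of_int k * \<alpha> 0\<bar> \<le> K"
proof -
  obtain C0 where C0: "\<And>x. \<bar>\<alpha> x - \<alpha> 0\<bar> \<le> C0 / ln (exp 1 + 1 / norm x)"
    using assms(1) by (auto simp: C_log_0_def)
  obtain a C1 where C1': "\<And>x. \<bar>\<alpha> x - a\<bar> \<le> C1 / ln (exp 1 + norm x)"
    using assms(1) by (auto simp: C_log_infinity_def)
  have lim: "(\<alpha> \<longlongrightarrow> a) at_infinity"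
  proof (rule Lim_null_comparison[of _ "\<lambda>x. C1 / ln (exp 1 + norm x)", THEN LIM_zero_cancel])
    show "\<forall>\<^sub>F x in at_infinity. norm (\<alpha> x - a) \<le> C1 / ln (exp 1 + norm x)"
      using C1' by simp
    have "filterlim (\<lambda>x::real^'n. ln (exp 1 + norm x)) at_top at_infinity"
      by (rule filterlim_compose[OF ln_at_top])
        (intro filterlim_tendsto_add_at_top[OF tendsto_const] filterlim_norm_at_top)
    then show "((\<lambda>x::real^'n. C1 / ln (exp 1 + norm x)) \<longlongrightarrow> 0) at_infinity"
      by (rule real_tendsto_divide_at_top[OF tendsto_const])
  qed
  then have "a = \<alpha> 0" unfolding Lim by (intro tendsto_Lim[symmetric] trivial_limit_at_infinity)
  then have C1: "\<bar>\<alpha> x - \<alpha> 0\<bar> \<le> C1 / ln (exp 1 + norm x)" for x using C1' by simp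
  have ln1: "1 \<le> ln (exp 1 + y)" if "0 \<le> y" for y :: real
    using that by (subst ln_ge_iff) (auto simp: add_pos_nonneg)
  have nonneg: "0 \<le> C0" "0 \<le> C1"
    using order_trans[OF abs_ge_zero C0[of 0]] order_trans[OF abs_ge_zero C1[of 0]] by simp_all
  have "\<bar>real_of_int k * \<alpha> x - real_of_int k * \<alpha> 0\<bar> \<le> C0 / ln 2 + C1 * (1 / ln 2 + 1)"
    if x: "x \<in> dyadic_shell k" for k x
  proof (cases "k \<le> 0")
    case True
    have "0 < norm x" "norm x \<le> 2 powr k"
      using x by (auto simp: mem_dyadic_shell two_powi intro: order_le_less_trans[rotated])
    define L where "L = ln (exp 1 + 1 / norm x)"
    have "2 powr (- k) \<le> 1 / norm x"
      using \<open>0 < norm x\<close> \<open>norm x \<le> 2 powr k\<close> by (simp add: powr_minus field_simps)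
    then have "ln (2 powr (- k)) \<le> L"
      unfolding L_def by (intro ln_mono) (auto simp: add_increasing)
    then have L: "- real_of_int k * ln 2 \<le> L" by (simp add: ln_powr)
    have "1 \<le> L" unfolding L_def by (rule ln1) simp
    have "- real_of_int k * \<bar>\<alpha> x - \<alpha> 0\<bar> \<le> - real_of_int k * (C0 / L)"
      using C0[of x] True unfolding L_def by (intro mult_left_mono) auto
    also have "\<dots> \<le> (L / ln 2) * (C0 / L)"
      using L nonneg \<open>1 \<le> L\<close> by (intro mult_right_mono) (auto simp: field_simps)
    also have "\<dots> = C0 / ln 2" using \<open>1 \<le> L\<close> by simp
    finally have "\<bar>real_of_int k\<bar> * \<bar>\<alpha> x - \<alpha> 0\<bar> \<le> C0 / ln 2" using True by simp
    moreover have "0 \<le> C1 * (1 / ln 2 + 1)" using nonneg by (simp add: add_nonneg_nonneg)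
    ultimately show ?thesis by (simp add: right_diff_distrib[symmetric] abs_mult)
  next
    case False
    have x2: "2 powr (k - 1) < norm x"
      using x by (auto simp: mem_dyadic_shell two_powi)
    define L where "L = ln (exp 1 + norm x)"
    have "ln (2 powr (k - 1)) \<le> L"
      unfolding L_def using x2 by (intro ln_mono) (auto simp: add_increasing)
    then have "(real_of_int k - 1) * ln 2 \<le> L" by (simp add: ln_powr)
    then have "real_of_int k - 1 \<le> L / ln 2" by (simp add: field_simps)
    have "1 \<le> L" unfolding L_def by (rule ln1) simp
    then have L: "real_of_int k \<le> L * (1 / ln 2 + 1)"
      using \<open>real_of_int k - 1 \<le> L / ln 2\<close> by (simp add: distrib_left)
    have "real_of_int k * \<bar>\<alpha> x - \<alpha> 0\<bar> \<le> real_of_int k * (C1 / L)"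
      using C1[of x] False unfolding L_def by (intro mult_left_mono) auto
    also have "\<dots> \<le> (L * (1 / ln 2 + 1)) * (C1 / L)"
      using L nonneg \<open>1 \<le> L\<close> by (intro mult_right_mono) auto
    also have "\<dots> = C1 * (1 / ln 2 + 1)" using \<open>1 \<le> L\<close> by simp
    finally have "\<bar>real_of_int k\<bar> * \<bar>\<alpha> x - \<alpha> 0\<bar> \<le> C1 * (1 / ln 2 + 1)" using False by simp
    moreover have "0 \<le> C0 / ln 2" using nonneg by simp
    ultimately show ?thesis by (simp add: right_diff_distrib[symmetric] abs_mult)
  qed
  then show ?thesis by (rule that)
qed

section \<open>Herz norms as Luxemburg norms on the integers\<close>

lemma infsum_int_eq_nn_integral:
  fixes f :: "int \<Rightarrow> ennreal"
  shows "(\<Sum>\<^sub>\<infinity>k. f k) = (\<integral>\<^sup>+k. f k \<partial>count_space UNIV)"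
proof -
  have fin: "(\<integral>\<^sup>+k. f k * indicator F k \<partial>count_space UNIV) = sum f F" if "finite F" for F
    using that by (simp add: nn_integral_count_space_indicator[symmetric] nn_integral_count_space_finite)
  have "(\<integral>\<^sup>+k. f k \<partial>count_space UNIV) = (\<integral>\<^sup>+k. (SUP n::nat. f k * indicator {- int n..int n} k) \<partial>count_space UNIV)"
  proof (intro nn_integral_cong antisym)
    fix k :: int
    have "k \<in> {- int (nat \<bar>k\<bar>)..int (nat \<bar>k\<bar>)}" by auto
    then show "f k \<le> (SUP n::nat. f k * indicator {- int n..int n} k)"
      by (intro SUP_upper2[of "nat \<bar>k\<bar>"]) (simp_all del: atLeastAtMost_iff int_nat_eq)
    show "(SUP n::nat. f k * indicator {- int n..int n} k) \<le> f k"
      by (rule SUP_least) (auto simp: indicator_def)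
  qed
  also have "\<dots> = (SUP n::nat. \<integral>\<^sup>+k. f k * indicator {- int n..int n} k \<partial>count_space UNIV)"
    by (rule nn_integral_monotone_convergence_SUP)
      (auto simp: incseq_def le_fun_def indicator_def intro!: mult_left_mono)
  also have "\<dots> = (SUP n::nat. sum f {- int n..int n})"
    by (simp add: fin)
  also have "\<dots> \<le> (SUP F\<in>{F. finite F \<and> F \<subseteq> UNIV}. sum f F)"
    by (rule SUP_least, rule SUP_upper) auto
  finally have "(\<integral>\<^sup>+k. f k \<partial>count_space UNIV) \<le> (SUP F\<in>{F. finite F \<and> F \<subseteq> UNIV}. sum f F)" .
  moreover have "(SUP F\<in>{F. finite F \<and> F \<subseteq> UNIV}. sum f F) \<le> (\<integral>\<^sup>+k. f k \<partial>count_space UNIV)"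
    by (rule SUP_least) (auto simp: fin[symmetric] indicator_def intro!: nn_integral_mono)
  ultimately show ?thesis
    by (subst nonneg_infsum_complete) (auto intro: antisym)
qed

text \<open>
  For a constant exponent the infimum has the usual closed form.
\<close>

lemma lux_le_const_iff:
  assumes p: "1 \<le> p" and [measurable]: "g \<in> borel_measurable M"
  shows "lux_le M (\<lambda>_. p) g \<eta> \<longleftrightarrow> ennreal_powr (\<integral>\<^sup>+x. ennreal_powr (g x) p \<partial>M) (1 / p) \<le> \<eta>"
proof -
  define X where "X = (\<integral>\<^sup>+x. ennreal_powr (g x) p \<partial>M)"
  consider "\<eta> = 0" | "\<eta> = top" | e where "\<eta> = ennreal e" "0 < e"
    by (cases \<eta>) (auto simp: less_le)
  then show ?thesis unfolding X_def[symmetric]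
  proof cases
    case 1
    have "lux_le M (\<lambda>_. p) g 0 \<longleftrightarrow> (AE x in M. g x = 0)"
      using lux_le_0_imp_AE_eq_0[of M "\<lambda>_. p" g] lux_le_0_if_AE_eq_0 by auto
    also have "\<dots> \<longleftrightarrow> X = 0"
      unfolding X_def by (subst nn_integral_0_iff_AE) auto
    finally show "lux_le M (\<lambda>_. p) g \<eta> \<longleftrightarrow> ennreal_powr X (1 / p) \<le> \<eta>" using 1 by simp
  next
    case 3
    have "g x / \<eta> = g x * ennreal (1 / e)" for x
      using 3 by (simp add: divide_ennreal_def inverse_ennreal inverse_eq_divide)
    then have "(\<integral>\<^sup>+x. ennreal_powr (g x / \<eta>) p \<partial>M) = X * ennreal_powr (ennreal (1 / e)) p"
      using p by (simp add: ennreal_powr_mult nn_integral_multc X_def)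
    also have "\<dots> = ennreal_powr (ennreal_powr X (1 / p) * ennreal (1 / e)) p"
      using p by (simp add: ennreal_powr_mult ennreal_powr_powr)
    also have "ennreal_powr X (1 / p) * ennreal (1 / e) = ennreal_powr X (1 / p) / \<eta>"
      using 3 by (simp add: divide_ennreal_def inverse_ennreal inverse_eq_divide)
    finally have *: "lux_le M (\<lambda>_. p) g \<eta> \<longleftrightarrow> ennreal_powr (ennreal_powr X (1 / p) / \<eta>) p \<le> 1"
      by (simp add: lux_le_def)
    show "lux_le M (\<lambda>_. p) g \<eta> \<longleftrightarrow> ennreal_powr X (1 / p) \<le> \<eta>"
    proof (cases "ennreal_powr X (1 / p)")
      case (real y)
      have "(y / e) powr p \<le> 1 \<longleftrightarrow> y / e \<le> 1"
        using p 3 real powr_mono2[of p "y / e" 1] powr_less_mono2[of p 1 "y / e"]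
        by (cases "y / e \<le> 1") (auto simp: not_le)
      then show ?thesis unfolding * using real 3
        by (simp add: divide_ennreal ennreal_powr_ennreal ennreal_le_1)
    next
      case top
      then show ?thesis unfolding * using 3 by (simp add: ennreal_top_divide top_unique)
    qed
  qed simp
qed

lemma herz_norm_le_iff:
  assumes "1 \<le> p"
  shows "herz_norm \<alpha> p q \<omega> f \<le> \<eta> \<longleftrightarrow> lux_le (count_space UNIV) (\<lambda>_. p)
    (\<lambda>k. weighted_Lp_norm q \<omega>
      (\<lambda>x. of_real (2 powr (of_int k * \<alpha> x)) * f x * indicator (dyadic_shell k) x)) \<eta>"
  unfolding herz_norm_def infsum_int_eq_nn_integral using assms by (subst lux_le_const_iff) auto

lemma lux_le_imp_AE_finite:
  assumes "lux_le M s g \<eta>" "\<eta> < top"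
    and [measurable]: "g \<in> borel_measurable M" "s \<in> borel_measurable M"
  shows "AE x in M. g x < top"
proof -
  have "(\<integral>\<^sup>+x. ennreal_powr (g x / \<eta>) (s x) \<partial>M) \<noteq> \<infinity>"
    using assms(1) by (auto simp: lux_le_def top_unique)
  then have "AE x in M. ennreal_powr (g x / \<eta>) (s x) \<noteq> \<infinity>"
    by (intro nn_integral_PInf_AE) auto
  then show ?thesis
    by eventually_elim (use assms(2) in \<open>auto simp: ennreal_top_divide less_top[symmetric]\<close>)
qed

lemma lux_le_int_shift:
  assumes "lux_le (count_space UNIV) (\<lambda>_::int. p) a H"
  shows "lux_le (count_space UNIV) (\<lambda>_. p) (\<lambda>k. a (k + c)) H"
proof -
  have "bij_betw (\<lambda>k. k + c) UNIV (UNIV :: int set)"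
    by (rule bij_betwI[of _ _ _ "\<lambda>k. k - c"]) auto
  then show ?thesis using assms
    unfolding lux_le_def by (subst nn_integral_bij_count_space[of "\<lambda>k. k + c" UNIV UNIV, where f="\<lambda>k. ennreal_powr (a k / H) p"]) auto
qed

text \<open>
  Rounding \<open>log 2 y\<close> up changes the exponent by at most \<open>\<bar>\<alpha>\<bar>\<close>.
\<close>

lemma two_powr_ceiling_log_le:
  assumes "0 < y"
  shows "2 powr (- (real_of_int \<lceil>log 2 y\<rceil> * \<alpha>)) \<le> 2 powr \<bar>\<alpha>\<bar> * y powr (- \<alpha>)"
proof -
  define l where "l = real_of_int \<lceil>log 2 y\<rceil>"
  have l: "log 2 y \<le> l" "l < log 2 y + 1" unfolding l_def by linarith+
  have "- (l * \<alpha>) + log 2 y * \<alpha> = - ((l - log 2 y) * \<alpha>)" by (simp add: algebra_simps)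
  also have "\<dots> \<le> \<bar>l - log 2 y\<bar> * \<bar>\<alpha>\<bar>" by (metis abs_ge_minus_self abs_mult)
  also have "\<dots> \<le> 1 * \<bar>\<alpha>\<bar>" using l by (intro mult_right_mono) auto
  finally have "- (l * \<alpha>) \<le> \<bar>\<alpha>\<bar> - log 2 y * \<alpha>" by simp
  then have "2 powr (- (l * \<alpha>)) \<le> 2 powr (\<bar>\<alpha>\<bar> - log 2 y * \<alpha>)" by simp
  also have "\<dots> = 2 powr \<bar>\<alpha>\<bar> * y powr (- \<alpha>)"
  proof -
    have "y powr \<alpha> = (2 powr log 2 y) powr \<alpha>" using assms by simp
    also have "\<dots> = 2 powr (log 2 y * \<alpha>)" by (rule powr_powr)
    finally show ?thesis by (simp add: powr_diff powr_minus field_simps)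
  qed
  finally show ?thesis unfolding l_def .
qed

text \<open>
  The factor \<open>2\<^sup>k\<^sup>\<alpha>\<close> cancels the \<open>k\<close>-dependence of the coefficients, so that the sum over \<open>r\<close> is a
  linear combination of translates of the sequence \<open>a\<close> with constant coefficients. Translations do
  not change the norm of \<open>\<ell>\<^sup>p\<close>. With \<open>y\<close> the norm of a matrix this produces the last two factors in
  the integrand of the constant of the theorem.
\<close>

lemma lux_le_shifted_shell_sum:
  fixes a :: "int \<Rightarrow> ennreal" and y :: real
  assumes a: "lux_le (count_space UNIV) (\<lambda>_. p) a H" and p: "1 \<le> p" and "0 < y" "0 \<le> D" "finite R"
  shows "lux_le (count_space UNIV) (\<lambda>_. p)
    (\<lambda>k. ennreal (2 powr (of_int k * \<alpha>)) *
        (\<Sum>r\<in>R. ennreal (D * 2 powr (- (of_int (k + \<lceil>log 2 y\<rceil> + r) * \<alpha>))) * a (k + \<lceil>log 2 y\<rceil> + r)))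
    (ennreal (D * 2 powr \<bar>\<alpha>\<bar>) * ennreal (y powr (-\<alpha>)) * ennreal (\<Sum>r\<in>R. 2 powr (- of_int r * \<alpha>)) * H)"
proof -
  define l where "l = \<lceil>log 2 y\<rceil>"
  define c where "c r = D * 2 powr \<bar>\<alpha>\<bar> * y powr (- \<alpha>) * 2 powr (- of_int r * \<alpha>)" for r :: int
  have c0: "0 \<le> c r" for r using \<open>0 \<le> D\<close> by (simp add: c_def)
  have "lux_le (count_space UNIV) (\<lambda>_. p) (\<lambda>k. \<Sum>r\<in>R. ennreal (c r) * a (k + (l + r))) (\<Sum>r\<in>R. ennreal (c r) * H)"
    using p by (intro lux_le_sum lux_le_cmult lux_le_int_shift a \<open>finite R\<close> sigma_finite_measure_count_space) auto
  then have "lux_le (count_space UNIV) (\<lambda>_. p)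
    (\<lambda>k. ennreal (2 powr (of_int k * \<alpha>)) * (\<Sum>r\<in>R. ennreal (D * 2 powr (- (of_int (k + l + r) * \<alpha>))) * a (k + l + r)))
    (\<Sum>r\<in>R. ennreal (c r) * H)"
  proof (rule lux_le_mono)
    show "AE k in count_space UNIV. ennreal (2 powr (of_int k * \<alpha>)) * (\<Sum>r\<in>R. ennreal (D * 2 powr (- (of_int (k + l + r) * \<alpha>))) * a (k + l + r))
       \<le> (\<Sum>r\<in>R. ennreal (c r) * a (k + (l + r)))"
    proof (intro always_eventually allI)
      fix k :: int
      have "ennreal (2 powr (of_int k * \<alpha>)) * (ennreal (D * 2 powr (- (of_int (k + l + r) * \<alpha>))) * a (k + l + r))
          \<le> ennreal (c r) * a (k + (l + r))" for r
      proof -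
        have "2 powr (of_int k * \<alpha>) * (D * 2 powr (- (of_int (k + l + r) * \<alpha>)))
            = D * 2 powr (of_int k * \<alpha> + (- (of_int (k + l + r) * \<alpha>)))"
          by (simp only: powr_add mult_ac)
        also have "of_int k * \<alpha> + (- (of_int (k + l + r) * \<alpha>)) = - (of_int l * \<alpha>) + (- of_int r * \<alpha>)"
          by (simp add: algebra_simps)
        also have "D * 2 powr \<dots> = D * (2 powr (- (of_int l * \<alpha>)) * 2 powr (- of_int r * \<alpha>))"
          by (simp only: powr_add)
        also have "\<dots> \<le> D * ((2 powr \<bar>\<alpha>\<bar> * y powr (- \<alpha>)) * 2 powr (- of_int r * \<alpha>))"
          using two_powr_ceiling_log_le[OF \<open>0 < y\<close>, of \<alpha>] \<open>0 \<le> D\<close> unfolding l_def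
          by (intro mult_left_mono mult_right_mono) auto
        also have "\<dots> = c r" by (simp add: c_def mult_ac)
        finally have "ennreal (2 powr (of_int k * \<alpha>) * (D * 2 powr (- (of_int (k + l + r) * \<alpha>)))) \<le> ennreal (c r)"
          by (rule ennreal_leI)
        then have "ennreal (2 powr (of_int k * \<alpha>)) * ennreal (D * 2 powr (- (of_int (k + l + r) * \<alpha>))) \<le> ennreal (c r)"
          using \<open>0 \<le> D\<close> by (simp add: ennreal_mult)
        then show ?thesis unfolding mult.assoc[symmetric] add.assoc[symmetric] by (rule mult_right_mono) simp
      qed
      then show "ennreal (2 powr (of_int k * \<alpha>)) * (\<Sum>r\<in>R. ennreal (D * 2 powr (- (of_int (k + l + r) * \<alpha>))) * a (k + l + r))
         \<le> (\<Sum>r\<in>R. ennreal (c r) * a (k + (l + r)))"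
        unfolding sum_distrib_left by (intro sum_mono)
    qed
  qed (use p in auto)
  moreover have "(\<Sum>r\<in>R. ennreal (c r) * H) = ennreal (D * 2 powr \<bar>\<alpha>\<bar>) * ennreal (y powr (-\<alpha>)) * ennreal (\<Sum>r\<in>R. 2 powr (- of_int r * \<alpha>)) * H"
  proof -
    have "(\<Sum>r\<in>R. c r) = D * 2 powr \<bar>\<alpha>\<bar> * y powr (- \<alpha>) * (\<Sum>r\<in>R. 2 powr (- of_int r * \<alpha>))"
      by (simp add: c_def sum_distrib_left)
    then show ?thesis using c0 \<open>0 \<le> D\<close>
      by (simp add: sum_distrib_right[symmetric] sum_ennreal ennreal_mult sum_nonneg)
  qed
  ultimately show ?thesis unfolding l_def by simp
qed

section \<open>The estimate on every shell\<close>

text \<open>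
  The analytic part of the theorem, for Borel functions. For fixed \<open>t\<close>, Hoelder's inequality and the
  substitution bound control the product of the dilated functions on the shell with index \<open>k\<close> by
  a quantity \<open>Q k t\<close>; as a sequence in \<open>k\<close> this quantity is controlled in \<open>\<ell>\<^sup>p\<close> by Hoelder's inequality
  for sequences and the bound on shifted sums. Minkowski's inequality in \<open>t\<close> is applied twice, in
  the variable exponent space over \<open>x\<close> and in \<open>\<ell>\<^sup>p\<close> over \<open>k\<close>.
\<close>

lemma hausdorff_shell_estimates:
  fixes A :: "nat \<Rightarrow> real^'n \<Rightarrow> real^'n^'n" and s :: "nat \<Rightarrow> real^'n \<Rightarrow> real" and s0 :: "real^'n \<Rightarrow> real"
    and G :: "nat \<Rightarrow> real^'n \<Rightarrow> ennreal" and a :: "nat \<Rightarrow> int \<Rightarrow> ennreal" and H :: "nat \<Rightarrow> ennreal"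
    and \<gamma> al D qm qp p :: "nat \<Rightarrow> real"
  assumes m: "1 \<le> m"
    and \<Phi> [measurable]: "\<Phi> \<in> borel_measurable lebesgue" and \<Phi>0: "\<And>t. 0 \<le> \<Phi> t"
    and A: "\<And>i. i \<in> {1..m} \<Longrightarrow> A i \<in> borel_measurable lebesgue"
    and good: "AE t in lebesgue. \<Phi> t \<noteq> 0 \<longrightarrow> (\<forall>i\<in>{1..m}. invertible (A i t) \<and>
        (AE x in lborel. s i (matrix_inv (A i t) *v x) \<le> \<zeta> * s i x) \<and>
        unit_dilation_norm (s i) \<zeta> (matrix_inv (A i t)) < top)"
    and s: "\<And>i. i \<in> {1..m} \<Longrightarrow> s i \<in> borel_measurable borel"
    and s0 [measurable]: "s0 \<in> borel_measurable borel"
    and sq: "\<And>i. i \<in> {1..m} \<Longrightarrow> 1 \<le> qm i"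
      "\<And>i. i \<in> {1..m} \<Longrightarrow> AE x in lborel. qm i \<le> s i x \<and> s i x \<le> qp i"
    and s01: "AE x in lborel. 1 \<le> s0 x \<and> (\<Sum>i\<in>{1..m}. 1 / s i x) = 1 / s0 x"
    and p: "\<And>i. i \<in> {1..m} \<Longrightarrow> 1 \<le> p i" "1 \<le> p0" "(\<Sum>i\<in>{1..m}. 1 / p i) = 1 / p0"
    and D: "\<And>i. i \<in> {1..m} \<Longrightarrow> 0 \<le> D i"
    and G: "\<And>i. i \<in> {1..m} \<Longrightarrow> G i \<in> borel_measurable borel"
    and GN: "\<And>i j. i \<in> {1..m} \<Longrightarrow> lux_le lborel (\<lambda>x. \<zeta> * s i x)
        (\<lambda>y. G i y * ennreal (norm y powr \<gamma> i) * indicator (dyadic_shell j) y)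
        (ennreal (D i * 2 powr (- (of_int j * al i))) * a i j)"
    and a: "\<And>i j. i \<in> {1..m} \<Longrightarrow> a i j < top"
      "\<And>i. i \<in> {1..m} \<Longrightarrow> lux_le (count_space UNIV) (\<lambda>_. p i) (a i) (H i)"
  shows "\<exists>\<beta>. (\<forall>k. lux_le lborel s0
        (\<lambda>x. (\<integral>\<^sup>+t. ennreal (\<Phi> t / norm t ^ CARD('n)) * (\<Prod>i\<in>{1..m}. G i (A i t *v x)) \<partial>lebesgue) *
          ennreal (norm x powr (\<Sum>i\<in>{1..m}. \<gamma> i)) * indicator (dyadic_shell k) x) (\<beta> k)) \<and>
      lux_le (count_space UNIV) (\<lambda>_. p0) (\<lambda>k. ennreal (2 powr (of_int k * (\<Sum>i\<in>{1..m}. al i))) * \<beta> k)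
        (of_nat m * of_nat m * (\<Prod>i\<in>{1..m}. 2 * ennreal (D i * 2 powr \<bar>al i\<bar>)) * (\<Prod>i\<in>{1..m}. H i) *
          (\<integral>\<^sup>+t. ennreal (\<Phi> t / norm t ^ CARD('n)) *
            (\<Prod>i\<in>{1..m}. ennreal (max (norm (A i t) powr (- \<gamma> i)) (norm (matrix_inv (A i t)) powr \<gamma> i) *
                max (\<bar>det (matrix_inv (A i t))\<bar> powr (1 / qp i)) (\<bar>det (matrix_inv (A i t))\<bar> powr (1 / qm i))) *
              unit_dilation_norm (s i) \<zeta> (matrix_inv (A i t)) *
              ennreal (norm (A i t) powr (- al i)) *
              ennreal (\<Sum>r\<in>{Theta m A t - 1..0}. 2 powr (- of_int r * al i))) \<partial>lebesgue))"
proof -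
  define I where "I = {1..m}"
  have I: "finite I" "I \<noteq> {}" "card I = m" using m by (auto simp: I_def)
  define \<Theta> where "\<Theta> t = \<lceil>- log 2 (MAX i\<in>I. norm (A i t) * norm (matrix_inv (A i t)))\<rceil> - 1" for t
  define l where "l i t = \<lceil>log 2 (norm (A i t))\<rceil>" for i t
  define n1 where "n1 t = ennreal (\<Phi> t / norm t ^ CARD('n))" for t
  define N where "N i j = ennreal (D i * 2 powr (- (of_int j * al i))) * a i j" for i j
  define S where "S i k t = (\<Sum>r\<in>{\<Theta> t - 1..0}. N i (k + l i t + r))" for i k t
  define W where "W i t = ennreal (max (norm (A i t) powr (- \<gamma> i)) (norm (matrix_inv (A i t)) powr \<gamma> i) *
        max (\<bar>det (matrix_inv (A i t))\<bar> powr (1 / qp i)) (\<bar>det (matrix_inv (A i t))\<bar> powr (1 / qm i)))" for i t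
  define U where "U i t = unit_dilation_norm (s i) \<zeta> (matrix_inv (A i t))" for i t
  define Q where "Q k t = n1 t * (of_nat m * (\<Prod>i\<in>I. W i t * (2 * U i t) * S i k t))" for k t
  define V where "V i t = ennreal (norm (A i t) powr (- al i)) * ennreal (\<Sum>r\<in>{\<Theta> t - 1..0}. 2 powr (- of_int r * al i))" for i t
  define T1 where "T1 t = n1 t * (\<Prod>i\<in>I. W i t * U i t * V i t)" for t
  define C where "C = of_nat m * of_nat m * (\<Prod>i\<in>I. 2 * ennreal (D i * 2 powr \<bar>al i\<bar>))"
  define \<beta> where "\<beta> k = (\<integral>\<^sup>+t. Q k t \<partial>lebesgue)" for k
  note sigma_finite_lebesgue[where 'a="real^'n", simp] lborel.sigma_finite_measure_axioms[simp]
  have [measurable]: "i \<in> I \<Longrightarrow> A i \<in> borel_measurable lebesgue" "i \<in> I \<Longrightarrow> s i \<in> borel_measurable borel"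
    "i \<in> I \<Longrightarrow> G i \<in> borel_measurable borel" for i
    using A s G by (auto simp: I_def)
  \<comment> \<open>The integer-valued functions \<open>\<Theta>\<close> and \<open>l i\<close> enter the ranges and the indices of sums; as they
    take countably many values, such sums remain measurable.\<close>
  have \<Theta>_m [measurable]: "\<Theta> \<in> measurable lebesgue (count_space UNIV)"
    unfolding \<Theta>_def using I by measurable
  have l_m [measurable]: "i \<in> I \<Longrightarrow> l i \<in> measurable lebesgue (count_space UNIV)" for i
    unfolding l_def by measurable
  have [measurable]: "n1 \<in> borel_measurable lebesgue"
    unfolding n1_def using borel_measurable_hausdorff_weight[OF \<Phi>] by (rule measurable_compose) simp
  have [measurable]: "i \<in> I \<Longrightarrow> W i \<in> borel_measurable lebesgue" for i unfolding W_def by measurable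
  have [measurable]: "i \<in> I \<Longrightarrow> U i \<in> borel_measurable lebesgue" for i
    unfolding U_def by (intro measurable_unit_dilation_norm) measurable
  have [measurable]: "i \<in> I \<Longrightarrow> (\<lambda>t. S i k t) \<in> borel_measurable lebesgue" for i k
  proof -
    assume i: "i \<in> I"
    have "(\<lambda>t. \<Sum>r\<in>{u - 1..0}. N i (k + l i t + r)) \<in> borel_measurable lebesgue" for u
      by (rule measurable_compose_countable[OF _ l_m[OF i], of "\<lambda>l t. \<Sum>r\<in>{u - 1..0}. N i (k + l + r)"]) simp
    then show "(\<lambda>t. S i k t) \<in> borel_measurable lebesgue"
      unfolding S_def by (rule measurable_compose_countable[OF _ \<Theta>_m, of "\<lambda>u t. \<Sum>r\<in>{u - 1..0}. N i (k + l i t + r)"])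
  qed
  have [measurable]: "i \<in> I \<Longrightarrow> V i \<in> borel_measurable lebesgue" for i
  proof -
    assume i: "i \<in> I"
    have [measurable]: "(\<lambda>t. \<Sum>r\<in>{\<Theta> t - 1..0}. 2 powr (- of_int r * al i)) \<in> borel_measurable lebesgue"
      by (rule measurable_compose_countable[OF _ \<Theta>_m, of "\<lambda>u t. \<Sum>r\<in>{u - 1..0}. 2 powr (- of_int r * al i)"]) simp
    show "V i \<in> borel_measurable lebesgue" unfolding V_def using i by measurable
  qed
  have [measurable]: "(\<lambda>t. Q k t) \<in> borel_measurable lebesgue" for k unfolding Q_def by measurable
  have [measurable]: "T1 \<in> borel_measurable lebesgue" unfolding T1_def by measurable
  have n1_fin: "n1 t < top" for t by (simp add: n1_def)
  have Nfin: "i \<in> I \<Longrightarrow> N i j < top" for i j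
    using a(1) by (auto simp: N_def I_def ennreal_mult_less_top)

  have x0: "0 \<notin> dyadic_shell k" for k :: int
    using mem_dyadic_shell[of 0 k] by (simp add: two_powi not_less)

  have 1: "lux_le lborel s0
        (\<lambda>x. (\<integral>\<^sup>+t. n1 t * (\<Prod>i\<in>I. G i (A i t *v x)) \<partial>lebesgue) *
          ennreal (norm x powr (\<Sum>i\<in>I. \<gamma> i)) * indicator (dyadic_shell k) x) (\<beta> k)" for k
  proof -
    define F where "F x t = n1 t * (\<Prod>i\<in>I. G i (A i t *v x) * ennreal (norm x powr \<gamma> i) * indicator (dyadic_shell k) x)" for x t
    have "lux_le lborel s0 (\<lambda>x. \<integral>\<^sup>+t. F x t \<partial>lebesgue) (\<integral>\<^sup>+t. Q k t \<partial>lebesgue)"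
    proof (rule lux_le_nn_integral)
      show "(\<lambda>(x, t). F x t) \<in> borel_measurable (lborel \<Otimes>\<^sub>M lebesgue)"
        unfolding F_def by measurable
      show "AE x in lborel. 1 \<le> s0 x" using s01 by eventually_elim simp
      show "AE t in lebesgue. lux_le lborel s0 (\<lambda>x. F x t) (Q k t)"
        using good
      proof eventually_elim
        case (elim t)
        show ?case
        proof (cases "\<Phi> t = 0")
          case True
          then show ?thesis by (intro lux_le_0_if_AE_eq_0) (simp add: F_def n1_def)
        next
          case False
          with elim have t: "\<And>i. i \<in> I \<Longrightarrow> invertible (A i t)"
            "\<And>i. i \<in> I \<Longrightarrow> AE x in lborel. s i (matrix_inv (A i t) *v x) \<le> \<zeta> * s i x"
            "\<And>i. i \<in> I \<Longrightarrow> unit_dilation_norm (s i) \<zeta> (matrix_inv (A i t)) < top"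
            by (auto simp: I_def)
          have th: "\<Theta> t = Theta m A t" "\<And>i. i \<in> I \<Longrightarrow> norm (A i t) * norm (matrix_inv (A i t)) < 2 powi (- \<Theta> t)"
            using Theta_eq[of m A t] m t(1) by (auto simp: \<Theta>_def I_def)
          have hm: "(\<lambda>x. G i (A i t *v x) * ennreal (norm x powr \<gamma> i) * indicator (dyadic_shell k) x) \<in> borel_measurable lborel"
            if "i \<in> I" for i
          proof (intro borel_measurable_times_ennreal)
            show "(\<lambda>x. G i (A i t *v x)) \<in> borel_measurable lborel"
              using measurable_compose[OF measurable_matrix_vector G] that by (simp add: I_def)
          qed measurable
          have "lux_le lborel s0 (\<lambda>x. \<Prod>i\<in>I. G i (A i t *v x) * ennreal (norm x powr \<gamma> i) * indicator (dyadic_shell k) x)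
             (of_nat (card I) * (\<Prod>i\<in>I. W i t * (2 * U i t) * S i k t))"
          proof (rule lux_le_prod[OF I(1,2), where s=s])
            show "AE x in lborel. 1 \<le> s0 x \<and> (\<forall>i\<in>I. 0 < s i x) \<and> (\<Sum>i\<in>I. 1 / s i x) = 1 / s0 x"
            proof -
              have "AE x in lborel. \<forall>i\<in>I. 0 < s i x"
              proof (rule AE_finite_allI[OF I(1)])
                fix i assume "i \<in> I"
                then have i: "i \<in> {1..m}" by (simp add: I_def)
                show "AE x in lborel. 0 < s i x"
                  using sq(2)[OF i] by eventually_elim (use sq(1)[OF i] in auto)
              qed
              with s01 show ?thesis by eventually_elim (simp add: I_def)
            qed
            fix i assume i: "i \<in> I"
            then have i': "i \<in> {1..m}" by (simp add: I_def)
            show "lux_le lborel (s i) (\<lambda>x. G i (A i t *v x) * ennreal (norm x powr \<gamma> i) * indicator (dyadic_shell k) x)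
               (W i t * (2 * U i t) * S i k t)"
              unfolding W_def U_def S_def l_def
              by (rule shell_substitution_bound_norm[OF t(1)[OF i] th(2)[OF i] s[OF i'] G[OF i'] sq(1)[OF i'] sq(2)[OF i'] t(2)[OF i] Nfin[OF i] t(3)[OF i]])
                (use GN[OF i'] in \<open>simp add: N_def\<close>)
          qed (use hm s in \<open>auto simp: I_def\<close>)
          then show ?thesis
            unfolding F_def Q_def I(3) using n1_fin[of t] by (intro lux_le_cmult) (auto simp: less_top)
        qed
      qed
    qed (simp_all)
    moreover have "(\<integral>\<^sup>+t. F x t \<partial>lebesgue) = (\<integral>\<^sup>+t. n1 t * (\<Prod>i\<in>I. G i (A i t *v x)) \<partial>lebesgue) *
          ennreal (norm x powr (\<Sum>i\<in>I. \<gamma> i)) * indicator (dyadic_shell k) x" for x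
    proof (cases "x \<in> dyadic_shell k")
      case True
      then have "x \<noteq> 0" using x0 by auto
      have "(\<Prod>i\<in>I. ennreal (norm x powr \<gamma> i)) = ennreal (norm x powr (\<Sum>i\<in>I. \<gamma> i))"
        using \<open>x \<noteq> 0\<close> by (subst powr_sum) (auto simp: I prod_ennreal)
      then have "F x t = n1 t * (\<Prod>i\<in>I. G i (A i t *v x)) * ennreal (norm x powr (\<Sum>i\<in>I. \<gamma> i))" for t
        using True by (simp add: F_def prod.distrib mult.assoc)
      then show ?thesis using True by (simp add: nn_integral_multc)
    next
      case False
      then have "F x t = 0" for t using I m by (simp add: F_def prod_zero_iff)
      then show ?thesis using False by simp
    qed
    ultimately show ?thesis by (simp add: \<beta>_def)
  qed

  have 2: "lux_le (count_space UNIV) (\<lambda>_. p0) (\<lambda>k. ennreal (2 powr (of_int k * (\<Sum>i\<in>I. al i))) * \<beta> k)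
        (C * (\<Prod>i\<in>I. H i) * (\<integral>\<^sup>+t. T1 t \<partial>lebesgue))"
  proof -
    define E where "E k t = ennreal (2 powr (of_int k * (\<Sum>i\<in>I. al i))) * Q k t" for k t
    have "lux_le (count_space UNIV) (\<lambda>_. p0) (\<lambda>k. \<integral>\<^sup>+t. E k t \<partial>lebesgue) (\<integral>\<^sup>+t. C * (\<Prod>i\<in>I. H i) * T1 t \<partial>lebesgue)"
    proof (rule lux_le_nn_integral)
      show "(\<lambda>(k, t). E k t) \<in> borel_measurable (count_space UNIV \<Otimes>\<^sub>M lebesgue)"
        by (rule measurable_pair_measure_countable1) (auto simp: E_def)
      show "AE t in lebesgue. lux_le (count_space UNIV) (\<lambda>_. p0) (\<lambda>k. E k t) (C * (\<Prod>i\<in>I. H i) * T1 t)"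
        using good
      proof eventually_elim
        case (elim t)
        show ?case
        proof (cases "\<Phi> t = 0")
          case True
          then show ?thesis by (intro lux_le_0_if_AE_eq_0) (simp add: E_def Q_def n1_def)
        next
          case False
          with elim have t: "\<And>i. i \<in> I \<Longrightarrow> invertible (A i t)" "\<And>i. i \<in> I \<Longrightarrow> U i t < top"
            by (auto simp: I_def U_def)
          have "lux_le (count_space UNIV) (\<lambda>_. p0) (\<lambda>k. \<Prod>i\<in>I. ennreal (2 powr (of_int k * al i)) * S i k t)
            (of_nat (card I) * (\<Prod>i\<in>I. ennreal (D i * 2 powr \<bar>al i\<bar>) * V i t * H i))"
          proof (rule lux_le_prod[OF I(1,2), where s="\<lambda>i _. p i"])
            show "AE x in count_space UNIV. 1 \<le> p0 \<and> (\<forall>i\<in>I. 0 < p i) \<and> (\<Sum>i\<in>I. 1 / p i) = 1 / p0"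
              using p by (auto simp: I_def intro!: always_eventually intro: less_le_trans[OF zero_less_one])
            fix i assume i: "i \<in> I"
            then have i': "i \<in> {1..m}" by (simp add: I_def)
            show "lux_le (count_space UNIV) (\<lambda>_. p i) (\<lambda>k. ennreal (2 powr (of_int k * al i)) * S i k t)
              (ennreal (D i * 2 powr \<bar>al i\<bar>) * V i t * H i)"
              unfolding S_def V_def N_def l_def
              using lux_le_shifted_shell_sum[OF a(2)[OF i'] p(1)[OF i'] norm_invertible_bounds(1)[OF t(1)[OF i]] D[OF i'], of "{\<Theta> t - 1..0}" "al i"]
              by (simp add: mult.assoc)
          qed auto
          then have "lux_le (count_space UNIV) (\<lambda>_. p0)
              (\<lambda>k. n1 t * (of_nat m * (\<Prod>i\<in>I. W i t * (2 * U i t))) * (\<Prod>i\<in>I. ennreal (2 powr (of_int k * al i)) * S i k t))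
              (n1 t * (of_nat m * (\<Prod>i\<in>I. W i t * (2 * U i t))) * (of_nat (card I) * (\<Prod>i\<in>I. ennreal (D i * 2 powr \<bar>al i\<bar>) * V i t * H i)))"
          proof (rule lux_le_cmult)
            have "U i t \<noteq> top" if "i \<in> I" for i using t(2)[OF that] by simp
            then have "(\<Prod>i\<in>I. W i t * (2 * U i t)) < top"
              unfolding less_top[symmetric] ennreal_prod_eq_top
              by (auto simp: ennreal_mult_eq_top_iff W_def)
            then show "n1 t * (of_nat m * (\<Prod>i\<in>I. W i t * (2 * U i t))) < \<infinity>"
              using n1_fin[of t] by (simp add: ennreal_mult_less_top of_nat_less_top)
          qed
          moreover have "E k t = n1 t * (of_nat m * (\<Prod>i\<in>I. W i t * (2 * U i t))) * (\<Prod>i\<in>I. ennreal (2 powr (of_int k * al i)) * S i k t)" for k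
          proof -
            have "(\<Prod>i\<in>I. ennreal (2 powr (of_int k * al i))) = ennreal (2 powr (of_int k * (\<Sum>i\<in>I. al i)))"
              unfolding sum_distrib_left by (subst powr_sum) (auto simp: I prod_ennreal)
            then show ?thesis unfolding E_def Q_def by (simp add: prod.distrib mult_ac)
          qed
          moreover have "n1 t * (of_nat m * (\<Prod>i\<in>I. W i t * (2 * U i t))) * (of_nat (card I) * (\<Prod>i\<in>I. ennreal (D i * 2 powr \<bar>al i\<bar>) * V i t * H i))
             = C * (\<Prod>i\<in>I. H i) * T1 t"
            unfolding C_def T1_def I(3) by (simp only: prod.distrib mult_ac)
          ultimately show ?thesis by simp
        qed
      qed
    qed (use p(2) in \<open>simp_all add: sigma_finite_measure_count_space\<close>)
    then show ?thesis by (simp add: E_def \<beta>_def nn_integral_cmult)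
  qed

  have "(\<integral>\<^sup>+t. T1 t \<partial>lebesgue) = (\<integral>\<^sup>+t. n1 t * (\<Prod>i\<in>I. W i t * U i t * ennreal (norm (A i t) powr (- al i)) *
          ennreal (\<Sum>r\<in>{Theta m A t - 1..0}. 2 powr (- of_int r * al i))) \<partial>lebesgue)"
    using good
  proof (intro nn_integral_cong_AE, eventually_elim)
    case (elim t)
    show ?case
    proof (cases "\<Phi> t = 0")
      case False
      then have "\<Theta> t = Theta m A t"
        using Theta_eq(1)[of m A t] m elim by (auto simp: \<Theta>_def I_def)
      then show ?thesis by (simp add: T1_def V_def mult.assoc)
    qed (simp add: T1_def n1_def)
  qed
  with 1 2 show ?thesis unfolding C_def I_def W_def U_def n1_def by (intro exI[of _ \<beta>]) simp
qed

section \<open>Borel representatives\<close>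

lemma borel_representative_exponent:
  fixes q :: "real^'n \<Rightarrow> ennreal"
  assumes q: "q \<in> bounded_variable_exponents"
  obtains s where "s \<in> borel_measurable borel" "AE x in lborel. q x = ennreal (s x)"
    "AE x in lborel. enn2real (essinf lebesgue q) \<le> s x \<and> s x \<le> enn2real (esssup lebesgue q)"
    "1 \<le> enn2real (essinf lebesgue q)"
proof -
  have b: "1 < essinf lebesgue q" "esssup lebesgue q < top" "essinf lebesgue q \<le> q x" "q x \<le> esssup lebesgue q"
    and [measurable]: "q \<in> borel_measurable lebesgue" for x
    using q by (auto simp: bounded_variable_exponents_def variable_exponents_def)
  obtain q' where [measurable]: "q' \<in> borel_measurable lborel" and qq': "AE x in lborel. q x = q' x"
    using completion_ex_borel_measurable[of q lborel] by auto
  have lt: "q x < top" "essinf lebesgue q < top" for x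
    using b(2) b(3)[of x] b(4)[of x] by (auto intro: le_less_trans)
  show ?thesis
  proof (rule that[of "\<lambda>x. enn2real (q' x)"])
    show "(\<lambda>x. enn2real (q' x)) \<in> borel_measurable borel" by measurable
    show "AE x in lborel. q x = ennreal (enn2real (q' x))"
      using qq' by eventually_elim (use lt in \<open>simp add: ennreal_enn2real_if less_top[symmetric]\<close>, metis less_irrefl lt(1))
    show "AE x in lborel. enn2real (essinf lebesgue q) \<le> enn2real (q' x) \<and> enn2real (q' x) \<le> enn2real (esssup lebesgue q)"
      using qq' by eventually_elim (metis b(2,3,4) lt(1) enn2real_mono)
    show "1 \<le> enn2real (essinf lebesgue q)"
      using enn2real_mono[of 1 "essinf lebesgue q"] b(1) lt(2) by simp
  qed
qed

lemma borel_representative_complex: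
  fixes f :: "'a::euclidean_space \<Rightarrow> complex"
  assumes f [measurable]: "f \<in> borel_measurable lebesgue"
  obtains g where "g \<in> borel_measurable borel" "AE x in lborel. f x = g x"
proof -
  obtain u where [measurable]: "u \<in> borel_measurable lborel" and u: "AE x in lborel. Re (f x) = u x"
    using completion_ex_borel_measurable_real[of "\<lambda>x. Re (f x)" lborel] by auto
  obtain v where [measurable]: "v \<in> borel_measurable lborel" and v: "AE x in lborel. Im (f x) = v x"
    using completion_ex_borel_measurable_real[of "\<lambda>x. Im (f x)" lborel] by auto
  show ?thesis
  proof (rule that[of "\<lambda>x. Complex (u x) (v x)"])
    show "(\<lambda>x. Complex (u x) (v x)) \<in> borel_measurable borel"
      unfolding complex_eq Complex_eq by measurable
    show "AE x in lborel. f x = Complex (u x) (v x)"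
      using u v by eventually_elim (simp add: complex_eq_iff)
  qed
qed

text \<open>
  Completeness of Lebesgue measure: the preimages under the two functions differ by null sets.
\<close>

lemma borel_measurable_lebesgue_if_AE_eq:
  assumes f: "AE x in lebesgue. f x = g x" and [measurable]: "g \<in> borel_measurable lebesgue"
  shows "f \<in> borel_measurable lebesgue"
proof (rule measurableI)
  fix S :: "'b set" assume [measurable]: "S \<in> sets borel"
  have ae: "AE x in lborel. \<not> (f x \<in> S \<and> g x \<notin> S)" "AE x in lborel. \<not> (f x \<notin> S \<and> g x \<in> S)"
    using f unfolding AE_completion_iff by (eventually_elim, simp)+
  have "{x. f x \<in> S \<and> g x \<notin> S} \<in> sets lebesgue" "{x. f x \<notin> S \<and> g x \<in> S} \<in> sets lebesgue"
    using sets_completion_AE[OF ae(1)] sets_completion_AE[OF ae(2)] by (simp_all add: pred_def)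
  moreover have "{x. g x \<in> S} \<in> sets lebesgue"
    using measurable_sets[OF assms(2) \<open>S \<in> sets borel\<close>] by (simp add: vimage_def)
  ultimately have "{x. f x \<in> S \<and> g x \<notin> S} \<union> ({x. g x \<in> S} - {x. f x \<notin> S \<and> g x \<in> S}) \<in> sets lebesgue"
    by (intro sets.Un sets.Diff)
  also have "{x. f x \<in> S \<and> g x \<notin> S} \<union> ({x. g x \<in> S} - {x. f x \<notin> S \<and> g x \<in> S}) = f -` S \<inter> space lebesgue"
    by auto
  finally show "f -` S \<inter> space lebesgue \<in> sets lebesgue" .
qed simp

lemma measurable_dilated_product_integral:
  fixes A :: "nat \<Rightarrow> real^'n \<Rightarrow> real^'n^'n" and G :: "nat \<Rightarrow> real^'n \<Rightarrow> ennreal"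
  assumes \<Phi>: "\<Phi> \<in> borel_measurable lebesgue"
    and A: "\<And>i. i \<in> I \<Longrightarrow> A i \<in> borel_measurable lebesgue"
    and G: "\<And>i. i \<in> I \<Longrightarrow> G i \<in> borel_measurable borel"
  shows "(\<lambda>x. \<integral>\<^sup>+t. ennreal (\<Phi> t / norm t ^ CARD('n)) * (\<Prod>i\<in>I. G i (A i t *v x)) \<partial>lebesgue) \<in> borel_measurable borel"
proof -
  interpret T: sigma_finite_measure "lebesgue :: (real^'n) measure" by (rule sigma_finite_lebesgue)
  note A[measurable] G[measurable] borel_measurable_hausdorff_weight[OF \<Phi>, measurable]
  have "(\<lambda>x. \<integral>\<^sup>+t. ennreal (\<Phi> t / norm t ^ CARD('n)) * (\<Prod>i\<in>I. G i (A i t *v x)) \<partial>lebesgue) \<in> borel_measurable lborel"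
    by (rule T.borel_measurable_nn_integral) measurable
  then show ?thesis by simp
qed

text \<open>
  Equality almost everywhere survives the composition with the map \<open>(t, x) \<mapsto> A(t) x\<close>: for fixed \<open>t\<close>
  an invertible matrix pulls null sets back to null sets, and Tonelli's theorem exchanges the order of
  the quantifiers. A Borel null set containing the exceptional set provides joint measurability.
\<close>

lemma AE_linear_family:
  fixes A :: "real^'n \<Rightarrow> real^'n^'n"
  assumes [measurable]: "A \<in> borel_measurable lebesgue" "\<Phi> \<in> borel_measurable lebesgue"
    and inv: "AE t in lebesgue. \<Phi> t \<noteq> (0::real) \<longrightarrow> invertible (A t)"
    and P: "AE y in lborel. P y"
  shows "AE x in lborel. AE t in lebesgue. \<Phi> t \<noteq> 0 \<longrightarrow> P (A t *v x)"
proof -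
  interpret T: sigma_finite_measure "lebesgue :: (real^'n) measure" by (rule sigma_finite_lebesgue)
  interpret XT: pair_sigma_finite lborel "lebesgue :: (real^'n) measure" ..
  obtain N where N: "{y. \<not> P y} \<subseteq> N" and [measurable]: "N \<in> sets borel" and "emeasure lborel N = 0"
    using P by (auto elim!: AE_E)
  then have notN: "AE y in lborel. y \<notin> N"
    by (intro AE_not_in) (auto simp: null_sets_def)
  have "AE t in lebesgue. AE x in lborel. \<Phi> t \<noteq> 0 \<longrightarrow> A t *v x \<notin> N"
    using inv
  proof eventually_elim
    case (elim t)
    then show ?case
      using AE_lborel_linear[OF _ notN, of "A t"] by (cases "\<Phi> t = 0") auto
  qed
  then have "AE x in lborel. AE t in lebesgue. \<Phi> t \<noteq> 0 \<longrightarrow> A t *v x \<notin> N"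
  proof (subst XT.AE_commute)
    have "Measurable.pred (lborel \<Otimes>\<^sub>M lebesgue) (\<lambda>p. \<Phi> (snd p) \<noteq> 0 \<longrightarrow> A (snd p) *v fst p \<notin> N)"
      by measurable
    then show "{p \<in> space (lborel \<Otimes>\<^sub>M lebesgue). \<Phi> (snd p) \<noteq> 0 \<longrightarrow> A (snd p) *v fst p \<notin> N}
        \<in> sets (lborel \<Otimes>\<^sub>M lebesgue)"
      by (simp add: pred_def)
  qed
  then show ?thesis
    by (rule eventually_mono) (use N in \<open>auto elim!: eventually_mono\<close>)
qed

lemma compact_punctured_dyadic_cover:
  fixes K :: "(real^'n) set"
  assumes "compact K" "K \<subseteq> - {0}"
  obtains r R where "0 < r" "r \<le> R" "\<And>x. x \<in> K \<Longrightarrow> r \<le> norm x \<and> norm x \<le> R"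
    "\<And>x. x \<in> K \<Longrightarrow> \<exists>k\<in>{\<lceil>log 2 r\<rceil>..\<lceil>log 2 R\<rceil>}. x \<in> dyadic_shell k"
proof -
  have "open (- K)" "0 \<in> - K" using assms compact_imp_closed by auto
  then obtain r where r: "0 < r" "ball 0 r \<subseteq> - K" using open_contains_ball by blast
  obtain R0 where R0: "\<And>x. x \<in> K \<Longrightarrow> norm x \<le> R0"
    using compact_imp_bounded[OF assms(1)] by (auto simp: bounded_iff)
  have b: "r \<le> norm x \<and> norm x \<le> max R0 r" if "x \<in> K" for x
    using r(2) R0[OF that] that by (force simp: not_le)
  show ?thesis
  proof (rule that[OF r(1), of "max R0 r"])
    fix x assume x: "x \<in> K"
    then have "x \<noteq> 0" using assms by auto
    have "log 2 r \<le> log 2 (norm x)" "log 2 (norm x) \<le> log 2 (max R0 r)"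
      using b[OF x] r(1) \<open>x \<noteq> 0\<close> by (auto intro!: log_mono simp del: max.bounded_iff)
    then have "\<lceil>log 2 (norm x)\<rceil> \<in> {\<lceil>log 2 r\<rceil>..\<lceil>log 2 (max R0 r)\<rceil>}"
      by (auto intro: ceiling_mono)
    then show "\<exists>k\<in>{\<lceil>log 2 r\<rceil>..\<lceil>log 2 (max R0 r)\<rceil>}. x \<in> dyadic_shell k"
      using dyadic_shell_of_norm[OF \<open>x \<noteq> 0\<close>] by blast
  qed (use b in auto)
qed

section \<open>The operator and its majorant\<close>

text \<open>
  Replacing the \<open>f\<^sub>i\<close> by Borel representatives changes the integrand only on a \<open>t\<close>-null set, for almost
  every \<open>x\<close>. For the representatives the integrand is jointly measurable, so that finiteness of the
  majorant yields integrability, and the operator is a measurable function of \<open>x\<close>.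
\<close>

lemma hausdorff_op_dominated:
  fixes A :: "nat \<Rightarrow> real^'n \<Rightarrow> real^'n^'n" and f g :: "nat \<Rightarrow> real^'n \<Rightarrow> complex"
  assumes \<Phi> [measurable]: "\<Phi> \<in> borel_measurable lebesgue" and \<Phi>0: "\<And>t. 0 \<le> \<Phi> t"
    and A: "\<And>i. i \<in> {1..m} \<Longrightarrow> A i \<in> borel_measurable lebesgue"
    and inv: "AE t in lebesgue. \<Phi> t \<noteq> 0 \<longrightarrow> (\<forall>i\<in>{1..m}. invertible (A i t))"
    and g: "\<And>i. i \<in> {1..m} \<Longrightarrow> g i \<in> borel_measurable borel"
    and fg: "\<And>i. i \<in> {1..m} \<Longrightarrow> AE y in lborel. f i y = g i y"
  defines "F \<equiv> \<lambda>x. \<integral>\<^sup>+t. ennreal (\<Phi> t / norm t ^ CARD('n)) * (\<Prod>i\<in>{1..m}. ennreal (norm (g i (A i t *v x)))) \<partial>lebesgue"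
  assumes fin: "AE x in lborel. F x < top"
  shows "AE x in lebesgue. integrable lebesgue (hausdorff_integrand m \<Phi> A f x)"
    and "hausdorff_op m \<Phi> A f \<in> borel_measurable lebesgue"
    and "AE x in lborel. ennreal (norm (hausdorff_op m \<Phi> A f x)) \<le> F x"
proof -
  interpret T: sigma_finite_measure "lebesgue :: (real^'n) measure" by (rule sigma_finite_lebesgue)
  define I where "I = {1..m}"
  have [measurable]: "i \<in> I \<Longrightarrow> A i \<in> borel_measurable lebesgue" "i \<in> I \<Longrightarrow> g i \<in> borel_measurable borel" for i
    using A g by (auto simp: I_def)
  define w where "w t = \<Phi> t / norm t ^ CARD('n)" for t
  have [measurable]: "w \<in> borel_measurable lebesgue"
    unfolding w_def by (rule borel_measurable_hausdorff_weight[OF \<Phi>])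
  have w0: "0 \<le> w t" for t using \<Phi>0 by (simp add: w_def)
  define h where "h x t = of_real (w t) * (\<Prod>i\<in>I. g i (A i t *v x))" for x t
  have h_pair [measurable]: "(\<lambda>(x, t). h x t) \<in> borel_measurable (lborel \<Otimes>\<^sub>M lebesgue)"
    unfolding h_def by measurable
  have h_t [measurable]: "h x \<in> borel_measurable lebesgue" for x
    unfolding h_def by measurable
  have norm_h: "ennreal (norm (h x t)) = ennreal (w t) * (\<Prod>i\<in>I. ennreal (norm (g i (A i t *v x))))" for x t
    using w0 by (simp add: h_def norm_mult prod_norm[symmetric] ennreal_mult prod_nonneg prod_ennreal)
  then have F: "F x = (\<integral>\<^sup>+t. ennreal (norm (h x t)) \<partial>lebesgue)" for x
    by (simp add: F_def w_def I_def)
  have "AE x in lborel. \<forall>i\<in>I. AE t in lebesgue. \<Phi> t \<noteq> 0 \<longrightarrow> f i (A i t *v x) = g i (A i t *v x)"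
  proof (rule AE_finite_allI)
    fix i assume i: "i \<in> I"
    show "AE x in lborel. AE t in lebesgue. \<Phi> t \<noteq> 0 \<longrightarrow> f i (A i t *v x) = g i (A i t *v x)"
    proof (rule AE_linear_family)
      show "AE t in lebesgue. \<Phi> t \<noteq> 0 \<longrightarrow> invertible (A i t)"
        using inv by eventually_elim (use i in \<open>auto simp: I_def\<close>)
      show "AE y in lborel. f i y = g i y" using fg i unfolding I_def by blast
    qed (use i in auto)
  qed (simp add: I_def)
  then have eq: "AE x in lborel. AE t in lebesgue. hausdorff_integrand m \<Phi> A f x t = h x t"
  proof eventually_elim
    case (elim x)
    then have "AE t in lebesgue. \<forall>i\<in>I. \<Phi> t \<noteq> 0 \<longrightarrow> f i (A i t *v x) = g i (A i t *v x)"
      by (intro AE_finite_allI) (auto simp: I_def)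
    then show ?case
    proof eventually_elim
      case (elim t)
      then show ?case
        by (cases "\<Phi> t = 0") (auto simp: hausdorff_integrand_def h_def w_def I_def)
    qed
  qed
  have good: "AE x in lborel. integrable lebesgue (hausdorff_integrand m \<Phi> A f x) \<and>
      hausdorff_op m \<Phi> A f x = (LINT t|lebesgue. h x t) \<and> integrable lebesgue (h x)"
    using eq fin
  proof eventually_elim
    case (elim x)
    have int: "integrable lebesgue (h x)"
      using elim(2) unfolding F by (intro integrableI_bounded) auto
    have meas: "hausdorff_integrand m \<Phi> A f x \<in> borel_measurable lebesgue"
      by (rule borel_measurable_lebesgue_if_AE_eq[OF elim(1)]) simp
    have "integrable lebesgue (hausdorff_integrand m \<Phi> A f x)"
      using integrable_cong_AE[OF meas h_t elim(1)] int by simp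
    moreover have "hausdorff_op m \<Phi> A f x = (LINT t|lebesgue. h x t)"
      unfolding hausdorff_op_def by (rule integral_cong_AE[OF meas h_t elim(1)])
    ultimately show ?case using int by simp
  qed
  show "AE x in lebesgue. integrable lebesgue (hausdorff_integrand m \<Phi> A f x)"
    unfolding AE_completion_iff using good by eventually_elim simp
  show "hausdorff_op m \<Phi> A f \<in> borel_measurable lebesgue"
  proof (rule borel_measurable_lebesgue_if_AE_eq)
    show "AE x in lebesgue. hausdorff_op m \<Phi> A f x = (LINT t|lebesgue. h x t)"
      unfolding AE_completion_iff using good by eventually_elim simp
    have "(\<lambda>x. LINT t|lebesgue. h x t) \<in> borel_measurable lborel"
      by (rule T.borel_measurable_lebesgue_integral) measurable
    then show "(\<lambda>x. LINT t|lebesgue. h x t) \<in> borel_measurable lebesgue"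
      by (rule measurable_completion)
  qed
  show "AE x in lborel. ennreal (norm (hausdorff_op m \<Phi> A f x)) \<le> F x"
    using good
  proof eventually_elim
    case (elim x)
    then show ?case unfolding F by (metis integral_norm_bound_ennreal)
  qed
qed

lemma AE_finite_of_shells:
  fixes F :: "real^'n \<Rightarrow> ennreal"
  assumes [measurable]: "F \<in> borel_measurable borel" "s \<in> borel_measurable borel"
    and lux: "\<And>k. lux_le lborel s (\<lambda>x. F x * ennreal (norm x powr \<gamma>) * indicator (dyadic_shell k) x) (\<beta> k)"
    and \<beta>: "\<And>k. \<beta> k < top"
  shows "AE x in lborel. F x < top"
proof -
  have "AE x in lborel. \<forall>k. F x * ennreal (norm x powr \<gamma>) * indicator (dyadic_shell k) x < top"
    unfolding AE_all_countable by (intro allI lux_le_imp_AE_finite[OF lux \<beta>]) measurable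
  then show ?thesis using AE_lborel_singleton[of 0]
  proof eventually_elim
    case (elim x)
    have "F x * ennreal (norm x powr \<gamma>) * indicator (dyadic_shell \<lceil>log 2 (norm x)\<rceil>) x < top"
      using elim(1) by blast
    then have "F x * ennreal (norm x powr \<gamma>) < top"
      using dyadic_shell_of_norm[OF elim(2)] by simp
    then show ?case using elim(2) by (auto simp: ennreal_mult_less_top)
  qed
qed

text \<open>
  A compact set avoiding the origin is covered by finitely many shells, and the weight is bounded below
  on it, so the norm over the compact set is bounded by a finite sum of weighted shell norms.
\<close>

lemma Lp_loc_punctured_if_shells:
  fixes F :: "real^'n \<Rightarrow> ennreal" and u :: "real^'n \<Rightarrow> complex"
  assumes q: "\<And>x. q x < top" "q \<in> borel_measurable lebesgue" and qs: "AE x in lborel. q x = ennreal (s x)" "AE x in lborel. 1 \<le> s x"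
    and [measurable]: "F \<in> borel_measurable borel" "s \<in> borel_measurable borel"
    and u [measurable]: "u \<in> borel_measurable lebesgue" and uF: "AE x in lborel. ennreal (norm (u x)) \<le> F x"
    and lux: "\<And>k. lux_le lborel s (\<lambda>x. F x * ennreal (norm x powr \<gamma>) * indicator (dyadic_shell k) x) (\<beta> k)"
    and \<beta>: "\<And>k. \<beta> k < top"
  shows "u \<in> Lp_loc_punctured q"
  unfolding Lp_loc_punctured_def
proof (intro CollectI conjI allI impI u)
  fix K :: "(real^'n) set" assume K: "compact K \<and> K \<subseteq> - {0}"
  have KB: "K \<in> sets lebesgue"
    using K by (metis borel_closed compact_imp_closed sets_completionI_sets sets_lborel)
  obtain r R where rR: "0 < r" "r \<le> R" "\<And>x. x \<in> K \<Longrightarrow> r \<le> norm x \<and> norm x \<le> R"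
    "\<And>x. x \<in> K \<Longrightarrow> \<exists>k\<in>{\<lceil>log 2 r\<rceil>..\<lceil>log 2 R\<rceil>}. x \<in> dyadic_shell k"
    using compact_punctured_dyadic_cover K by metis
  define Z where "Z = {\<lceil>log 2 r\<rceil>..\<lceil>log 2 R\<rceil>}"
  \<comment> \<open>The maximum of the inverse weight on the compact set, for either sign of \<open>\<gamma>\<close>.\<close>
  define c where "c = max (r powr (- \<gamma>)) (R powr (- \<gamma>))"
  have c: "1 \<le> c * norm x powr \<gamma>" if "x \<in> K" for x
  proof -
    have x: "r \<le> norm x" "norm x \<le> R" "0 < norm x" using rR(1) rR(3)[OF that] by auto
    have "norm x powr (- \<gamma>) \<le> c"
    proof (cases "0 \<le> \<gamma>")
      case True
      then have "norm x powr (- \<gamma>) \<le> r powr (- \<gamma>)" using x rR(1) by (intro powr_mono2') auto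
      then show ?thesis by (simp add: c_def)
    next
      case False
      then have "norm x powr (- \<gamma>) \<le> R powr (- \<gamma>)" using x by (intro powr_mono2) auto
      then show ?thesis by (simp add: c_def)
    qed
    then show ?thesis using x(3) by (simp add: powr_minus field_simps)
  qed
  have "lux_le lborel s (\<lambda>x. \<Sum>k\<in>Z. F x * ennreal (norm x powr \<gamma>) * indicator (dyadic_shell k) x) (\<Sum>k\<in>Z. \<beta> k)"
    using qs by (intro lux_le_sum lux lborel.sigma_finite_measure_axioms) (auto simp: Z_def)
  then have "lux_le lborel s (\<lambda>x. ennreal c * (\<Sum>k\<in>Z. F x * ennreal (norm x powr \<gamma>) * indicator (dyadic_shell k) x))
      (ennreal c * (\<Sum>k\<in>Z. \<beta> k))"
    by (rule lux_le_cmult) simp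
  \<comment> \<open>Adding one makes the bound positive, as membership in the space requires.\<close>
  then have "lux_le lborel s (\<lambda>x. ennreal (norm (u x * indicator K x))) (ennreal c * (\<Sum>k\<in>Z. \<beta> k) + 1)"
  proof (rule lux_le_mono)
    show "AE x in lborel. ennreal (norm (u x * indicator K x)) \<le>
      ennreal c * (\<Sum>k\<in>Z. F x * ennreal (norm x powr \<gamma>) * indicator (dyadic_shell k) x)"
      using uF
    proof eventually_elim
      case (elim x)
      show ?case
      proof (cases "x \<in> K")
        case True
        obtain k where k: "k \<in> Z" "x \<in> dyadic_shell k" using rR(4)[OF True] by (auto simp: Z_def)
        have "ennreal (norm (u x * indicator K x)) \<le> 1 * F x" using elim True by simp
        also have "\<dots> \<le> ennreal (c * norm x powr \<gamma>) * F x"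
          using c[OF True] by (intro mult_right_mono) auto
        also have "\<dots> = ennreal c * (F x * ennreal (norm x powr \<gamma>) * indicator (dyadic_shell k) x)"
          using k by (simp add: ennreal_mult' mult_ac c_def le_max_iff_disj)
        also have "\<dots> \<le> ennreal c * (\<Sum>k\<in>Z. F x * ennreal (norm x powr \<gamma>) * indicator (dyadic_shell k) x)"
          by (intro mult_left_mono member_le_sum k(1)) (auto simp: Z_def)
        finally show ?thesis .
      qed simp
    qed
  qed (use qs in \<open>auto elim: eventually_mono\<close>)
  moreover have "ennreal c * (\<Sum>k\<in>Z. \<beta> k) < top"
    using \<beta> by (simp add: ennreal_mult_less_top Z_def)
  then obtain e where e: "ennreal c * (\<Sum>k\<in>Z. \<beta> k) = ennreal e" "0 \<le> e"
    by (cases "ennreal c * (\<Sum>k\<in>Z. \<beta> k)") auto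
  have "ennreal c * (\<Sum>k\<in>Z. \<beta> k) + 1 = ennreal (e + 1)"
    unfolding e(1) using e(2) by simp
  ultimately have "lux_le lborel s (\<lambda>x. ennreal (norm (u x * indicator K x))) (ennreal (e + 1))"
    by simp
  moreover have "lux_le lborel (\<lambda>x. enn2real (q x)) (\<lambda>x. ennreal (norm (u x * indicator K x))) (ennreal (e + 1))
      \<longleftrightarrow> lux_le lborel s (\<lambda>x. ennreal (norm (u x * indicator K x))) (ennreal (e + 1))"
  proof (rule lux_le_cong_AE)
    show "AE x in lborel. enn2real (q x) = s x" using qs by eventually_elim auto
  qed simp
  ultimately have "lux_le lebesgue (\<lambda>x. enn2real (q x)) (\<lambda>x. ennreal (norm (u x * indicator K x))) (ennreal (e + 1))"
    unfolding lux_le_lebesgue_iff by simp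
  then have "Lp_modular q (\<lambda>x. u x * indicator K x / of_real (e + 1)) \<le> 1"
    using q e(2) by (subst Lp_modular_eq_nn_integral) (auto simp: lux_le_def)
  then have "Lp_modular q (\<lambda>x. u x * indicator K x / of_real (e + 1)) < \<infinity>"
    by (rule le_less_trans) simp
  then show "(\<lambda>x. u x * indicator K x) \<in> Lp_var q"
    unfolding Lp_var_def using KB e(2) by (auto intro!: exI[of _ "e + 1"] borel_measurable_times)
qed

section \<open>The boundedness theorem\<close>

theorem theorem3p4:
  fixes m :: nat
    and \<Phi> :: "real^'n \<Rightarrow> real"
    and A :: "nat \<Rightarrow> real^'n \<Rightarrow> real^'n^'n"
    and \<gamma> p :: "nat \<Rightarrow> real"
    and p0 \<zeta> :: real
    and q :: "nat \<Rightarrow> real^'n \<Rightarrow> ennreal"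
    and q0 :: "real^'n \<Rightarrow> ennreal"
    and \<alpha> :: "nat \<Rightarrow> real^'n \<Rightarrow> real"
  assumes "m \<ge> 1"
    and "\<Phi> \<in> borel_measurable lebesgue"
    and "\<forall>t. \<Phi> t \<ge> 0"
    and "\<forall>i\<in>{1..m}. A i \<in> borel_measurable lebesgue"
    and "AE t in lebesgue. t \<in> supp \<Phi> \<longrightarrow> (\<forall>i\<in>{1..m}. invertible (A i t))"
    and "\<forall>i\<in>{1..m}. q i \<in> bounded_variable_exponents"
    and "q0 \<in> bounded_variable_exponents"
    and "\<forall>x. (\<Sum>i=1..m. inverse (q i x)) = inverse (q0 x)"
    and "\<zeta> > 0"
    and "\<forall>i\<in>{1..m}. \<alpha> i \<in> L_infinity \<inter> C_log_0 \<inter> C_log_infinity"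
    and "\<forall>i\<in>{1..m}. \<alpha> i 0 = Lim at_infinity (\<alpha> i)"
    and "\<forall>i\<in>{1..m}. 1 \<le> p i"
    and "1 \<le> p0"
    and "(\<Sum>i=1..m. 1 / p i) = 1 / p0"
    and "AE t in lebesgue. t \<in> supp \<Phi> \<longrightarrow>
           (\<forall>i\<in>{1..m}. (\<forall>x. q i (matrix_inv (A i t) *v x) \<le> ennreal \<zeta> * q i x) \<and>
              Lp_norm (r_exponent (A i t) (q i) \<zeta>) (\<lambda>x. 1) < \<infinity>)"
    and "C4 m \<Phi> A \<gamma> q \<zeta> \<alpha> p0 < \<infinity>"
  shows "\<exists>C::real. \<forall>f :: nat \<Rightarrow> real^'n \<Rightarrow> complex.
           (\<forall>i\<in>{1..m}. f i \<in> herz_space (\<alpha> i) (p i) (\<lambda>x. ennreal \<zeta> * q i x) (\<lambda>x. norm x powr \<gamma> i)) \<longrightarrow>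
           (AE x in lebesgue. integrable lebesgue (hausdorff_integrand m \<Phi> A f x)) \<and>
           hausdorff_op m \<Phi> A f
             \<in> herz_space (\<lambda>x. \<Sum>i=1..m. \<alpha> i x) p0 q0 (\<lambda>x. norm x powr (\<Sum>i=1..m. \<gamma> i)) \<and>
           herz_norm (\<lambda>x. \<Sum>i=1..m. \<alpha> i x) p0 q0 (\<lambda>x. norm x powr (\<Sum>i=1..m. \<gamma> i))
               (hausdorff_op m \<Phi> A f)
             \<le> ennreal C *
               (\<Prod>i=1..m. herz_norm (\<alpha> i) (p i) (\<lambda>x. ennreal \<zeta> * q i x) (\<lambda>x. norm x powr \<gamma> i) (f i))"
proof -
  define I where "I = {1..m}"
  define al where "al i = \<alpha> i 0" for i
  define qm where "qm i = enn2real (essinf lebesgue (q i))" for i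
  define qp where "qp i = enn2real (esssup lebesgue (q i))" for i
  have I: "finite I" "I \<noteq> {}" using assms(1) by (auto simp: I_def)
  have \<Phi>0: "0 \<le> \<Phi> t" for t using assms(3) by simp
  have Am: "A i \<in> borel_measurable lebesgue" if "i \<in> {1..m}" for i using assms(4) that by blast
  have q: "q i \<in> bounded_variable_exponents" if "i \<in> {1..m}" for i using assms(6) that by blast
  have supp: "t \<in> supp \<Phi>" if "\<Phi> t \<noteq> 0" for t
    using that closure_subset[of "{t. \<Phi> t \<noteq> 0}"] by (auto simp: supp_def)
  have "\<exists>s. \<forall>i\<in>{1..m}. s i \<in> borel_measurable borel \<and> (AE x in lborel. q i x = ennreal (s i x)) \<and>
      (AE x in lborel. qm i \<le> s i x \<and> s i x \<le> qp i) \<and> 1 \<le> qm i"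
  proof (rule bchoice, rule ballI)
    fix i assume i: "i \<in> {1..m}"
    obtain u where "u \<in> borel_measurable borel" "AE x in lborel. q i x = ennreal (u x)"
      "AE x in lborel. qm i \<le> u x \<and> u x \<le> qp i" "1 \<le> qm i"
      unfolding qm_def qp_def by (rule borel_representative_exponent[OF q[OF i]])
    then show "\<exists>s. s \<in> borel_measurable borel \<and> (AE x in lborel. q i x = ennreal (s x)) \<and>
      (AE x in lborel. qm i \<le> s x \<and> s x \<le> qp i) \<and> 1 \<le> qm i"
      by (intro exI[of _ u] conjI)
  qed
  then obtain s where s: "\<And>i. i \<in> {1..m} \<Longrightarrow> s i \<in> borel_measurable borel"
      "\<And>i. i \<in> {1..m} \<Longrightarrow> AE x in lborel. q i x = ennreal (s i x)"
      "\<And>i. i \<in> {1..m} \<Longrightarrow> AE x in lborel. qm i \<le> s i x \<and> s i x \<le> qp i" "\<And>i. i \<in> {1..m} \<Longrightarrow> 1 \<le> qm i"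
    by blast
  obtain s0 where s0: "s0 \<in> borel_measurable borel" "AE x in lborel. q0 x = ennreal (s0 x)"
      "AE x in lborel. enn2real (essinf lebesgue q0) \<le> s0 x \<and> s0 x \<le> enn2real (esssup lebesgue q0)"
      "1 \<le> enn2real (essinf lebesgue q0)"
    by (rule borel_representative_exponent[OF assms(7)])
  have s0_ge: "AE x in lborel. 1 \<le> s0 x" using s0(3) by eventually_elim (use s0(4) in auto)
  have s_ge: "AE x in lborel. q i x = ennreal (s i x) \<and> 1 \<le> s i x" if i: "i \<in> {1..m}" for i
    using s(2,3)[OF i] by eventually_elim (use s(4)[OF i] in auto)
  have s_all: "AE x in lborel. \<forall>i\<in>I. q i x = ennreal (s i x) \<and> 1 \<le> s i x"
    by (rule AE_finite_allI[OF I(1)]) (unfold I_def, rule s_ge)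
  \<comment> \<open>The reciprocal relation between the exponents passes to the real-valued representatives.\<close>
  have s01: "AE x in lborel. 1 \<le> s0 x \<and> (\<Sum>i\<in>{1..m}. 1 / s i x) = 1 / s0 x"
    using s_all s0(2) s0_ge
  proof eventually_elim
    case (elim x)
    have "(\<Sum>i\<in>I. inverse (q i x)) = (\<Sum>i\<in>I. ennreal (1 / s i x))"
      using elim(1) by (intro sum.cong) (auto simp: inverse_ennreal inverse_eq_divide)
    also have "\<dots> = ennreal (\<Sum>i\<in>I. 1 / s i x)"
      using elim(1) by (intro sum_ennreal) (auto intro: order_trans[OF zero_le_one])
    finally have "(\<Sum>i\<in>I. inverse (q i x)) = ennreal (\<Sum>i\<in>I. 1 / s i x)" .
    moreover have "(\<Sum>i\<in>I. inverse (q i x)) = inverse (q0 x)"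
      unfolding I_def by (rule assms(8)[rule_format])
    moreover have "inverse (q0 x) = ennreal (1 / s0 x)"
      using elim(2,3) by (simp only: inverse_ennreal inverse_eq_divide)
    ultimately have "ennreal (\<Sum>i\<in>I. 1 / s i x) = ennreal (1 / s0 x)" by (simp only:)
    moreover have "0 \<le> (\<Sum>i\<in>I. 1 / s i x)"
      using elim(1) by (intro sum_nonneg) (auto intro: order_trans[OF zero_le_one])
    ultimately have "(\<Sum>i\<in>I. 1 / s i x) = 1 / s0 x"
      using elim(3) by (subst (asm) ennreal_inj) auto
    then show ?case using elim(3) unfolding I_def by blast
  qed
  have q_ge: "1 \<le> q i x" "q i x < top" if "i \<in> {1..m}" for i x
    using q[OF that] by (auto simp: bounded_variable_exponents_def variable_exponents_def intro: le_less_trans)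
  have q0_lt: "q0 x < top" for x
    using assms(7) by (auto simp: bounded_variable_exponents_def intro: le_less_trans)
  have q0_m: "q0 \<in> borel_measurable lebesgue"
    using assms(7) by (auto simp: bounded_variable_exponents_def variable_exponents_def)
  have q_m: "q i \<in> borel_measurable lebesgue" if "i \<in> {1..m}" for i
    using q[OF that] by (auto simp: bounded_variable_exponents_def variable_exponents_def)

  have "\<exists>K. \<forall>i\<in>{1..m}. \<forall>k x. x \<in> dyadic_shell k \<longrightarrow> \<bar>real_of_int k * \<alpha> i x - real_of_int k * \<alpha> i 0\<bar> \<le> K i"
  proof (rule bchoice, rule ballI)
    fix i assume i: "i \<in> {1..m}"
    then have cls: "\<alpha> i \<in> C_log_0 \<inter> C_log_infinity" and lim: "\<alpha> i 0 = Lim at_infinity (\<alpha> i)"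
      using assms(10,11) by auto
    obtain L where "\<And>k x. x \<in> dyadic_shell k \<Longrightarrow> \<bar>real_of_int k * \<alpha> i x - real_of_int k * \<alpha> i 0\<bar> \<le> L"
      by (rule log_Hoelder_shell_oscillation[OF cls lim]) (rule that)
    then show "\<exists>K. \<forall>k x. x \<in> dyadic_shell k \<longrightarrow> \<bar>real_of_int k * \<alpha> i x - real_of_int k * \<alpha> i 0\<bar> \<le> K"
      by (intro exI[of _ L] allI impI)
  qed
  then obtain K where K': "\<forall>i\<in>{1..m}. \<forall>k x. x \<in> dyadic_shell k \<longrightarrow>
      \<bar>real_of_int k * \<alpha> i x - real_of_int k * \<alpha> i 0\<bar> \<le> K i"
    by (rule exE)
  then have K: "\<bar>real_of_int k * \<alpha> i x - real_of_int k * al i\<bar> \<le> K i"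
    if "i \<in> {1..m}" "x \<in> dyadic_shell k" for i k x
    using that unfolding al_def by (intro K'[rule_format])
  \<comment> \<open>The cost of exchanging the variable index \<open>\<alpha> i\<close> for its value at the origin.\<close>
  define D where "D i = 2 powr K i" for i

  have good: "AE t in lebesgue. \<Phi> t \<noteq> 0 \<longrightarrow> (\<forall>i\<in>{1..m}. invertible (A i t) \<and>
      (AE x in lborel. s i (matrix_inv (A i t) *v x) \<le> \<zeta> * s i x) \<and>
      unit_dilation_norm (s i) \<zeta> (matrix_inv (A i t)) \<le> Lp_norm (r_exponent (A i t) (q i) \<zeta>) (\<lambda>x. 1) \<and>
      Lp_norm (r_exponent (A i t) (q i) \<zeta>) (\<lambda>x. 1) < top)"
    using assms(5,15)
  proof eventually_elim
    case (elim t)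
    show ?case
    proof (intro impI ballI)
      fix i assume \<Phi>t: "\<Phi> t \<noteq> 0" and i: "i \<in> {1..m}"
      have inv: "invertible (A i t)" and dil: "\<And>x. q i (matrix_inv (A i t) *v x) \<le> ennreal \<zeta> * q i x"
        and r: "Lp_norm (r_exponent (A i t) (q i) \<zeta>) (\<lambda>x. 1) < top"
        using elim supp[OF \<Phi>t] i by auto
      have invB: "invertible (matrix_inv (A i t))" by (rule invertible_matrix_inv[OF inv])
      note sge = s_ge[OF i]
      have "AE x in lborel. s i (matrix_inv (A i t) *v x) \<le> \<zeta> * s i x"
        using sge AE_lborel_linear[OF invB sge]
      proof eventually_elim
        case (elim x)
        have "ennreal (s i (matrix_inv (A i t) *v x)) \<le> ennreal (\<zeta> * s i x)"
          using dil[of x] elim assms(9) by (simp add: ennreal_mult)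
        then show ?case using elim assms(9) by (simp add: ennreal_le_iff)
      qed
      then show "invertible (A i t) \<and> (AE x in lborel. s i (matrix_inv (A i t) *v x) \<le> \<zeta> * s i x) \<and>
        unit_dilation_norm (s i) \<zeta> (matrix_inv (A i t)) \<le> Lp_norm (r_exponent (A i t) (q i) \<zeta>) (\<lambda>x. 1) \<and>
        Lp_norm (r_exponent (A i t) (q i) \<zeta>) (\<lambda>x. 1) < top"
        using inv r unit_dilation_norm_le_Lp_norm[OF q[OF i] inv assms(9) s(1)[OF i] s(2)[OF i]] by blast
    qed
  qed
  have good': "AE t in lebesgue. \<Phi> t \<noteq> 0 \<longrightarrow> (\<forall>i\<in>{1..m}. invertible (A i t) \<and>
      (AE x in lborel. s i (matrix_inv (A i t) *v x) \<le> \<zeta> * s i x) \<and>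
      unit_dilation_norm (s i) \<zeta> (matrix_inv (A i t)) < top)"
    using good by eventually_elim (auto intro: le_less_trans)
  have inv: "AE t in lebesgue. \<Phi> t \<noteq> 0 \<longrightarrow> (\<forall>i\<in>{1..m}. invertible (A i t))"
    using good by eventually_elim auto

  define J where "J = (\<integral>\<^sup>+t. ennreal (\<Phi> t / norm t ^ CARD('n)) *
            (\<Prod>i\<in>{1..m}. ennreal (max (norm (A i t) powr (- \<gamma> i)) (norm (matrix_inv (A i t)) powr \<gamma> i) *
                max (\<bar>det (matrix_inv (A i t))\<bar> powr (1 / qp i)) (\<bar>det (matrix_inv (A i t))\<bar> powr (1 / qm i))) *
              unit_dilation_norm (s i) \<zeta> (matrix_inv (A i t)) *
              ennreal (norm (A i t) powr (- al i)) *
              ennreal (\<Sum>r\<in>{Theta m A t - 1..0}. 2 powr (- of_int r * al i))) \<partial>lebesgue)"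
  \<comment> \<open>Monotonicity of the integral suffices, so the integrand of \<open>C4\<close> may be compared without
    knowing that it is measurable.\<close>
  have "J \<le> C4 m \<Phi> A \<gamma> q \<zeta> \<alpha> p0"
    unfolding J_def C4_def
    using good
  proof (intro nn_integral_mono_AE, eventually_elim)
    case (elim t)
    show ?case
    proof (cases "\<Phi> t = 0")
      case False
      then have "Theta m A t \<le> -1"
        using Theta_eq(3)[of m A t] assms(1) elim by auto
      then have "1 \<le> (2 - of_int (Theta m A t)) powr (real m - 1 / p0)"
        using assms(1,13) by (intro ge_one_powr_ge_zero) (auto simp: field_simps intro: order_trans[of _ p0])
      then have "1 * (\<Phi> t / norm t ^ CARD('n)) \<le> (2 - of_int (Theta m A t)) powr (real m - 1 / p0) * (\<Phi> t / norm t ^ CARD('n))"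
        using \<Phi>0[of t] by (intro mult_right_mono) auto
      moreover have "unit_dilation_norm (s i) \<zeta> (matrix_inv (A i t)) \<le> Lp_norm (r_exponent (A i t) (q i) \<zeta>) (\<lambda>x. 1)"
        if "i \<in> {1..m}" for i
        using elim False that by blast
      ultimately show ?thesis
        unfolding c_const_def qm_def qp_def al_def
        by (intro mult_mono prod_mono_ennreal ennreal_leI order_refl) auto
    qed simp
  qed
  then have J: "J < top" using assms(16) by (auto intro: le_less_trans)

  define C1 :: ennreal where "C1 = of_nat m * of_nat m * (\<Prod>i\<in>{1..m}. 2 * ennreal (D i * 2 powr \<bar>al i\<bar>))"
  define D0 where "D0 = 2 powr (\<Sum>i\<in>{1..m}. K i)"
  define C where "C = ennreal D0 * (C1 * J)"
  have C1: "C1 < top"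
    unfolding C1_def by (intro ennreal_mult_less_top[THEN iffD2] disjI2 conjI prod_less_top_ennreal) (auto simp: of_nat_less_top)
  then have C: "C < top"
    using J by (simp add: C_def ennreal_mult_less_top)

  show ?thesis
  proof (intro exI[of _ "enn2real C"] allI impI)
    fix f :: "nat \<Rightarrow> real^'n \<Rightarrow> complex"
    assume f: "\<forall>i\<in>{1..m}. f i \<in> herz_space (\<alpha> i) (p i) (\<lambda>x. ennreal \<zeta> * q i x) (\<lambda>x. norm x powr \<gamma> i)"
    define H where "H i = herz_norm (\<alpha> i) (p i) (\<lambda>x. ennreal \<zeta> * q i x) (\<lambda>x. norm x powr \<gamma> i) (f i)" for i
    define fk where "fk i j = (\<lambda>x. of_real (2 powr (of_int j * \<alpha> i x)) * f i x * indicator (dyadic_shell j) x)" for i j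
    define a where "a i j = weighted_Lp_norm (\<lambda>x. ennreal \<zeta> * q i x) (\<lambda>x. norm x powr \<gamma> i) (fk i j)" for i j
    have Hfin: "H i < top" and f_m: "f i \<in> borel_measurable lebesgue" if "i \<in> {1..m}" for i
      using f that by (auto simp: herz_space_def H_def Lp_loc_punctured_def)
    have p1: "1 \<le> p i" if "i \<in> {1..m}" for i using assms(12) that by blast
    have a_lux: "lux_le (count_space UNIV) (\<lambda>_. p i) (a i) (H i)" if "i \<in> {1..m}" for i
      unfolding a_def fk_def H_def by (subst herz_norm_le_iff[OF p1[OF that], symmetric]) simp
    have a_fin: "a i j < top" if "i \<in> {1..m}" for i j
      using lux_le_imp_AE_finite[OF a_lux[OF that] Hfin[OF that]] by (simp add: AE_count_space)
    have "\<exists>g. \<forall>i\<in>{1..m}. g i \<in> borel_measurable borel \<and> (AE x in lborel. f i x = g i x)"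
    proof (rule bchoice, rule ballI)
      fix i assume i: "i \<in> {1..m}"
      obtain u where "u \<in> borel_measurable borel" "AE x in lborel. f i x = u x"
        by (rule borel_representative_complex[OF f_m[OF i]])
      then show "\<exists>g. g \<in> borel_measurable borel \<and> (AE x in lborel. f i x = g x)"
        by (intro exI[of _ u] conjI)
    qed
    then obtain g where g: "\<And>i. i \<in> {1..m} \<Longrightarrow> g i \<in> borel_measurable borel"
      "\<And>i. i \<in> {1..m} \<Longrightarrow> AE x in lborel. f i x = g i x" by blast
    define G where "G i x = ennreal (norm (g i x))" for i x
    \<comment> \<open>The shell norms of the Borel representatives, with the index frozen at the origin.\<close>
    have GN: "lux_le lborel (\<lambda>x. \<zeta> * s i x)
        (\<lambda>y. G i y * ennreal (norm y powr \<gamma> i) * indicator (dyadic_shell j) y)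
        (ennreal (D i * 2 powr (- (of_int j * al i))) * a i j)" if i: "i \<in> {1..m}" for i j
    proof -
      let ?u = "\<lambda>x. fk i j x * of_real (norm x powr \<gamma> i)"
      have "(\<lambda>x::real^'n. complex_of_real (norm x powr \<gamma> i)) \<in> borel_measurable lebesgue"
        "(\<lambda>x::real^'n. indicator (dyadic_shell j) x :: complex) \<in> borel_measurable lebesgue"
        by (rule measurable_completion, measurable)+
      moreover have "\<alpha> i \<in> borel_measurable lebesgue" using assms(10) i by (auto simp: L_infinity_def)
      ultimately have u_m: "?u \<in> borel_measurable lebesgue"
        using f_m[OF i] unfolding fk_def by measurable
      have "lux_le lebesgue (\<lambda>x. enn2real (ennreal \<zeta> * q i x)) (\<lambda>x. ennreal (norm (?u x))) (a i j)"
        unfolding a_def weighted_Lp_norm_def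
      proof (rule lux_le_Lp_norm[OF u_m])
        show "(\<lambda>x. ennreal \<zeta> * q i x) \<in> borel_measurable lebesgue" using q_m[OF i] by measurable
        show "0 < ennreal \<zeta> * q i x" for x
          using q_ge(1)[OF i, of x] assms(9) by (auto simp: ennreal_zero_less_mult_iff intro: less_le_trans[OF zero_less_one])
        show "ennreal \<zeta> * q i x < \<infinity>" for x
          using q_ge(2)[OF i, of x] by (simp add: ennreal_mult_less_top)
      qed
      moreover have "AE x in lborel. enn2real (ennreal \<zeta> * q i x) = \<zeta> * s i x"
        using s_ge[OF i] by eventually_elim (use assms(9) in \<open>simp add: enn2real_mult\<close>)
      ultimately have "lux_le lborel (\<lambda>x. \<zeta> * s i x) (\<lambda>x. ennreal (norm (?u x))) (a i j)"
        unfolding lux_le_lebesgue_iff by (rule lux_le_cong_AE[OF AE_I2[OF refl], THEN iffD1, rotated])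
      then have "lux_le lborel (\<lambda>x. \<zeta> * s i x) (\<lambda>x. ennreal (D i * 2 powr (- (of_int j * al i))) * ennreal (norm (?u x)))
          (ennreal (D i * 2 powr (- (of_int j * al i))) * a i j)"
        by (rule lux_le_cmult) simp
      then show ?thesis
      proof (rule lux_le_mono)
        show "AE y in lborel. G i y * ennreal (norm y powr \<gamma> i) * indicator (dyadic_shell j) y
          \<le> ennreal (D i * 2 powr (- (of_int j * al i))) * ennreal (norm (?u y))"
          using g(2)[OF i]
        proof eventually_elim
          case (elim y)
          show ?case
          proof (cases "y \<in> dyadic_shell j")
            case True
            have "0 \<le> K i + (- (of_int j * al i)) + of_int j * \<alpha> i y"
              using K[OF i True] by linarith
            then have "2 powr 0 \<le> (2::real) powr (K i + (- (of_int j * al i)) + of_int j * \<alpha> i y)"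
              by (intro powr_mono) auto
            also have "\<dots> = D i * 2 powr (- (of_int j * al i)) * 2 powr (of_int j * \<alpha> i y)"
              by (simp only: powr_add D_def)
            finally have *: "1 \<le> D i * 2 powr (- (of_int j * al i)) * 2 powr (of_int j * \<alpha> i y)" by simp
            have "1 * (norm (g i y) * norm y powr \<gamma> i)
              \<le> D i * 2 powr (- (of_int j * al i)) * 2 powr (of_int j * \<alpha> i y) * (norm (g i y) * norm y powr \<gamma> i)"
              by (rule mult_right_mono[OF *]) simp
            then have "ennreal (norm (g i y) * norm y powr \<gamma> i)
              \<le> ennreal (D i * 2 powr (- (of_int j * al i)) * norm (?u y))"
              using True elim by (intro ennreal_leI) (simp add: fk_def norm_mult mult_ac)
            then show ?thesis using True by (simp add: G_def ennreal_mult D_def)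
          qed simp
        qed
        show "AE x in lborel. 0 \<le> \<zeta> * s i x"
          using s_ge[OF i] by eventually_elim (use assms(9) in simp)
      qed simp
    qed
    have G_m: "G i \<in> borel_measurable borel" if "i \<in> {1..m}" for i
      using g(1)[OF that] unfolding G_def by measurable
    define F where "F x = (\<integral>\<^sup>+t. ennreal (\<Phi> t / norm t ^ CARD('n)) * (\<Prod>i\<in>{1..m}. G i (A i t *v x)) \<partial>lebesgue)" for x
    obtain \<beta> where \<beta>: "\<And>k. lux_le lborel s0 (\<lambda>x. F x * ennreal (norm x powr (\<Sum>i\<in>{1..m}. \<gamma> i)) * indicator (dyadic_shell k) x) (\<beta> k)"
      and \<beta>_lux: "lux_le (count_space UNIV) (\<lambda>_. p0) (\<lambda>k. ennreal (2 powr (of_int k * (\<Sum>i\<in>{1..m}. al i))) * \<beta> k)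
        (C1 * (\<Prod>i\<in>{1..m}. H i) * J)"
      using hausdorff_shell_estimates[OF assms(1,2) \<Phi>0 Am good' s(1) s0(1) s(4,3) s01 p1 assms(13,14) _ G_m GN a_fin a_lux]
      unfolding F_def C1_def J_def by (auto simp: D_def)
    have Hprod: "(\<Prod>i\<in>{1..m}. H i) < top"
      using Hfin by (rule prod_less_top_ennreal)
    have bound_fin: "C1 * (\<Prod>i\<in>{1..m}. H i) * J < top"
      using C1 Hprod J by (simp add: ennreal_mult_less_top)
    have \<beta>_fin: "\<beta> k < top" for k
    proof -
      have "ennreal (2 powr (of_int k * (\<Sum>i\<in>{1..m}. al i))) * \<beta> k < top"
        using lux_le_imp_AE_finite[OF \<beta>_lux bound_fin] by (simp add: AE_count_space)
      then show ?thesis by (cases "\<beta> k = 0") (auto simp: ennreal_mult_less_top)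
    qed
    have F_m: "F \<in> borel_measurable borel"
      unfolding F_def by (rule measurable_dilated_product_integral[OF assms(2) Am G_m])
    have F_fin: "AE x in lborel. F x < top"
      by (rule AE_finite_of_shells[OF F_m s0(1) \<beta> \<beta>_fin])
    note dom = hausdorff_op_dominated[OF assms(2) \<Phi>0 Am inv g F_fin[unfolded F_def G_def]]
    have op: "AE x in lebesgue. integrable lebesgue (hausdorff_integrand m \<Phi> A f x)"
      "hausdorff_op m \<Phi> A f \<in> borel_measurable lebesgue"
      "AE x in lborel. ennreal (norm (hausdorff_op m \<Phi> A f x)) \<le> F x"
      unfolding F_def G_def by (rule dom(1), assumption+, rule dom(2), assumption+, rule dom(3), assumption+)
    have loc: "hausdorff_op m \<Phi> A f \<in> Lp_loc_punctured q0"
      by (rule Lp_loc_punctured_if_shells[OF q0_lt q0_m s0(2) s0_ge F_m s0(1) op(2,3) \<beta> \<beta>_fin])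
    define \<alpha>0 where "\<alpha>0 x = (\<Sum>i=1..m. \<alpha> i x)" for x
    define b where "b k = weighted_Lp_norm q0 (\<lambda>x. norm x powr (\<Sum>i=1..m. \<gamma> i))
        (\<lambda>x. of_real (2 powr (of_int k * \<alpha>0 x)) * hausdorff_op m \<Phi> A f x * indicator (dyadic_shell k) x)" for k
    \<comment> \<open>The variable index is restored for the image function.\<close>
    have b_le: "b k \<le> ennreal D0 * (ennreal (2 powr (of_int k * (\<Sum>i\<in>{1..m}. al i))) * \<beta> k)" for k
    proof -
      let ?u = "\<lambda>x. of_real (2 powr (of_int k * \<alpha>0 x)) * hausdorff_op m \<Phi> A f x * indicator (dyadic_shell k) x *
        of_real (norm x powr (\<Sum>i=1..m. \<gamma> i)) :: complex"
      let ?c = "D0 * 2 powr (of_int k * (\<Sum>i\<in>{1..m}. al i))"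
      have "lux_le lborel s0 (\<lambda>x. ennreal ?c * (F x * ennreal (norm x powr (\<Sum>i\<in>{1..m}. \<gamma> i)) * indicator (dyadic_shell k) x))
         (ennreal ?c * \<beta> k)"
        by (rule lux_le_cmult[OF \<beta>]) simp
      then have "lux_le lborel s0 (\<lambda>x. ennreal (norm (?u x))) (ennreal ?c * \<beta> k)"
      proof (rule lux_le_mono)
        show "AE x in lborel. ennreal (norm (?u x)) \<le> ennreal ?c * (F x * ennreal (norm x powr (\<Sum>i\<in>{1..m}. \<gamma> i)) * indicator (dyadic_shell k) x)"
          using op(3)
        proof eventually_elim
          case (elim x)
          show ?case
          proof (cases "x \<in> dyadic_shell k")
            case True
            have "of_int k * \<alpha>0 x - of_int k * (\<Sum>i\<in>{1..m}. al i) = (\<Sum>i\<in>{1..m}. of_int k * \<alpha> i x - of_int k * al i)"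
              by (simp add: \<alpha>0_def sum_subtractf sum_distrib_left)
            also have "\<dots> \<le> (\<Sum>i\<in>{1..m}. K i)"
              using K[OF _ True] by (intro sum_mono) (auto dest!: abs_le_D1)
            finally have "2 powr (of_int k * \<alpha>0 x) \<le> 2 powr ((\<Sum>i\<in>{1..m}. K i) + of_int k * (\<Sum>i\<in>{1..m}. al i))"
              by (intro powr_mono) auto
            also have "\<dots> = ?c" by (simp add: powr_add D0_def)
            finally have "ennreal (2 powr (of_int k * \<alpha>0 x)) * ennreal (norm (hausdorff_op m \<Phi> A f x)) \<le> ennreal ?c * F x"
              using elim by (intro mult_mono ennreal_leI) auto
            then have "ennreal (2 powr (of_int k * \<alpha>0 x)) * ennreal (norm (hausdorff_op m \<Phi> A f x)) * ennreal (norm x powr (\<Sum>i\<in>{1..m}. \<gamma> i))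
              \<le> ennreal ?c * F x * ennreal (norm x powr (\<Sum>i\<in>{1..m}. \<gamma> i))"
              by (rule mult_right_mono) simp
            then show ?thesis using True by (simp add: norm_mult ennreal_mult mult.assoc)
          qed simp
        qed
        show "AE x in lborel. 0 \<le> s0 x" using s0_ge by eventually_elim simp
      qed simp
      moreover have "AE x in lborel. s0 x = enn2real (q0 x)"
        using s0(2) s0_ge by eventually_elim simp
      ultimately have "lux_le lebesgue (\<lambda>x. enn2real (q0 x)) (\<lambda>x. ennreal (norm (?u x))) (ennreal ?c * \<beta> k)"
        unfolding lux_le_lebesgue_iff by (rule lux_le_cong_AE[OF AE_I2[OF refl], THEN iffD1, rotated])
      then have "b k \<le> ennreal ?c * \<beta> k"
        unfolding b_def weighted_Lp_norm_def using q0_lt by (intro Lp_norm_le_if_lux_le) auto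
      then show ?thesis by (simp add: ennreal_mult D0_def mult.assoc)
    qed
    have "lux_le (count_space UNIV) (\<lambda>_. p0) (\<lambda>k. ennreal D0 * (ennreal (2 powr (of_int k * (\<Sum>i\<in>{1..m}. al i))) * \<beta> k))
      (ennreal D0 * (C1 * (\<Prod>i\<in>{1..m}. H i) * J))"
      by (rule lux_le_cmult[OF \<beta>_lux]) simp
    then have "lux_le (count_space UNIV) (\<lambda>_. p0) b (ennreal D0 * (C1 * (\<Prod>i\<in>{1..m}. H i) * J))"
      by (rule lux_le_mono) (use b_le assms(13) in auto)
    then have "herz_norm \<alpha>0 p0 q0 (\<lambda>x. norm x powr (\<Sum>i=1..m. \<gamma> i)) (hausdorff_op m \<Phi> A f)
        \<le> ennreal D0 * (C1 * (\<Prod>i\<in>{1..m}. H i) * J)"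
      unfolding herz_norm_le_iff[OF assms(13)] b_def .
    also have "\<dots> = C * (\<Prod>i\<in>{1..m}. H i)" by (simp add: C_def mult_ac)
    finally have herz: "herz_norm \<alpha>0 p0 q0 (\<lambda>x. norm x powr (\<Sum>i=1..m. \<gamma> i)) (hausdorff_op m \<Phi> A f)
        \<le> ennreal (enn2real C) * (\<Prod>i\<in>{1..m}. H i)"
      using C by simp
    moreover have "ennreal (enn2real C) * (\<Prod>i\<in>{1..m}. H i) < top"
      using Hprod by (simp add: ennreal_mult_less_top)
    ultimately show "(AE x in lebesgue. integrable lebesgue (hausdorff_integrand m \<Phi> A f x)) \<and>
           hausdorff_op m \<Phi> A f
             \<in> herz_space (\<lambda>x. \<Sum>i=1..m. \<alpha> i x) p0 q0 (\<lambda>x. norm x powr (\<Sum>i=1..m. \<gamma> i)) \<and>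
           herz_norm (\<lambda>x. \<Sum>i=1..m. \<alpha> i x) p0 q0 (\<lambda>x. norm x powr (\<Sum>i=1..m. \<gamma> i))
               (hausdorff_op m \<Phi> A f)
             \<le> ennreal (enn2real C) *
               (\<Prod>i=1..m. herz_norm (\<alpha> i) (p i) (\<lambda>x. ennreal \<zeta> * q i x) (\<lambda>x. norm x powr \<gamma> i) (f i))"
      using op(1) loc unfolding herz_space_def H_def \<alpha>0_def by (auto intro: le_less_trans)
  qed
qed

end
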